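(* Let $X$ be a smooth algebraic variety over $\mathbb{C}$ and let $\omega:\mathcal{L}\to\Omega^1_X$ be a codimension $1$ foliation on $X$. Let $\mathcal{J}=\mathcal{J}(\omega)$ be the ideal sheaf of the singular set of $\omega$, $\mathcal{K}=\mathcal{K}(\omega)$ the ideal sheaf of the Kupka singularities of $\omega$, and $\mathcal{I}=\mathcal{I}(\omega)$ the ideal sheaf of the persistent singularities of $\omega$. Then $$\mathcal{J}\subseteq\mathcal{I}\subseteq\mathcal{K}.$$
   Context: A codimension $1$ foliation on $X$ (with $\dim X\ge 2$) is a line bundle $\mathcal{L}$ on $X$ together with a non-trivial $\mathcal{O}_X$-linear morphism $\omega:\mathcal{L}\to\Omega^1_X$ such that $\Omega^1_X/\mathcal{L}$ is torsion free and $\omega(s)\wedge d(\omega(s))=0$ for every local section $s$ of $\mathcal{L}$. Throughout, $\varpi$ denotes a local generator of the image of $\omega$ (a local $1$-form); the ideals below do not depend on its choice. $\mathcal{J}(\omega)$ is the image of the morphism $TX\otimes\mathcal{L}\to\mathcal{O}_X$, $v\otimes s\mapsto i_v\,\omega(s)$ (contraction). The closed subscheme it defines is $\mathrm{Sing}(\omega)$. $\mathcal{I}(\omega)$ is the annihilator of the class $[d\omega]$, a global section of $\mathcal{H}^2(\omega)\otimes\mathcal{L}$ given locally by $d\varpi$, where $\mathcal{H}^2(\omega)$ is the degree $2$ cohomology sheaf of the Koszul complex $\mathcal{O}_X\xrightarrow{\wedge\omega}\Omega^1_X\otimes\mathcal{L}^{-1}\xrightarrow{\wedge\omega}\Omega^2_X\otimes\mathcal{L}^{-2}\to\cdots$.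 Equivalently, a local function $h$ belongs to $\mathcal{I}(\omega)$ iff locally there is a $1$-form $\eta$ with $h\,d\varpi=\varpi\wedge\eta$. It defines the subscheme of persistent singularities. $\mathcal{K}(\omega)$ is the annihilator of the global section $\{d\omega\}$ of $\Omega^2_X\otimes\mathcal{O}_{\mathrm{Sing}(\omega)}\otimes\mathcal{L}^{-1}$ given locally by the class of $d\varpi$. Equivalently, $h\in\mathcal{K}(\omega)$ iff $h\,d\varpi\in\mathcal{J}(\omega)\cdot\Omega^2_X$ locally. It defines the subscheme of Kupka singularities. *)

theory Defs
  imports
    "HOL-Analysis.Analysis"
    "HOL-Library.Extended_Nat"
    "HOL-Library.Function_Algebras"
    "HOL-Algebra.Module"
    "HOL-Algebra.AbelCoset"
begin

section \<open>Module constructions\<close>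

text \<open>
  In the records of modules below the ring components \<open>mult\<close> and \<open>one\<close> of the library's
  module record are irrelevant and left undefined.
\<close>

definition regular_module :: "('r, 'e) ring_scheme \<Rightarrow> ('r, 'r) module" where
  "regular_module R =
     \<lparr>carrier = carrier R, mult = undefined, one = undefined,
      zero = zero R, add = add R, smult = mult R\<rparr>"

definition free_module :: "('r, 'e) ring_scheme \<Rightarrow> 's set \<Rightarrow> ('r, 's \<Rightarrow> 'r) module" where
  "free_module R S =
     \<lparr>carrier = {\<phi>. (\<forall>s\<in>S. \<phi> s \<in> carrier R) \<and> (\<forall>s. s \<notin> S \<longrightarrow> \<phi> s = \<zero>\<^bsub>R\<^esub>)
                     \<and> finite {s. \<phi> s \<noteq> \<zero>\<^bsub>R\<^esub>}},
      mult = undefined, one = undefined,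
      zero = (\<lambda>s. \<zero>\<^bsub>R\<^esub>),
      add = (\<lambda>\<phi> \<psi> s. \<phi> s \<oplus>\<^bsub>R\<^esub> \<psi> s),
      smult = (\<lambda>r \<phi> s. r \<otimes>\<^bsub>R\<^esub> \<phi> s)\<rparr>"

definition fgen :: "('r, 'e) ring_scheme \<Rightarrow> 's \<Rightarrow> 's \<Rightarrow> 'r" where
  "fgen R s = (\<lambda>t. if t = s then \<one>\<^bsub>R\<^esub> else \<zero>\<^bsub>R\<^esub>)"

definition submodule_gen ::
    "('r, 'e) ring_scheme \<Rightarrow> ('r, 'm) module \<Rightarrow> 'm set \<Rightarrow> 'm set" where
  "submodule_gen R M S = \<Inter>{N. submodule N R M \<and> S \<subseteq> N}"

definition quotient_module :: "('r, 'm) module \<Rightarrow> 'm set \<Rightarrow> ('r, 'm set) module" where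
  "quotient_module M N =
     \<lparr>carrier = a_rcosets\<^bsub>M\<^esub> N, mult = undefined, one = undefined,
      zero = N, add = set_add M,
      smult = (\<lambda>r C. \<Union>c\<in>C. N +>\<^bsub>M\<^esub> (r \<odot>\<^bsub>M\<^esub> c))\<rparr>"

text \<open>Intended for modules over an integral domain.\<close>
definition torsion_free :: "('r, 'e) ring_scheme \<Rightarrow> ('r, 'm) module \<Rightarrow> bool" where
  "torsion_free R M \<longleftrightarrow>
     (\<forall>r\<in>carrier R. \<forall>m\<in>carrier M. r \<odot>\<^bsub>M\<^esub> m = \<zero>\<^bsub>M\<^esub> \<longrightarrow> r = \<zero>\<^bsub>R\<^esub> \<or> m = \<zero>\<^bsub>M\<^esub>)"

subsection \<open>Tensor products\<close>

definition tensor_relations ::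
    "('r, 'e) ring_scheme \<Rightarrow> ('r, 'm) module \<Rightarrow> ('r, 'n) module \<Rightarrow> ('m \<times> 'n \<Rightarrow> 'r) set" where
  "tensor_relations R M N = (let F = free_module R (carrier M \<times> carrier N) in
     {fgen R (m \<oplus>\<^bsub>M\<^esub> m', n) \<ominus>\<^bsub>F\<^esub> (fgen R (m, n) \<oplus>\<^bsub>F\<^esub> fgen R (m', n)) | m m' n.
        m \<in> carrier M \<and> m' \<in> carrier M \<and> n \<in> carrier N} \<union>
     {fgen R (m, n \<oplus>\<^bsub>N\<^esub> n') \<ominus>\<^bsub>F\<^esub> (fgen R (m, n) \<oplus>\<^bsub>F\<^esub> fgen R (m, n')) | m n n'.
        m \<in> carrier M \<and> n \<in> carrier N \<and> n' \<in> carrier N} \<union>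
     {fgen R (r \<odot>\<^bsub>M\<^esub> m, n) \<ominus>\<^bsub>F\<^esub> (r \<odot>\<^bsub>F\<^esub> fgen R (m, n)) | r m n.
        r \<in> carrier R \<and> m \<in> carrier M \<and> n \<in> carrier N} \<union>
     {fgen R (m, r \<odot>\<^bsub>N\<^esub> n) \<ominus>\<^bsub>F\<^esub> (r \<odot>\<^bsub>F\<^esub> fgen R (m, n)) | r m n.
        r \<in> carrier R \<and> m \<in> carrier M \<and> n \<in> carrier N})"

definition tensor_kernel ::
    "('r, 'e) ring_scheme \<Rightarrow> ('r, 'm) module \<Rightarrow> ('r, 'n) module \<Rightarrow> ('m \<times> 'n \<Rightarrow> 'r) set" where
  "tensor_kernel R M N =
     submodule_gen R (free_module R (carrier M \<times> carrier N)) (tensor_relations R M N)"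

definition tensor_module ::
    "('r, 'e) ring_scheme \<Rightarrow> ('r, 'm) module \<Rightarrow> ('r, 'n) module
       \<Rightarrow> ('r, ('m \<times> 'n \<Rightarrow> 'r) set) module" where
  "tensor_module R M N =
     quotient_module (free_module R (carrier M \<times> carrier N)) (tensor_kernel R M N)"

definition pure_tensor ::
    "('r, 'e) ring_scheme \<Rightarrow> ('r, 'm) module \<Rightarrow> ('r, 'n) module \<Rightarrow> 'm \<Rightarrow> 'n
       \<Rightarrow> ('m \<times> 'n \<Rightarrow> 'r) set" where
  "pure_tensor R M N m n =
     tensor_kernel R M N +>\<^bsub>free_module R (carrier M \<times> carrier N)\<^esub> fgen R (m, n)"

subsection \<open>Exterior powers\<close>

definition ext_tuples :: "('r, 'm) module \<Rightarrow> nat \<Rightarrow> 'm list set" where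
  "ext_tuples M k = {ms. length ms = k \<and> set ms \<subseteq> carrier M}"

definition ext_relations ::
    "('r, 'e) ring_scheme \<Rightarrow> ('r, 'm) module \<Rightarrow> nat \<Rightarrow> ('m list \<Rightarrow> 'r) set" where
  "ext_relations R M k = (let T = ext_tuples M k; F = free_module R T in
     {fgen R (xs @ (m \<oplus>\<^bsub>M\<^esub> m') # ys)
        \<ominus>\<^bsub>F\<^esub> (fgen R (xs @ m # ys) \<oplus>\<^bsub>F\<^esub> fgen R (xs @ m' # ys)) | xs ys m m'.
        xs @ m # ys \<in> T \<and> m' \<in> carrier M} \<union>
     {fgen R (xs @ (r \<odot>\<^bsub>M\<^esub> m) # ys) \<ominus>\<^bsub>F\<^esub> (r \<odot>\<^bsub>F\<^esub> fgen R (xs @ m # ys)) | xs ys r m.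
        xs @ m # ys \<in> T \<and> r \<in> carrier R} \<union>
     {fgen R ms | ms. ms \<in> T \<and> \<not> distinct ms})"

definition ext_kernel ::
    "('r, 'e) ring_scheme \<Rightarrow> ('r, 'm) module \<Rightarrow> nat \<Rightarrow> ('m list \<Rightarrow> 'r) set" where
  "ext_kernel R M k = submodule_gen R (free_module R (ext_tuples M k)) (ext_relations R M k)"

definition ext_power ::
    "('r, 'e) ring_scheme \<Rightarrow> ('r, 'm) module \<Rightarrow> nat \<Rightarrow> ('r, ('m list \<Rightarrow> 'r) set) module" where
  "ext_power R M k = quotient_module (free_module R (ext_tuples M k)) (ext_kernel R M k)"

text \<open>\<open>wedge R M [m\<^sub>1, \<dots>, m\<^sub>k]\<close> is \<open>m\<^sub>1 \<and> \<dots> \<and> m\<^sub>k\<close>.\<close>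
definition wedge ::
    "('r, 'e) ring_scheme \<Rightarrow> ('r, 'm) module \<Rightarrow> 'm list \<Rightarrow> ('m list \<Rightarrow> 'r) set" where
  "wedge R M ms =
     ext_kernel R M (length ms) +>\<^bsub>free_module R (ext_tuples M (length ms))\<^esub> fgen R ms"

text \<open>
  The map \<open>\<theta> \<mapsto> w \<and> \<theta>\<close> from degree \<open>k\<close> to degree \<open>k + 1\<close>, computed on an arbitrary
  representative \<open>\<Sum> \<phi>(ms) [ms]\<close> of \<open>\<theta>\<close>; the value is independent of the representative.
\<close>
definition wedge_left ::
    "('r, 'e) ring_scheme \<Rightarrow> ('r, 'm) module \<Rightarrow> nat \<Rightarrow> 'm
       \<Rightarrow> ('m list \<Rightarrow> 'r) set \<Rightarrow> ('m list \<Rightarrow> 'r) set" where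
  "wedge_left R M k w \<theta> = (THE \<theta>'. \<exists>\<phi>\<in>\<theta>. \<theta>' =
     finsum (ext_power R M (Suc k))
       (\<lambda>ms. \<phi> ms \<odot>\<^bsub>ext_power R M (Suc k)\<^esub> wedge R M (w # ms)) {ms. \<phi> ms \<noteq> \<zero>\<^bsub>R\<^esub>})"

subsection \<open>The Koszul complex of an element\<close>

definition koszul_cycles ::
    "('r, 'e) ring_scheme \<Rightarrow> ('r, 'm) module \<Rightarrow> 'm \<Rightarrow> nat \<Rightarrow> ('m list \<Rightarrow> 'r) set set" where
  "koszul_cycles R M w k =
     {\<theta> \<in> carrier (ext_power R M k). wedge_left R M k w \<theta> = \<zero>\<^bsub>ext_power R M (Suc k)\<^esub>}"

fun koszul_boundaries ::
    "('r, 'e) ring_scheme \<Rightarrow> ('r, 'm) module \<Rightarrow> 'm \<Rightarrow> nat \<Rightarrow> ('m list \<Rightarrow> 'r) set set" where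
  "koszul_boundaries R M w 0 = {\<zero>\<^bsub>ext_power R M 0\<^esub>}"
| "koszul_boundaries R M w (Suc k) = wedge_left R M k w ` carrier (ext_power R M k)"

definition koszul_cohomology ::
    "('r, 'e) ring_scheme \<Rightarrow> ('r, 'm) module \<Rightarrow> 'm \<Rightarrow> nat
       \<Rightarrow> ('r, ('m list \<Rightarrow> 'r) set set) module" where
  "koszul_cohomology R M w k =
     quotient_module ((ext_power R M k)\<lparr>carrier := koszul_cycles R M w k\<rparr>)
       (koszul_boundaries R M w k)"

definition koszul_class ::
    "('r, 'e) ring_scheme \<Rightarrow> ('r, 'm) module \<Rightarrow> 'm \<Rightarrow> nat \<Rightarrow> ('m list \<Rightarrow> 'r) set
       \<Rightarrow> ('m list \<Rightarrow> 'r) set set" where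
  "koszul_class R M w k \<theta> = koszul_boundaries R M w k +>\<^bsub>ext_power R M k\<^esub> \<theta>"

subsection \<open>Kaehler differentials\<close>

text \<open>Differentials of a ring \<open>R\<close> relative to a subring \<open>k\<close> of constants.\<close>

definition kaehler_relations ::
    "('r, 'e) ring_scheme \<Rightarrow> 'r set \<Rightarrow> ('r \<Rightarrow> 'r) set" where
  "kaehler_relations R k = (let F = free_module R (carrier R) in
     {fgen R (a \<oplus>\<^bsub>R\<^esub> b) \<ominus>\<^bsub>F\<^esub> (fgen R a \<oplus>\<^bsub>F\<^esub> fgen R b) | a b.
        a \<in> carrier R \<and> b \<in> carrier R} \<union>
     {fgen R (a \<otimes>\<^bsub>R\<^esub> b) \<ominus>\<^bsub>F\<^esub> ((a \<odot>\<^bsub>F\<^esub> fgen R b) \<oplus>\<^bsub>F\<^esub> (b \<odot>\<^bsub>F\<^esub> fgen R a)) | a b.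
        a \<in> carrier R \<and> b \<in> carrier R} \<union>
     {fgen R c | c. c \<in> k})"

definition kaehler_kernel :: "('r, 'e) ring_scheme \<Rightarrow> 'r set \<Rightarrow> ('r \<Rightarrow> 'r) set" where
  "kaehler_kernel R k =
     submodule_gen R (free_module R (carrier R)) (kaehler_relations R k)"

definition kaehler :: "('r, 'e) ring_scheme \<Rightarrow> 'r set \<Rightarrow> ('r, ('r \<Rightarrow> 'r) set) module" where
  "kaehler R k = quotient_module (free_module R (carrier R)) (kaehler_kernel R k)"

definition kaehler_d :: "('r, 'e) ring_scheme \<Rightarrow> 'r set \<Rightarrow> 'r \<Rightarrow> ('r \<Rightarrow> 'r) set" where
  "kaehler_d R k a = kaehler_kernel R k +>\<^bsub>free_module R (carrier R)\<^esub> fgen R a"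

text \<open>
  The exterior derivative from \<open>1\<close>-forms to \<open>2\<close>-forms, \<open>\<Sum> \<phi>(a) da \<mapsto> \<Sum> d\<phi>(a) \<and> da\<close>;
  again the value is independent of the representative \<open>\<phi>\<close>.
\<close>
definition ext_deriv ::
    "('r, 'e) ring_scheme \<Rightarrow> 'r set \<Rightarrow> ('r \<Rightarrow> 'r) set \<Rightarrow> (('r \<Rightarrow> 'r) set list \<Rightarrow> 'r) set" where
  "ext_deriv R k \<eta> = (THE \<theta>. \<exists>\<phi>\<in>\<eta>. \<theta> =
     finsum (ext_power R (kaehler R k) 2)
       (\<lambda>a. wedge R (kaehler R k) [kaehler_d R k (\<phi> a), kaehler_d R k a])
       {a. \<phi> a \<noteq> \<zero>\<^bsub>R\<^esub>})"

section \<open>Spaces with functions\<close>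

text \<open>
  Algebraic varieties over the complex numbers are taken in the classical sense: a space of
  closed points with its Zariski topology and its sheaf of complex-valued regular functions.
  Sections over \<open>U\<close> are represented by functions that are undefined outside \<open>U\<close>.
\<close>

record 'a fspace =
  zar :: "'a topology"
  reg :: "'a set \<Rightarrow> ('a \<Rightarrow> complex) set"

definition fspace_morphism :: "'a fspace \<Rightarrow> 'b fspace \<Rightarrow> ('a \<Rightarrow> 'b) \<Rightarrow> bool" where
  "fspace_morphism X Y \<phi> \<longleftrightarrow> continuous_map (zar X) (zar Y) \<phi> \<and>
     (\<forall>V f. openin (zar Y) V \<and> f \<in> reg Y V \<longrightarrow>
        (\<lambda>x\<in>{x \<in> topspace (zar X). \<phi> x \<in> V}. f (\<phi> x))
          \<in> reg X {x \<in> topspace (zar X). \<phi> x \<in> V})"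

definition fspace_iso :: "'a fspace \<Rightarrow> 'b fspace \<Rightarrow> ('a \<Rightarrow> 'b) \<Rightarrow> bool" where
  "fspace_iso X Y \<phi> \<longleftrightarrow> fspace_morphism X Y \<phi> \<and>
     (\<exists>\<psi>. fspace_morphism Y X \<psi> \<and> (\<forall>x\<in>topspace (zar X). \<psi> (\<phi> x) = x) \<and>
          (\<forall>y\<in>topspace (zar Y). \<phi> (\<psi> y) = y))"

definition open_fsubspace :: "'a fspace \<Rightarrow> 'a set \<Rightarrow> 'a fspace" where
  "open_fsubspace X U = \<lparr>zar = subtopology (zar X) U, reg = reg X\<rparr>"

definition function_sheaf :: "'a fspace \<Rightarrow> bool" where
  "function_sheaf X \<longleftrightarrow>
     (\<forall>U. openin (zar X) U \<longrightarrow>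
        reg X U \<subseteq> extensional U \<and>
        (\<forall>c. (\<lambda>x\<in>U. c) \<in> reg X U) \<and>
        (\<forall>f\<in>reg X U. \<forall>g\<in>reg X U.
           (\<lambda>x\<in>U. f x + g x) \<in> reg X U \<and> (\<lambda>x\<in>U. f x * g x) \<in> reg X U) \<and>
        (\<forall>f\<in>reg X U. \<forall>V. openin (zar X) V \<and> V \<subseteq> U \<longrightarrow> restrict f V \<in> reg X V) \<and>
        (\<forall>f\<in>extensional U.
           (\<forall>x\<in>U. \<exists>V. openin (zar X) V \<and> x \<in> V \<and> V \<subseteq> U \<and> restrict f V \<in> reg X V)
             \<longrightarrow> f \<in> reg X U))"

section \<open>Affine varieties\<close>

definition affine_space :: "nat \<Rightarrow> (nat \<Rightarrow> complex) set" where
  "affine_space N = ({..<N} \<rightarrow>\<^sub>E UNIV)"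

inductive_set poly_funs :: "nat \<Rightarrow> ((nat \<Rightarrow> complex) \<Rightarrow> complex) set" for N where
  const: "(\<lambda>p. c) \<in> poly_funs N"
| coord: "i < N \<Longrightarrow> (\<lambda>p. p i) \<in> poly_funs N"
| add: "f \<in> poly_funs N \<Longrightarrow> g \<in> poly_funs N \<Longrightarrow> (\<lambda>p. f p + g p) \<in> poly_funs N"
| mult: "f \<in> poly_funs N \<Longrightarrow> g \<in> poly_funs N \<Longrightarrow> (\<lambda>p. f p * g p) \<in> poly_funs N"

definition zariski :: "nat \<Rightarrow> (nat \<Rightarrow> complex) topology" where
  "zariski N =
     topology_generated_by {{p \<in> affine_space N. f p \<noteq> 0} | f. f \<in> poly_funs N}"

definition algebraic_set :: "nat \<Rightarrow> (nat \<Rightarrow> complex) set \<Rightarrow> bool" where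
  "algebraic_set N Y \<longleftrightarrow>
     (\<exists>S \<subseteq> poly_funs N. Y = {p \<in> affine_space N. \<forall>f\<in>S. f p = 0})"

definition vanishing_ideal ::
    "nat \<Rightarrow> (nat \<Rightarrow> complex) set \<Rightarrow> ((nat \<Rightarrow> complex) \<Rightarrow> complex) set" where
  "vanishing_ideal N Y = {f \<in> poly_funs N. \<forall>p\<in>Y. f p = 0}"

definition ideal_generators ::
    "nat \<Rightarrow> ((nat \<Rightarrow> complex) \<Rightarrow> complex) set \<Rightarrow> ((nat \<Rightarrow> complex) \<Rightarrow> complex) set \<Rightarrow> bool" where
  "ideal_generators N F I \<longleftrightarrow> finite F \<and> F \<subseteq> I \<and>
     (\<forall>f\<in>I. \<exists>c. (\<forall>g\<in>F. c g \<in> poly_funs N) \<and> f = (\<lambda>p. \<Sum>g\<in>F. c g p * g p))"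

definition affine_fspace :: "nat \<Rightarrow> (nat \<Rightarrow> complex) set \<Rightarrow> (nat \<Rightarrow> complex) fspace" where
  "affine_fspace N Y =
     \<lparr>zar = subtopology (zariski N) Y,
      reg = (\<lambda>W. {f \<in> extensional W. \<forall>p\<in>W. \<exists>V. openin (subtopology (zariski N) Y) V \<and>
               p \<in> V \<and> V \<subseteq> W \<and>
               (\<exists>g\<in>poly_funs N. \<exists>h\<in>poly_funs N. \<forall>q\<in>V. h q \<noteq> 0 \<and> f q = g q / h q)})\<rparr>"

text \<open>The rank of the Jacobian matrix of \<open>F\<close> at \<open>p\<close>, i.e. the dimension of its row space.\<close>
definition jacobian_rank ::
    "nat \<Rightarrow> ((nat \<Rightarrow> complex) \<Rightarrow> complex) set \<Rightarrow> (nat \<Rightarrow> complex) \<Rightarrow> nat" where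
  "jacobian_rank N F p =
     vector_space.dim (\<lambda>(c :: complex) (v :: nat \<Rightarrow> complex) i. c * v i)
       ((\<lambda>f i. if i < N then deriv (\<lambda>t. f (p(i := t))) (p i) else 0) ` F)"

section \<open>Smooth algebraic varieties\<close>

definition irreducible_in :: "'a topology \<Rightarrow> 'a set \<Rightarrow> bool" where
  "irreducible_in T Z \<longleftrightarrow> Z \<subseteq> topspace T \<and> Z \<noteq> {} \<and>
     (\<forall>A B. closedin T A \<and> closedin T B \<and> Z \<subseteq> A \<union> B \<longrightarrow> Z \<subseteq> A \<or> Z \<subseteq> B)"

definition krull_dim :: "'a topology \<Rightarrow> enat" where
  "krull_dim T = Sup {enat n | n. \<exists>Z. (\<forall>i\<le>n. closedin T (Z i) \<and> irreducible_in T (Z i)) \<and>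
                                     (\<forall>i<n. Z i \<subset> Z (Suc i))}"

definition affine_chart ::
    "'a fspace \<Rightarrow> 'a set \<Rightarrow> nat \<Rightarrow> (nat \<Rightarrow> complex) set \<Rightarrow> ('a \<Rightarrow> nat \<Rightarrow> complex) \<Rightarrow> bool" where
  "affine_chart X U N Y \<phi> \<longleftrightarrow> openin (zar X) U \<and> algebraic_set N Y \<and>
     fspace_iso (open_fsubspace X U) (affine_fspace N Y) \<phi>"

text \<open>
  Separatedness is the condition that two morphisms into \<open>X\<close> agree on a closed set; it is a
  local condition on the source, so affine sources suffice.
\<close>
definition separated :: "'a fspace \<Rightarrow> bool" where
  "separated X \<longleftrightarrow> (\<forall>N Y f g. algebraic_set N Y \<and>
     fspace_morphism (affine_fspace N Y) X f \<and> fspace_morphism (affine_fspace N Y) X g \<longrightarrow>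
     closedin (zar (affine_fspace N Y)) {p \<in> Y. f p = g p})"

definition algebraic_variety :: "'a fspace \<Rightarrow> bool" where
  "algebraic_variety X \<longleftrightarrow> function_sheaf X \<and>
     irreducible_in (zar X) (topspace (zar X)) \<and>
     (\<exists>\<U>. finite \<U> \<and> \<Union>\<U> = topspace (zar X) \<and> (\<forall>U\<in>\<U>. \<exists>N Y \<phi>. affine_chart X U N Y \<phi>)) \<and>
     separated X"

text \<open>Smoothness is the Jacobian criterion on an affine cover.\<close>
definition smooth_variety :: "'a fspace \<Rightarrow> bool" where
  "smooth_variety X \<longleftrightarrow> algebraic_variety X \<and>
     (\<forall>x\<in>topspace (zar X). \<exists>U N Y \<phi> F d.
        affine_chart X U N Y \<phi> \<and> x \<in> U \<and> ideal_generators N F (vanishing_ideal N Y) \<and>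
        krull_dim (zar X) = enat d \<and> (\<forall>p\<in>Y. jacobian_rank N F p + d = N))"

section \<open>Stalks of the structure sheaf and of the sheaf of differentials\<close>

type_synonym 'a germ = "('a set \<times> ('a \<Rightarrow> complex)) set"
type_synonym 'a cotangent = "('a germ \<Rightarrow> 'a germ) set"
type_synonym 'a form = "('a cotangent list \<Rightarrow> 'a germ) set"

definition germ :: "'a fspace \<Rightarrow> 'a \<Rightarrow> 'a set \<Rightarrow> ('a \<Rightarrow> complex) \<Rightarrow> 'a germ" where
  "germ X x U f = {(V, g). openin (zar X) V \<and> x \<in> V \<and> g \<in> reg X V \<and>
     (\<exists>W. openin (zar X) W \<and> x \<in> W \<and> W \<subseteq> U \<inter> V \<and> (\<forall>y\<in>W. f y = g y))}"

definition const_germ :: "'a fspace \<Rightarrow> 'a \<Rightarrow> complex \<Rightarrow> 'a germ" where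
  "const_germ X x c = germ X x (topspace (zar X)) (\<lambda>y\<in>topspace (zar X). c)"

definition stalk :: "'a fspace \<Rightarrow> 'a \<Rightarrow> 'a germ ring" where
  "stalk X x =
     \<lparr>carrier = {germ X x U f | U f. openin (zar X) U \<and> x \<in> U \<and> f \<in> reg X U},
      mult = (\<lambda>A B. \<Union>(U, f)\<in>A. \<Union>(V, g)\<in>B. germ X x (U \<inter> V) (\<lambda>y\<in>U \<inter> V. f y * g y)),
      one = const_germ X x 1,
      zero = const_germ X x 0,
      add = (\<lambda>A B. \<Union>(U, f)\<in>A. \<Union>(V, g)\<in>B. germ X x (U \<inter> V) (\<lambda>y\<in>U \<inter> V. f y + g y))\<rparr>"

abbreviation Omega_stalk :: "'a fspace \<Rightarrow> 'a \<Rightarrow> ('a germ, 'a cotangent) module" where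
  "Omega_stalk X x \<equiv> kaehler (stalk X x) (range (const_germ X x))"

abbreviation d_stalk :: "'a fspace \<Rightarrow> 'a \<Rightarrow> 'a germ \<Rightarrow> 'a cotangent" where
  "d_stalk X x \<equiv> kaehler_d (stalk X x) (range (const_germ X x))"

abbreviation Omega_k_stalk :: "'a fspace \<Rightarrow> nat \<Rightarrow> 'a \<Rightarrow> ('a germ, 'a form) module" where
  "Omega_k_stalk X k x \<equiv> ext_power (stalk X x) (Omega_stalk X x) k"

abbreviation ext_deriv_stalk :: "'a fspace \<Rightarrow> 'a \<Rightarrow> 'a cotangent \<Rightarrow> 'a form" where
  "ext_deriv_stalk X x \<equiv> ext_deriv (stalk X x) (range (const_germ X x))"

abbreviation wedge_stalk :: "'a fspace \<Rightarrow> nat \<Rightarrow> 'a \<Rightarrow> 'a cotangent \<Rightarrow> 'a form \<Rightarrow> 'a form" where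
  "wedge_stalk X k x \<equiv> wedge_left (stalk X x) (Omega_stalk X x) k"

section \<open>Sheaves of modules\<close>

definition reg_ring :: "'a fspace \<Rightarrow> 'a set \<Rightarrow> ('a \<Rightarrow> complex) ring" where
  "reg_ring X U =
     \<lparr>carrier = reg X U, mult = (\<lambda>f g. \<lambda>x\<in>U. f x * g x), one = (\<lambda>x\<in>U. 1),
      zero = (\<lambda>x\<in>U. 0), add = (\<lambda>f g. \<lambda>x\<in>U. f x + g x)\<rparr>"

text \<open>A presheaf of modules: its modules of sections, and \<open>res F U V\<close> restricting from \<open>U\<close> to \<open>V\<close>.\<close>
record ('a, 'm) mod_presheaf =
  sect :: "'a set \<Rightarrow> ('a \<Rightarrow> complex, 'm) module"
  res :: "'a set \<Rightarrow> 'a set \<Rightarrow> 'm \<Rightarrow> 'm"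

definition module_sheaf :: "'a fspace \<Rightarrow> ('a, 'm) mod_presheaf \<Rightarrow> bool" where
  "module_sheaf X F \<longleftrightarrow>
     (\<forall>U. openin (zar X) U \<longrightarrow> module (reg_ring X U) (sect F U)) \<and>
     (\<forall>U V. openin (zar X) U \<and> openin (zar X) V \<and> V \<subseteq> U \<longrightarrow>
        (\<forall>s\<in>carrier (sect F U). res F U V s \<in> carrier (sect F V) \<and>
           (\<forall>t\<in>carrier (sect F U).
              res F U V (s \<oplus>\<^bsub>sect F U\<^esub> t) = res F U V s \<oplus>\<^bsub>sect F V\<^esub> res F U V t) \<and>
           (\<forall>f\<in>reg X U.
              res F U V (f \<odot>\<^bsub>sect F U\<^esub> s) = restrict f V \<odot>\<^bsub>sect F V\<^esub> res F U V s))) \<and>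
     (\<forall>U. openin (zar X) U \<longrightarrow> (\<forall>s\<in>carrier (sect F U). res F U U s = s)) \<and>
     (\<forall>U V W. openin (zar X) U \<and> openin (zar X) V \<and> openin (zar X) W \<and> W \<subseteq> V \<and> V \<subseteq> U \<longrightarrow>
        (\<forall>s\<in>carrier (sect F U). res F V W (res F U V s) = res F U W s)) \<and>
     (\<forall>\<V>. (\<forall>V\<in>\<V>. openin (zar X) V) \<longrightarrow>
        (\<forall>\<sigma>. (\<forall>V\<in>\<V>. \<sigma> V \<in> carrier (sect F V)) \<and>
              (\<forall>V\<in>\<V>. \<forall>W\<in>\<V>. res F V (V \<inter> W) (\<sigma> V) = res F W (V \<inter> W) (\<sigma> W)) \<longrightarrow>
              (\<exists>!s. s \<in> carrier (sect F (\<Union>\<V>)) \<and> (\<forall>V\<in>\<V>. res F (\<Union>\<V>) V s = \<sigma> V))))"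

text \<open>\<open>Hom(F, G)(V)\<close>: the morphisms of sheaves of modules from \<open>F|\<^sub>V\<close> to \<open>G|\<^sub>V\<close>.\<close>
definition sheaf_hom ::
    "'a fspace \<Rightarrow> 'a set \<Rightarrow> ('a, 'm) mod_presheaf \<Rightarrow> ('a, 'n) mod_presheaf
       \<Rightarrow> ('a set \<Rightarrow> 'm \<Rightarrow> 'n) set" where
  "sheaf_hom X V F G = {\<phi>. \<forall>W. openin (zar X) W \<and> W \<subseteq> V \<longrightarrow>
     (\<forall>s\<in>carrier (sect F W). \<phi> W s \<in> carrier (sect G W) \<and>
        (\<forall>t\<in>carrier (sect F W). \<phi> W (s \<oplus>\<^bsub>sect F W\<^esub> t) = \<phi> W s \<oplus>\<^bsub>sect G W\<^esub> \<phi> W t) \<and>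
        (\<forall>f\<in>reg X W. \<phi> W (f \<odot>\<^bsub>sect F W\<^esub> s) = f \<odot>\<^bsub>sect G W\<^esub> \<phi> W s) \<and>
        (\<forall>W'. openin (zar X) W' \<and> W' \<subseteq> W \<longrightarrow>
           \<phi> W' (res F W W' s) = res G W W' (\<phi> W s)))}"

definition structure_sheaf :: "'a fspace \<Rightarrow> ('a, 'a \<Rightarrow> complex) mod_presheaf" where
  "structure_sheaf X =
     \<lparr>sect = (\<lambda>U. regular_module (reg_ring X U)), res = (\<lambda>U V f. restrict f V)\<rparr>"

definition line_bundle :: "'a fspace \<Rightarrow> ('a, 'l) mod_presheaf \<Rightarrow> bool" where
  "line_bundle X L \<longleftrightarrow> module_sheaf X L \<and>
     (\<forall>x\<in>topspace (zar X). \<exists>V. openin (zar X) V \<and> x \<in> V \<and>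
        (\<exists>\<phi>\<in>sheaf_hom X V (structure_sheaf X) L. \<forall>W. openin (zar X) W \<and> W \<subseteq> V \<longrightarrow>
           bij_betw (\<phi> W) (reg X W) (carrier (sect L W))))"

text \<open>
  The sheaf \<open>\<Omega>\<^sup>1\<close> of differentials is the sheafification of \<open>U \<mapsto> \<Omega>\<^bsub>\<O>(U)/\<complex>\<^esub>\<close>: a section is
  a family of elements of the stalks that is locally of the form \<open>\<Sum> f\<^sub>i dg\<^sub>i\<close>.
\<close>
definition Omega_sections :: "'a fspace \<Rightarrow> 'a set \<Rightarrow> ('a \<Rightarrow> 'a cotangent) set" where
  "Omega_sections X U = {s \<in> extensional U. \<forall>x\<in>U. \<exists>V. openin (zar X) V \<and> x \<in> V \<and> V \<subseteq> U \<and>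
     (\<exists>(n :: nat) f g. (\<forall>i<n. f i \<in> reg X V \<and> g i \<in> reg X V) \<and>
        (\<forall>y\<in>V. s y = finsum (Omega_stalk X y)
           (\<lambda>i. germ X y V (f i) \<odot>\<^bsub>Omega_stalk X y\<^esub> d_stalk X y (germ X y V (g i))) {..<n}))}"

definition Omega :: "'a fspace \<Rightarrow> ('a, 'a \<Rightarrow> 'a cotangent) mod_presheaf" where
  "Omega X =
     \<lparr>sect = (\<lambda>U. \<lparr>carrier = Omega_sections X U, mult = undefined, one = undefined,
                     zero = (\<lambda>x\<in>U. \<zero>\<^bsub>Omega_stalk X x\<^esub>),
                     add = (\<lambda>s t. \<lambda>x\<in>U. s x \<oplus>\<^bsub>Omega_stalk X x\<^esub> t x),
                     smult = (\<lambda>f s. \<lambda>x\<in>U. germ X x U f \<odot>\<^bsub>Omega_stalk X x\<^esub> s x)\<rparr>),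
      res = (\<lambda>U V s. restrict s V)\<rparr>"

text \<open>
  Sections of the tangent sheaf, the dual of \<open>\<Omega>\<^sup>1\<close>; the contraction of a \<open>1\<close>-form with a vector
  field is therefore just application.
\<close>
definition tangent_sections ::
    "'a fspace \<Rightarrow> 'a set \<Rightarrow> ('a set \<Rightarrow> ('a \<Rightarrow> 'a cotangent) \<Rightarrow> 'a \<Rightarrow> complex) set" where
  "tangent_sections X V = sheaf_hom X V (Omega X) (structure_sheaf X)"

section \<open>Codimension one foliations and their singularities\<close>

text \<open>The stalk at \<open>x\<close> of the image of a morphism of sheaves \<open>\<omega> : L \<rightarrow> \<Omega>\<^sup>1\<close>.\<close>
definition image_stalk ::
    "'a fspace \<Rightarrow> ('a, 'l) mod_presheaf \<Rightarrow> ('a set \<Rightarrow> 'l \<Rightarrow> 'a \<Rightarrow> 'a cotangent) \<Rightarrow> 'a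
       \<Rightarrow> 'a cotangent set" where
  "image_stalk X L \<omega> x =
     {\<omega> V s x | V s. openin (zar X) V \<and> x \<in> V \<and> s \<in> carrier (sect L V)}"

definition codim1_foliation ::
    "'a fspace \<Rightarrow> ('a, 'l) mod_presheaf \<Rightarrow> ('a set \<Rightarrow> 'l \<Rightarrow> 'a \<Rightarrow> 'a cotangent) \<Rightarrow> bool" where
  "codim1_foliation X L \<omega> \<longleftrightarrow>
     krull_dim (zar X) \<ge> 2 \<and>
     line_bundle X L \<and>
     \<omega> \<in> sheaf_hom X (topspace (zar X)) L (Omega X) \<and>
     (\<exists>V s. openin (zar X) V \<and> s \<in> carrier (sect L V) \<and> \<omega> V s \<noteq> \<zero>\<^bsub>sect (Omega X) V\<^esub>) \<and>
     (\<forall>x\<in>topspace (zar X).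
        torsion_free (stalk X x) (quotient_module (Omega_stalk X x) (image_stalk X L \<omega> x))) \<and>
     (\<forall>V s x. openin (zar X) V \<and> s \<in> carrier (sect L V) \<and> x \<in> V \<longrightarrow>
        wedge_stalk X 2 x (\<omega> V s x) (ext_deriv_stalk X x (\<omega> V s x)) = \<zero>\<^bsub>Omega_k_stalk X 3 x\<^esub>)"

text \<open>The local generators \<open>\<alpha>\<close> of the image of \<open>\<omega>\<close>.\<close>
definition local_generator ::
    "'a fspace \<Rightarrow> ('a, 'l) mod_presheaf \<Rightarrow> ('a set \<Rightarrow> 'l \<Rightarrow> 'a \<Rightarrow> 'a cotangent) \<Rightarrow> 'a set
       \<Rightarrow> ('a \<Rightarrow> 'a cotangent) \<Rightarrow> bool" where
  "local_generator X L \<omega> V \<alpha> \<longleftrightarrow> openin (zar X) V \<and> \<alpha> \<in> carrier (sect (Omega X) V) \<and>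
     (\<forall>x\<in>V. image_stalk X L \<omega> x = {a \<odot>\<^bsub>Omega_stalk X x\<^esub> \<alpha> x | a. a \<in> carrier (stalk X x)})"

text \<open>
  The image sheaf of \<open>TX \<otimes> L \<rightarrow> \<O>\<close>: functions that are locally a finite sum of contractions
  of \<open>\<omega>(s)\<close> with a vector field.
\<close>
definition sing_ideal ::
    "'a fspace \<Rightarrow> ('a, 'l) mod_presheaf \<Rightarrow> ('a set \<Rightarrow> 'l \<Rightarrow> 'a \<Rightarrow> 'a cotangent) \<Rightarrow> 'a set
       \<Rightarrow> ('a \<Rightarrow> complex) set" where
  "sing_ideal X L \<omega> U = {h \<in> reg X U. \<forall>x\<in>U. \<exists>V. openin (zar X) V \<and> x \<in> V \<and> V \<subseteq> U \<and>
     (\<exists>(n :: nat) v s. (\<forall>i<n. v i \<in> tangent_sections X V \<and> s i \<in> carrier (sect L V)) \<and>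
        (\<forall>y\<in>V. h y = (\<Sum>i<n. v i V (\<omega> V (s i)) y)))}"

text \<open>
  The annihilator of the class of \<open>d\<omega>\<close> in \<open>H\<^sup>2(\<omega>) \<otimes> L\<close>. Where \<open>\<alpha>\<close> is a local generator, it
  trivializes \<open>L\<close> and its powers, the complex becomes the Koszul complex of \<open>\<alpha>\<close>, and the section
  is the class of \<open>d\<alpha>\<close>. A section of a sheaf vanishes iff all its germs do.
\<close>
definition persistent_ideal ::
    "'a fspace \<Rightarrow> ('a, 'l) mod_presheaf \<Rightarrow> ('a set \<Rightarrow> 'l \<Rightarrow> 'a \<Rightarrow> 'a cotangent) \<Rightarrow> 'a set
       \<Rightarrow> ('a \<Rightarrow> complex) set" where
  "persistent_ideal X L \<omega> U = {h \<in> reg X U. \<forall>V \<alpha>. V \<subseteq> U \<and> local_generator X L \<omega> V \<alpha> \<longrightarrow>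
     (\<forall>x\<in>V. let H2 = koszul_cohomology (stalk X x) (Omega_stalk X x) (\<alpha> x) 2 in
        germ X x U h \<odot>\<^bsub>H2\<^esub>
          koszul_class (stalk X x) (Omega_stalk X x) (\<alpha> x) 2 (ext_deriv_stalk X x (\<alpha> x))
        = \<zero>\<^bsub>H2\<^esub>)}"

definition sing_ideal_stalk ::
    "'a fspace \<Rightarrow> ('a, 'l) mod_presheaf \<Rightarrow> ('a set \<Rightarrow> 'l \<Rightarrow> 'a \<Rightarrow> 'a cotangent) \<Rightarrow> 'a
       \<Rightarrow> 'a germ set" where
  "sing_ideal_stalk X L \<omega> x =
     {germ X x V h | V h. openin (zar X) V \<and> x \<in> V \<and> h \<in> sing_ideal X L \<omega> V}"

text \<open>The stalk at \<open>x\<close> of the structure sheaf of the singular scheme, as a module over \<open>\<O>\<^sub>x\<close>.\<close>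
definition O_Sing_stalk ::
    "'a fspace \<Rightarrow> ('a, 'l) mod_presheaf \<Rightarrow> ('a set \<Rightarrow> 'l \<Rightarrow> 'a \<Rightarrow> 'a cotangent) \<Rightarrow> 'a
       \<Rightarrow> ('a germ, 'a germ set) module" where
  "O_Sing_stalk X L \<omega> x =
     quotient_module (regular_module (stalk X x)) (sing_ideal_stalk X L \<omega> x)"

text \<open>
  The annihilator of the section of \<open>\<Omega>\<^sup>2 \<otimes> \<O>\<^bsub>Sing(\<omega>)\<^esub> \<otimes> L\<^sup>-\<^sup>1\<close> given by \<open>d\<alpha> \<otimes> 1\<close> where \<open>\<alpha>\<close> is a
  local generator trivializing \<open>L\<close>.
\<close>
definition kupka_ideal ::
    "'a fspace \<Rightarrow> ('a, 'l) mod_presheaf \<Rightarrow> ('a set \<Rightarrow> 'l \<Rightarrow> 'a \<Rightarrow> 'a cotangent) \<Rightarrow> 'a set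
       \<Rightarrow> ('a \<Rightarrow> complex) set" where
  "kupka_ideal X L \<omega> U = {h \<in> reg X U. \<forall>V \<alpha>. V \<subseteq> U \<and> local_generator X L \<omega> V \<alpha> \<longrightarrow>
     (\<forall>x\<in>V. let S = O_Sing_stalk X L \<omega> x;
                 one_S = sing_ideal_stalk X L \<omega> x +>\<^bsub>regular_module (stalk X x)\<^esub> \<one>\<^bsub>stalk X x\<^esub>;
                 T = tensor_module (stalk X x) (Omega_k_stalk X 2 x) S in
        germ X x U h \<odot>\<^bsub>T\<^esub>
          pure_tensor (stalk X x) (Omega_k_stalk X 2 x) S (ext_deriv_stalk X x (\<alpha> x)) one_S
        = \<zero>\<^bsub>T\<^esub>)}"

end

theory Submission
  imports Defs
begin

text \<open>
  Write \<open>\<alpha>\<close> for a local generator. Contracting the integrability condition \<open>\<alpha> \<and> d\<alpha> = 0\<close> with a vector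
  field \<open>v\<close> gives \<open>\<alpha>(v) d\<alpha> = \<alpha> \<and> i\<^sub>v d\<alpha>\<close>, so the coefficients \<open>\<alpha>(v)\<close>, which generate the ideal of
  the singular scheme, annihilate the class of \<open>d\<alpha>\<close> in the Koszul cohomology. Next, if
  \<open>h d\<alpha> = \<alpha> \<and> \<eta>\<close>, then \<open>h d\<alpha>\<close> vanishes on the singular scheme because \<open>\<alpha>\<close> does: smoothness provides
  forms \<open>b\<^sub>j\<close> and vector fields \<open>v\<^sub>j\<close> near each point with \<open>\<alpha> = \<Sum> \<alpha>(v\<^sub>j) b\<^sub>j\<close>. The \<open>v\<^sub>j\<close> are the columns
  of a polynomial matrix projecting onto the kernel of the Jacobian matrix, found by Gaussian
  elimination, and the \<open>b\<^sub>j\<close> are the differentials of the ambient coordinates divided by a common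
  denominator.
\<close>

section \<open>Linear algebra over a commutative ring: linear maps, free modules, quotients,
  presentations\<close>

section \<open>Linear maps and submodules\<close>

text \<open>Two difficulties shape the development. Forms, wedge products and
  \<open>ext_deriv\<close> are cosets of finitely supported functions, with values picked by
  \<open>THE\<close> over representatives: before any identity can be used, the map on
  representatives must be seen to kill the relations. Exterior powers, differentials and tensor
  products are therefore treated as modules with generators and relations, and identities are
  checked on generators. Secondly, the Jacobian criterion speaks of ranks at single points, while
  vector fields live on open sets. Elimination at a point p selects equations \<open>H\<close> and
  writes \<open>D\<close> times the identity as \<open>P\<close> plus combinations of gradients of
  \<open>H\<close>, valid identically; the columns of \<open>P\<close> are known to kill the
  remaining equations only at p. Constancy of the rank spreads this to all points of
  \<open>Y\<close> where \<open>D\<close> is nonzero. On \<open>Y\<close> the differentials of the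
  equations vanish, so the identity reads D dx_i = sum of P_ij dx_j, which is the dual basis up to
  the factor D. The vector fields are assembled from their values at points, because a regular
  function is determined by its values.\<close>

text \<open>The library's \<^locale>\<open>module\<close> also admits extended records, to which \<^const>\<open>quotient_module\<close> does not apply.\<close>
locale plain_module = module R M for R (structure) and M :: "('a, 'm) module" (structure)

lemma (in abelian_group) minus_eq_zero_iff:
  "x \<in> carrier G \<Longrightarrow> y \<in> carrier G \<Longrightarrow> x \<ominus> y = \<zero> \<longleftrightarrow> x = y"
  using add.inv_solve_right[of \<zero> x y] by (auto simp: a_minus_def)

text \<open>A predicate on plain functions: the maps that occur, such as
  \<open>THE\<close>-expressions on cosets, are unspecified off the carrier.\<close>

definition linear_map ::
    "('r, 'e) ring_scheme \<Rightarrow> ('r, 'm) module \<Rightarrow> ('r, 'n) module \<Rightarrow> ('m \<Rightarrow> 'n) \<Rightarrow> bool" where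
  "linear_map R M N f \<longleftrightarrow>
     f \<in> carrier M \<rightarrow> carrier N \<and>
     (\<forall>x\<in>carrier M. \<forall>y\<in>carrier M. f (x \<oplus>\<^bsub>M\<^esub> y) = f x \<oplus>\<^bsub>N\<^esub> f y) \<and>
     (\<forall>r\<in>carrier R. \<forall>x\<in>carrier M. f (r \<odot>\<^bsub>M\<^esub> x) = r \<odot>\<^bsub>N\<^esub> f x)"

lemma linear_mapI:
  assumes "\<And>x. x \<in> carrier M \<Longrightarrow> f x \<in> carrier N"
    and "\<And>x y. x \<in> carrier M \<Longrightarrow> y \<in> carrier M \<Longrightarrow> f (x \<oplus>\<^bsub>M\<^esub> y) = f x \<oplus>\<^bsub>N\<^esub> f y"
    and "\<And>r x. r \<in> carrier R \<Longrightarrow> x \<in> carrier M \<Longrightarrow> f (r \<odot>\<^bsub>M\<^esub> x) = r \<odot>\<^bsub>N\<^esub> f x"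
  shows "linear_map R M N f"
  using assms by (auto simp: linear_map_def)

lemma linear_mapD:
  assumes "linear_map R M N f"
  shows linear_map_closed: "x \<in> carrier M \<Longrightarrow> f x \<in> carrier N"
    and linear_map_add: "x \<in> carrier M \<Longrightarrow> y \<in> carrier M \<Longrightarrow> f (x \<oplus>\<^bsub>M\<^esub> y) = f x \<oplus>\<^bsub>N\<^esub> f y"
    and linear_map_smult: "r \<in> carrier R \<Longrightarrow> x \<in> carrier M \<Longrightarrow> f (r \<odot>\<^bsub>M\<^esub> x) = r \<odot>\<^bsub>N\<^esub> f x"
  using assms by (auto simp: linear_map_def)

lemma linear_map_comp:
  assumes "linear_map R M N f" "linear_map R N P g"
  shows "linear_map R M P (\<lambda>x. g (f x))"
  by (rule linear_mapI) (simp_all add: linear_mapD[OF assms(1)] linear_mapD[OF assms(2)])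

lemma linear_map_zero:
  assumes "plain_module R M" "plain_module R N" "linear_map R M N f"
  shows "f \<zero>\<^bsub>M\<^esub> = \<zero>\<^bsub>N\<^esub>"
proof -
  interpret M: plain_module R M by fact
  interpret N: plain_module R N by fact
  have "f \<zero>\<^bsub>M\<^esub> = f (\<zero>\<^bsub>R\<^esub> \<odot>\<^bsub>M\<^esub> \<zero>\<^bsub>M\<^esub>)" by simp
  also have "\<dots> = \<zero>\<^bsub>N\<^esub>"
    using linear_mapD[OF assms(3)] by (metis M.R.zero_closed M.zero_closed N.smult_l_null)
  finally show ?thesis .
qed

lemma linear_map_uminus:
  assumes "plain_module R M" "plain_module R N" "linear_map R M N f" "y \<in> carrier M"
  shows "f (\<ominus>\<^bsub>M\<^esub> y) = \<ominus>\<^bsub>N\<^esub> f y"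
proof -
  interpret M: plain_module R M by fact
  interpret N: plain_module R N by fact
  note l = linear_mapD[OF assms(3)]
  have "f (\<ominus>\<^bsub>M\<^esub> y) \<oplus>\<^bsub>N\<^esub> f y = \<zero>\<^bsub>N\<^esub>"
    using l(2)[of "\<ominus>\<^bsub>M\<^esub> y" y] assms by (simp add: M.l_neg linear_map_zero[OF assms(1-3)])
  then show ?thesis
    using N.minus_equality[OF _ l(1)[OF assms(4)] l(1)[OF M.a_inv_closed[OF assms(4)]]] by simp
qed

lemma linear_map_minus:
  assumes "plain_module R M" "plain_module R N" "linear_map R M N f" "x \<in> carrier M" "y \<in> carrier M"
  shows "f (x \<ominus>\<^bsub>M\<^esub> y) = f x \<ominus>\<^bsub>N\<^esub> f y"
proof -
  interpret M: plain_module R M by fact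
  show ?thesis
    using assms(4,5) linear_map_add[OF assms(3), of x "\<ominus>\<^bsub>M\<^esub> y"] linear_map_uminus[OF assms(1-3,5)]
    by (simp add: a_minus_def)
qed

lemma linear_map_finsum:
  assumes "plain_module R M" "plain_module R N" "linear_map R M N f" "finite A" "g \<in> A \<rightarrow> carrier M"
  shows "f (finsum M g A) = finsum N (\<lambda>a. f (g a)) A"
proof -
  interpret M: plain_module R M by fact
  interpret N: plain_module R N by fact
  note l = linear_mapD[OF assms(3)]
  show ?thesis
    using assms(4,5)
  proof (induction A)
    case empty
    then show ?case by (simp add: linear_map_zero[OF assms(1-3)])
  next
    case (insert a A)
    then have "g a \<in> carrier M" "g \<in> A \<rightarrow> carrier M" by auto
    moreover have "(\<lambda>a. f (g a)) \<in> A \<rightarrow> carrier N" "f (g a) \<in> carrier N"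
      using insert.prems l(1) by auto
    ultimately show ?case
      using insert by (simp add: l)
  qed
qed

lemma (in plain_module) zero_submodule: "submodule {\<zero>\<^bsub>M\<^esub>} R M"
  by (rule submoduleI) auto

lemma (in plain_module) submodule_zero_closed:
  assumes "submodule H R M"
  shows "\<zero>\<^bsub>M\<^esub> \<in> H"
  using subgroup.one_closed[OF submodule.axioms(1)[OF assms]] by simp

text \<open>Kernels and congruences modulo boundaries are preimages of submodules. Together with the
  span lemmas below, this turns a verification on all elements into one on generators.\<close>

lemma linear_map_vimage_submodule:
  assumes "plain_module R M" "plain_module R N" "linear_map R M N f" "submodule P R N"
  shows "submodule {x \<in> carrier M. f x \<in> P} R M"
proof -
  interpret M: plain_module R M by fact
  interpret N: plain_module R N by fact
  note l = linear_mapD[OF assms(3)]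
  note P = N.submoduleE[OF assms(4)]
  show ?thesis
    using N.submodule_zero_closed[OF assms(4)]
    by (intro M.submoduleI)
      (auto simp: l P linear_map_zero[OF assms(1-3)] linear_map_uminus[OF assms(1-3)])
qed

lemma linear_map_image_submodule:
  assumes "plain_module R M" "plain_module R N" "linear_map R M N f"
  shows "submodule (f ` carrier M) R N"
proof -
  interpret M: plain_module R M by fact
  interpret N: plain_module R N by fact
  note l = linear_mapD[OF assms(3)]
  show ?thesis
  proof (rule N.submoduleI)
    show "f ` carrier M \<subseteq> carrier N" using l(1) by auto
    show "\<zero>\<^bsub>N\<^esub> \<in> f ` carrier M"
      using linear_map_zero[OF assms] M.zero_closed image_eqI[of _ f "\<zero>\<^bsub>M\<^esub>"] by simp
    fix a assume "a \<in> f ` carrier M"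
    then obtain x where x: "x \<in> carrier M" "a = f x" by auto
    then show "\<ominus>\<^bsub>N\<^esub> a \<in> f ` carrier M"
      using linear_map_uminus[OF assms, of x] image_eqI[of _ f "\<ominus>\<^bsub>M\<^esub> x"] by simp
    show "r \<odot>\<^bsub>N\<^esub> a \<in> f ` carrier M" if "r \<in> carrier R" for r
      using that x l(3) image_eqI[of _ f "r \<odot>\<^bsub>M\<^esub> x"] by simp
    fix b assume "b \<in> f ` carrier M"
    then obtain y where "y \<in> carrier M" "b = f y" by auto
    then show "a \<oplus>\<^bsub>N\<^esub> b \<in> f ` carrier M"
      using x l(2) image_eqI[of _ f "x \<oplus>\<^bsub>M\<^esub> y"] by simp
  qed
qed

lemma submodule_gen_incl: "S \<subseteq> submodule_gen R M S"
  by (auto simp: submodule_gen_def)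

lemma submodule_gen_minimal: "submodule N R M \<Longrightarrow> S \<subseteq> N \<Longrightarrow> submodule_gen R M S \<subseteq> N"
  by (auto simp: submodule_gen_def)

lemma (in plain_module) submodule_gen_submodule:
  assumes "S \<subseteq> carrier M"
  shows "submodule (submodule_gen R M S) R M"
proof (rule submoduleI)
  show "submodule_gen R M S \<subseteq> carrier M"
    by (rule submodule_gen_minimal[OF carrier_is_submodule assms])
  show "\<zero>\<^bsub>M\<^esub> \<in> submodule_gen R M S"
    by (auto simp: submodule_gen_def submodule_zero_closed)
qed (auto simp: submodule_gen_def submoduleE)

text \<open>The vanishing set of \<open>f\<close> is a submodule containing \<open>S\<close>, hence
  it contains all that \<open>S\<close> generates. This is how maps descend to quotients by
  relations.\<close>

lemma linear_map_submodule_gen: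
  assumes "plain_module R M" "plain_module R N" "linear_map R M N f" "S \<subseteq> carrier M"
    and "\<And>x. x \<in> S \<Longrightarrow> f x = \<zero>\<^bsub>N\<^esub>" "x \<in> submodule_gen R M S"
  shows "f x = \<zero>\<^bsub>N\<^esub>"
proof -
  have "submodule_gen R M S \<subseteq> {x \<in> carrier M. f x \<in> {\<zero>\<^bsub>N\<^esub>}}"
    using assms
    by (intro submodule_gen_minimal linear_map_vimage_submodule[OF assms(1-3)] plain_module.zero_submodule) auto
  then show ?thesis using assms(6) by auto
qed

subsection \<open>Free modules\<close>

lemma free_module_simps [simp]:
  "\<zero>\<^bsub>free_module R S\<^esub> = (\<lambda>s. \<zero>\<^bsub>R\<^esub>)"
  "\<phi> \<oplus>\<^bsub>free_module R S\<^esub> \<psi> = (\<lambda>s. \<phi> s \<oplus>\<^bsub>R\<^esub> \<psi> s)"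
  "r \<odot>\<^bsub>free_module R S\<^esub> \<phi> = (\<lambda>s. r \<otimes>\<^bsub>R\<^esub> \<phi> s)"
  by (simp_all add: free_module_def)

lemma free_module_carrier:
  "\<phi> \<in> carrier (free_module R S) \<longleftrightarrow>
     (\<forall>s\<in>S. \<phi> s \<in> carrier R) \<and> (\<forall>s. s \<notin> S \<longrightarrow> \<phi> s = \<zero>\<^bsub>R\<^esub>) \<and> finite {s. \<phi> s \<noteq> \<zero>\<^bsub>R\<^esub>}"
  by (simp add: free_module_def)

lemma (in cring) free_module_carrierD:
  assumes "\<phi> \<in> carrier (free_module R S)"
  shows "\<phi> s \<in> carrier R"
  using assms by (cases "s \<in> S") (auto simp: free_module_carrier)

lemma (in cring) free_module_module: "plain_module R (free_module R S)"
proof (rule plain_module.intro, rule moduleI)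
  have supp: "finite {s. \<phi> s \<oplus> \<psi> s \<noteq> \<zero>}"
    if "finite {s. \<phi> s \<noteq> \<zero>}" "finite {s. \<psi> s \<noteq> \<zero>}" for \<phi> \<psi> :: "'s \<Rightarrow> 'a"
    by (rule finite_subset[OF _ finite_UnI[OF that]]) auto
  show "abelian_group (free_module R S)"
  proof (rule abelian_groupI)
    fix \<phi> \<psi> assume "\<phi> \<in> carrier (free_module R S)" "\<psi> \<in> carrier (free_module R S)"
    then show "\<phi> \<oplus>\<^bsub>free_module R S\<^esub> \<psi> \<in> carrier (free_module R S)"
      by (auto simp: free_module_carrier supp)
  next
    fix \<phi> assume \<phi>: "\<phi> \<in> carrier (free_module R S)"
    have "(\<lambda>s. \<ominus> \<phi> s) \<in> carrier (free_module R S)"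
      using \<phi> by (auto simp: free_module_carrier intro: finite_subset[of _ "{s. \<phi> s \<noteq> \<zero>}"])
    moreover have "(\<lambda>s. \<ominus> \<phi> s) \<oplus>\<^bsub>free_module R S\<^esub> \<phi> = \<zero>\<^bsub>free_module R S\<^esub>"
      using free_module_carrierD[OF \<phi>] by (simp add: l_neg)
    ultimately show "\<exists>\<psi>\<in>carrier (free_module R S). \<psi> \<oplus>\<^bsub>free_module R S\<^esub> \<phi> = \<zero>\<^bsub>free_module R S\<^esub>"
      by blast
  qed (auto simp: free_module_carrierD a_ac fun_eq_iff free_module_carrier)
  fix r \<phi> assume "r \<in> carrier R" "\<phi> \<in> carrier (free_module R S)"
  then show "r \<odot>\<^bsub>free_module R S\<^esub> \<phi> \<in> carrier (free_module R S)"
    by (auto simp: free_module_carrier intro: finite_subset[of _ "{s. \<phi> s \<noteq> \<zero>}"])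
qed (auto simp: free_module_carrierD l_distr r_distr m_assoc is_cring)

lemma (in cring) fgen_closed: "s \<in> S \<Longrightarrow> fgen R s \<in> carrier (free_module R S)"
  by (auto simp: fgen_def free_module_carrier)

text \<open>Induction runs over a finite set containing the support instead of the support itself,
  so that removing one coordinate fits the hypothesis even when the coefficient there is already
  zero.\<close>

lemma (in cring) free_module_span:
  assumes N: "submodule N R (free_module R S)" and gen: "\<And>s. s \<in> S \<Longrightarrow> fgen R s \<in> N"
    and \<phi>: "\<phi> \<in> carrier (free_module R S)"
  shows "\<phi> \<in> N"
proof -
  interpret F: plain_module R "free_module R S" by (rule free_module_module)
  have "finite A \<Longrightarrow> \<phi> \<in> carrier (free_module R S) \<Longrightarrow> {s. \<phi> s \<noteq> \<zero>} \<subseteq> A \<Longrightarrow> \<phi> \<in> N" for A \<phi>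
  proof (induction A arbitrary: \<phi> rule: finite_induct)
    case empty
    then have "\<phi> = \<zero>\<^bsub>free_module R S\<^esub>" by auto
    then show ?case using F.submodule_zero_closed[OF N] by simp
  next
    case (insert a A)
    show ?case
    proof (cases "\<phi> a = \<zero>")
      case True
      then show ?thesis using insert by (intro insert.IH) auto
    next
      case False
      then have a: "a \<in> S" using insert.prems by (auto simp: free_module_carrier)
      let ?\<psi> = "\<phi>(a := \<zero>)"
      have c: "?\<psi> \<in> carrier (free_module R S)"
        using insert.prems(1) by (auto simp: free_module_carrier elim!: rev_finite_subset)
      have "?\<psi> \<in> N" by (rule insert.IH[OF c]) (use insert.prems in auto)
      moreover have "\<phi> a \<odot>\<^bsub>free_module R S\<^esub> fgen R a \<in> N"
        by (intro F.submoduleE(4)[OF N] gen a free_module_carrierD[OF insert.prems(1)])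
      ultimately have "?\<psi> \<oplus>\<^bsub>free_module R S\<^esub> (\<phi> a \<odot>\<^bsub>free_module R S\<^esub> fgen R a) \<in> N"
        by (rule F.submoduleE(5)[OF N])
      moreover have "?\<psi> \<oplus>\<^bsub>free_module R S\<^esub> (\<phi> a \<odot>\<^bsub>free_module R S\<^esub> fgen R a) = \<phi>"
        using free_module_carrierD[OF insert.prems(1)] by (auto simp: fgen_def)
      ultimately show ?thesis by simp
    qed
  qed
  from this[OF _ \<phi> order_refl] \<phi> show ?thesis by (simp add: free_module_carrier)
qed

text \<open>The sum over the support has literally the shape of the sum in
  \<open>wedge_left\<close>, whose \<open>THE\<close>-expression is therefore the lift of a
  \<open>lin_ext\<close>.\<close>

definition lin_ext ::
    "('r, 'e) ring_scheme \<Rightarrow> ('r, 'm) module \<Rightarrow> ('s \<Rightarrow> 'm) \<Rightarrow> ('s \<Rightarrow> 'r) \<Rightarrow> 'm" where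
  "lin_ext R M f \<phi> = finsum M (\<lambda>s. \<phi> s \<odot>\<^bsub>M\<^esub> f s) {s. \<phi> s \<noteq> \<zero>\<^bsub>R\<^esub>}"

text \<open>Supports change under addition and scaling. Enlarging the index set to a common finite
  \<open>A\<close> lets sums be compared term by term.\<close>

lemma (in plain_module) lin_ext_eq:
  assumes "f \<in> S \<rightarrow> carrier M" "\<phi> \<in> carrier (free_module R S)"
    and "finite A" "A \<subseteq> S" "{s. \<phi> s \<noteq> \<zero>} \<subseteq> A"
  shows "lin_ext R M f \<phi> = finsum M (\<lambda>s. \<phi> s \<odot>\<^bsub>M\<^esub> f s) A"
  unfolding lin_ext_def
  by (rule M.add.finprod_mono_neutral_cong_left)
    (use assms in \<open>auto simp: free_module_carrier Pi_iff subset_iff\<close>)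

lemma (in plain_module) lin_ext_linear:
  assumes f: "f \<in> S \<rightarrow> carrier M"
  shows "linear_map R (free_module R S) M (lin_ext R M f)"
proof (rule linear_mapI)
  note eq = lin_ext_eq[OF f]
  interpret F: plain_module R "free_module R S" by (rule R.free_module_module)
  fix \<phi> assume \<phi>: "\<phi> \<in> carrier (free_module R S)"
  have \<phi>S: "{s. \<phi> s \<noteq> \<zero>} \<subseteq> S" "finite {s. \<phi> s \<noteq> \<zero>}" using \<phi> by (auto simp: free_module_carrier)
  have in_M: "\<psi> s \<odot>\<^bsub>M\<^esub> f s \<in> carrier M" if "\<psi> \<in> carrier (free_module R S)" "s \<in> S" for \<psi> s
    using R.free_module_carrierD[OF that(1), of s] that(2) f by (simp add: Pi_iff)
  show "lin_ext R M f \<phi> \<in> carrier M"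
    unfolding lin_ext_def using \<phi>S in_M[OF \<phi>] by (intro M.finsum_closed) auto
  show "lin_ext R M f (r \<odot>\<^bsub>free_module R S\<^esub> \<phi>) = r \<odot>\<^bsub>M\<^esub> lin_ext R M f \<phi>" if r: "r \<in> carrier R" for r
  proof -
    let ?A = "{s. \<phi> s \<noteq> \<zero>}"
    have "lin_ext R M f (r \<odot>\<^bsub>free_module R S\<^esub> \<phi>) = finsum M (\<lambda>s. (r \<otimes> \<phi> s) \<odot>\<^bsub>M\<^esub> f s) ?A"
      using r by (subst eq[OF F.smult_closed[OF r \<phi>] \<phi>S(2,1)]) auto
    also have "\<dots> = finsum M (\<lambda>s. r \<odot>\<^bsub>M\<^esub> (\<phi> s \<odot>\<^bsub>M\<^esub> f s)) ?A"
      using \<phi>S f r R.free_module_carrierD[OF \<phi>] in_M[OF \<phi>]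
      by (intro M.finsum_cong') (auto simp: smult_assoc1 Pi_iff subset_iff)
    also have "\<dots> = r \<odot>\<^bsub>M\<^esub> lin_ext R M f \<phi>"
      unfolding lin_ext_def using \<phi>S in_M[OF \<phi>] r by (intro finsum_smult_ldistr[symmetric]) auto
    finally show ?thesis .
  qed
  fix \<psi> assume \<psi>: "\<psi> \<in> carrier (free_module R S)"
  have \<psi>S: "{s. \<psi> s \<noteq> \<zero>} \<subseteq> S" "finite {s. \<psi> s \<noteq> \<zero>}" using \<psi> by (auto simp: free_module_carrier)
  let ?A = "{s. \<phi> s \<noteq> \<zero>} \<union> {s. \<psi> s \<noteq> \<zero>}"
  have A: "finite ?A" "?A \<subseteq> S" using \<phi>S \<psi>S by auto
  have "lin_ext R M f (\<phi> \<oplus>\<^bsub>free_module R S\<^esub> \<psi>) = finsum M (\<lambda>s. (\<phi> s \<oplus> \<psi> s) \<odot>\<^bsub>M\<^esub> f s) ?A"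
    by (subst eq[OF F.a_closed[OF \<phi> \<psi>] A]) auto
  also have "\<dots> = finsum M (\<lambda>s. \<phi> s \<odot>\<^bsub>M\<^esub> f s \<oplus>\<^bsub>M\<^esub> \<psi> s \<odot>\<^bsub>M\<^esub> f s) ?A"
    using A in_M[OF \<phi>] in_M[OF \<psi>] R.free_module_carrierD[OF \<phi>] R.free_module_carrierD[OF \<psi>] f
    by (intro M.finsum_cong') (auto simp: smult_l_distr Pi_iff subset_iff)
  also have "\<dots> = finsum M (\<lambda>s. \<phi> s \<odot>\<^bsub>M\<^esub> f s) ?A \<oplus>\<^bsub>M\<^esub> finsum M (\<lambda>s. \<psi> s \<odot>\<^bsub>M\<^esub> f s) ?A"
    using A in_M[OF \<phi>] in_M[OF \<psi>] by (intro M.finsum_addf) auto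
  also have "\<dots> = lin_ext R M f \<phi> \<oplus>\<^bsub>M\<^esub> lin_ext R M f \<psi>"
    by (subst eq[OF \<phi> A], blast, subst eq[OF \<psi> A]) blast+
  finally show "lin_ext R M f (\<phi> \<oplus>\<^bsub>free_module R S\<^esub> \<psi>) = lin_ext R M f \<phi> \<oplus>\<^bsub>M\<^esub> lin_ext R M f \<psi>" .
qed

lemma (in plain_module) lin_ext_fgen:
  assumes f: "f \<in> S \<rightarrow> carrier M" and s: "s \<in> S"
  shows "lin_ext R M f (fgen R s) = f s"
proof -
  have "lin_ext R M f (fgen R s) = finsum M (\<lambda>t. fgen R s t \<odot>\<^bsub>M\<^esub> f t) {s}"
    using s by (intro lin_ext_eq[OF f R.fgen_closed[OF s]]) (auto simp: fgen_def)
  also have "\<dots> = f s" using s f by (simp add: fgen_def Pi_iff)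
  finally show ?thesis .
qed

subsection \<open>Quotient modules\<close>

lemma quotient_module_simps:
  "carrier (quotient_module M N) = (\<lambda>m. N +>\<^bsub>M\<^esub> m) ` carrier M"
  "\<zero>\<^bsub>quotient_module M N\<^esub> = N"
  "C \<oplus>\<^bsub>quotient_module M N\<^esub> D = C <+>\<^bsub>M\<^esub> D"
  "r \<odot>\<^bsub>quotient_module M N\<^esub> C = (\<Union>c\<in>C. N +>\<^bsub>M\<^esub> (r \<odot>\<^bsub>M\<^esub> c))"
  by (auto simp: quotient_module_def A_RCOSETS_def RCOSETS_def a_r_coset_def)

context plain_module
begin

context
  fixes N
  assumes N: "submodule N R M"
begin

lemma submodule_abelian_subgroup: "abelian_subgroup N M"
  using abelian_subgroupI2[OF M.a_comm_group submodule.axioms(1)[OF N]] .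

lemma quotient_add:
  "x \<in> carrier M \<Longrightarrow> y \<in> carrier M \<Longrightarrow>
    (N +>\<^bsub>M\<^esub> x) \<oplus>\<^bsub>quotient_module M N\<^esub> (N +>\<^bsub>M\<^esub> y) = N +>\<^bsub>M\<^esub> (x \<oplus>\<^bsub>M\<^esub> y)"
  by (simp add: quotient_module_simps abelian_subgroup.a_rcos_sum[OF submodule_abelian_subgroup])

lemma coset_eq_iff:
  assumes "x \<in> carrier M" "y \<in> carrier M"
  shows "N +>\<^bsub>M\<^esub> x = N +>\<^bsub>M\<^esub> y \<longleftrightarrow> x \<ominus>\<^bsub>M\<^esub> y \<in> N"
proof -
  interpret N: abelian_subgroup N M by (rule submodule_abelian_subgroup)
  show ?thesis
    unfolding a_minus_def N.a_rcos_module[OF assms(2,1), symmetric]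
    using N.a_repr_independence'[OF _ assms(2), of x] N.a_repr_independenceD[OF assms(1), of y] by metis
qed

lemma coset_eq_self_iff: "x \<in> carrier M \<Longrightarrow> N +>\<^bsub>M\<^esub> x = N \<longleftrightarrow> x \<in> N"
  using abelian_subgroup.a_rcos_const[OF submodule_abelian_subgroup]
    abelian_subgroup.a_rcos_self[OF submodule_abelian_subgroup] by blast

text \<open>Scaling in the quotient is a union over all representatives; since \<open>N\<close>
  absorbs scalars, the cosets in this nonempty union coincide.\<close>

lemma quotient_smult:
  assumes r: "r \<in> carrier R" and x: "x \<in> carrier M"
  shows "r \<odot>\<^bsub>quotient_module M N\<^esub> (N +>\<^bsub>M\<^esub> x) = N +>\<^bsub>M\<^esub> (r \<odot>\<^bsub>M\<^esub> x)"
proof -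
  interpret N: abelian_subgroup N M by (rule submodule_abelian_subgroup)
  have "N +>\<^bsub>M\<^esub> (r \<odot>\<^bsub>M\<^esub> c) = N +>\<^bsub>M\<^esub> (r \<odot>\<^bsub>M\<^esub> x)" if "c \<in> N +>\<^bsub>M\<^esub> x" for c
  proof -
    have c: "c \<in> carrier M" using that x N.a_elemrcos_carrier by blast
    have "c \<ominus>\<^bsub>M\<^esub> x \<in> N" using N.a_rcos_module[OF x c] that by (simp add: a_minus_def)
    then have "r \<odot>\<^bsub>M\<^esub> (c \<ominus>\<^bsub>M\<^esub> x) \<in> N" using submoduleE(4)[OF N] r by blast
    then show ?thesis
      using r x c by (simp add: coset_eq_iff a_minus_def smult_r_distr smult_r_minus)
  qed
  moreover have "x \<in> N +>\<^bsub>M\<^esub> x" using x by (rule N.a_rcos_self)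
  ultimately show ?thesis unfolding quotient_module_simps by blast
qed

lemma quotient_module_module: "plain_module R (quotient_module M N)"
proof (rule plain_module.intro, rule moduleI)
  note q = quotient_module_simps(1) quotient_add quotient_smult
  note zero = coset_eq_self_iff[THEN iffD2, OF M.zero_closed submodule_zero_closed[OF N]]
  show "abelian_group (quotient_module M N)"
  proof (rule abelian_groupI)
    show "\<zero>\<^bsub>quotient_module M N\<^esub> \<in> carrier (quotient_module M N)"
      using imageI[OF M.zero_closed, of "\<lambda>m. N +>\<^bsub>M\<^esub> m"]
      by (simp only: quotient_module_simps(1,2) zero)
    fix x assume "x \<in> carrier (quotient_module M N)"
    then obtain m where m: "m \<in> carrier M" "x = N +>\<^bsub>M\<^esub> m" by (auto simp: q)
    show "\<zero>\<^bsub>quotient_module M N\<^esub> \<oplus>\<^bsub>quotient_module M N\<^esub> x = x"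
      using m quotient_add[of "\<zero>\<^bsub>M\<^esub>" m] by (simp add: zero quotient_module_simps(2))
    have "(N +>\<^bsub>M\<^esub> (\<ominus>\<^bsub>M\<^esub> m)) \<oplus>\<^bsub>quotient_module M N\<^esub> x = \<zero>\<^bsub>quotient_module M N\<^esub>"
      using m by (simp add: quotient_add zero M.l_neg quotient_module_simps(2))
    then show "\<exists>y\<in>carrier (quotient_module M N). y \<oplus>\<^bsub>quotient_module M N\<^esub> x = \<zero>\<^bsub>quotient_module M N\<^esub>"
      using m(1) by (intro bexI[of _ "N +>\<^bsub>M\<^esub> (\<ominus>\<^bsub>M\<^esub> m)"]) (simp_all add: quotient_module_simps(1))
  qed (auto simp: q M.a_ac)
qed (auto simp: quotient_module_simps(1) quotient_add quotient_smult smult_l_distr smult_r_distr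
      smult_assoc1 R.is_cring)

lemma quotient_projection_linear: "linear_map R M (quotient_module M N) (\<lambda>m. N +>\<^bsub>M\<^esub> m)"
  by (rule linear_mapI) (auto simp: quotient_module_simps(1) quotient_add quotient_smult)

text \<open>Phrased for any \<open>g\<close> that is constant on cosets, because the exterior
  derivative of a representative is merely additive.\<close>

lemma quotient_the_eq:
  assumes "\<And>m m'. m \<in> carrier M \<Longrightarrow> m' \<in> carrier M \<Longrightarrow> m \<ominus>\<^bsub>M\<^esub> m' \<in> N \<Longrightarrow> g m = g m'"
    and m: "m \<in> carrier M"
  shows "(THE y. \<exists>c\<in>N +>\<^bsub>M\<^esub> m. y = g c) = g m"
proof -
  interpret N: abelian_subgroup N M by (rule submodule_abelian_subgroup)
  have "g c = g m" if "c \<in> N +>\<^bsub>M\<^esub> m" for c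
  proof -
    have c: "c \<in> carrier M" using that m N.a_elemrcos_carrier by blast
    have "c \<ominus>\<^bsub>M\<^esub> m \<in> N" using N.a_rcos_module[OF m c] that by (simp add: a_minus_def)
    then show ?thesis using assms(1) c m by blast
  qed
  moreover have "m \<in> N +>\<^bsub>M\<^esub> m" using m by (rule N.a_rcos_self)
  ultimately show ?thesis by (intro the_equality) (blast, metis)
qed

lemma quotient_the_linear:
  assumes P: "plain_module R P" and g: "linear_map R M P g" and ker: "\<And>n. n \<in> N \<Longrightarrow> g n = \<zero>\<^bsub>P\<^esub>"
  shows "linear_map R (quotient_module M N) P (\<lambda>C. THE y. \<exists>c\<in>C. y = g c)"
    and "m \<in> carrier M \<Longrightarrow> (THE y. \<exists>c\<in>N +>\<^bsub>M\<^esub> m. y = g c) = g m"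
proof -
  interpret P: plain_module R P by fact
  have eq: "(THE y. \<exists>c\<in>N +>\<^bsub>M\<^esub> m. y = g c) = g m" if m: "m \<in> carrier M" for m
  proof (rule quotient_the_eq[OF _ m])
    fix x y assume xy: "x \<in> carrier M" "y \<in> carrier M" "x \<ominus>\<^bsub>M\<^esub> y \<in> N"
    have "g x \<ominus>\<^bsub>P\<^esub> g y = \<zero>\<^bsub>P\<^esub>"
      unfolding linear_map_minus[OF plain_module_axioms P g xy(1,2), symmetric] by (rule ker[OF xy(3)])
    then show "g x = g y"
      using linear_map_closed[OF g] xy by (simp add: P.minus_eq_zero_iff)
  qed
  then show "m \<in> carrier M \<Longrightarrow> (THE y. \<exists>c\<in>N +>\<^bsub>M\<^esub> m. y = g c) = g m" .
  show "linear_map R (quotient_module M N) P (\<lambda>C. THE y. \<exists>c\<in>C. y = g c)"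
    by (rule linear_mapI)
      (auto simp: quotient_module_simps(1) quotient_add quotient_smult eq linear_mapD[OF g])
qed

end

end

subsection \<open>Modules given by generators and relations\<close>

text \<open>Common form of exterior powers, Kaehler differentials and tensor products. The universal
  properties of the first two become instances of \<open>presented_lift_linear\<close> and
  \<open>presented_lift_class\<close>.\<close>

definition presented :: "('r, 'e) ring_scheme \<Rightarrow> 's set \<Rightarrow> ('s \<Rightarrow> 'r) set \<Rightarrow> ('r, ('s \<Rightarrow> 'r) set) module" where
  "presented R S Q = quotient_module (free_module R S) (submodule_gen R (free_module R S) Q)"

definition presented_class ::
    "('r, 'e) ring_scheme \<Rightarrow> 's set \<Rightarrow> ('s \<Rightarrow> 'r) set \<Rightarrow> ('s \<Rightarrow> 'r) \<Rightarrow> ('s \<Rightarrow> 'r) set" where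
  "presented_class R S Q \<phi> = submodule_gen R (free_module R S) Q +>\<^bsub>free_module R S\<^esub> \<phi>"

locale presentation = cring R for R (structure) +
  fixes S :: "'s set" and Q :: "('s \<Rightarrow> 'a) set"
  assumes relations_closed: "Q \<subseteq> carrier (free_module R S)"
begin

sublocale F: plain_module R "free_module R S" by (rule free_module_module)

lemma kernel_submodule: "submodule (submodule_gen R (free_module R S) Q) R (free_module R S)"
  by (rule F.submodule_gen_submodule[OF relations_closed])

lemma presented_module: "plain_module R (presented R S Q)"
  unfolding presented_def by (rule F.quotient_module_module[OF kernel_submodule])

lemma class_linear: "linear_map R (free_module R S) (presented R S Q) (presented_class R S Q)"
  unfolding presented_def presented_class_def[abs_def]
  by (rule F.quotient_projection_linear[OF kernel_submodule])

lemma relation_class_zero: "\<phi> \<in> Q \<Longrightarrow> presented_class R S Q \<phi> = \<zero>\<^bsub>presented R S Q\<^esub>"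
  unfolding presented_def presented_class_def quotient_module_simps(2)
  by (rule F.coset_eq_self_iff[OF kernel_submodule, THEN iffD2])
    (rule subsetD[OF relations_closed], assumption, rule subsetD[OF submodule_gen_incl], assumption)

text \<open>Relations in the module constructions are formal differences; this reads them as
  equations between classes.\<close>

lemma relation_class_eq:
  assumes "\<phi> \<ominus>\<^bsub>free_module R S\<^esub> \<psi> \<in> Q" "\<phi> \<in> carrier (free_module R S)" "\<psi> \<in> carrier (free_module R S)"
  shows "presented_class R S Q \<phi> = presented_class R S Q \<psi>"
proof -
  interpret P: plain_module R "presented R S Q" by (rule presented_module)
  show ?thesis
    using relation_class_zero[OF assms(1)] assms(2,3)
    by (simp add: linear_map_minus[OF F.plain_module_axioms P.plain_module_axioms class_linear]
      linear_map_closed[OF class_linear] P.minus_eq_zero_iff)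
qed

lemma presented_carrier:
  "carrier (presented R S Q) = presented_class R S Q ` carrier (free_module R S)"
  by (simp add: presented_def presented_class_def quotient_module_simps(1))

lemma class_fgen_closed: "s \<in> S \<Longrightarrow> presented_class R S Q (fgen R s) \<in> carrier (presented R S Q)"
  by (rule linear_map_closed[OF class_linear fgen_closed])

text \<open>The preimage of \<open>N\<close> in the free module contains all generators, so it is
  everything.\<close>

lemma presented_span:
  assumes N: "submodule N R (presented R S Q)"
    and "\<And>s. s \<in> S \<Longrightarrow> presented_class R S Q (fgen R s) \<in> N" and x: "x \<in> carrier (presented R S Q)"
  shows "x \<in> N"
proof -
  obtain \<phi> where \<phi>: "\<phi> \<in> carrier (free_module R S)" "x = presented_class R S Q \<phi>"
    using x presented_carrier by auto
  have "\<phi> \<in> {\<phi> \<in> carrier (free_module R S). presented_class R S Q \<phi> \<in> N}"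
    by (rule free_module_span[OF linear_map_vimage_submodule[OF F.plain_module_axioms presented_module
      class_linear N] _ \<phi>(1)]) (simp add: assms(2) fgen_closed)
  then show ?thesis using \<phi> by simp
qed

text \<open>The set where two linear maps agree is a submodule, so generator classes
  suffice.\<close>

lemma presented_linear_eq:
  assumes "plain_module R P" "linear_map R (presented R S Q) P f" "linear_map R (presented R S Q) P g"
    and "\<And>s. s \<in> S \<Longrightarrow> f (presented_class R S Q (fgen R s)) = g (presented_class R S Q (fgen R s))"
    and "x \<in> carrier (presented R S Q)"
  shows "f x = g x"
proof -
  interpret P: plain_module R P by fact
  interpret Z: plain_module R "presented R S Q" by (rule presented_module)
  note f = linear_mapD[OF assms(2)] and g = linear_mapD[OF assms(3)]
  have "submodule {x \<in> carrier (presented R S Q). f x = g x} R (presented R S Q)"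
    by (rule Z.submoduleI)
      (auto simp: f g linear_map_zero[OF presented_module assms(1) assms(2)]
        linear_map_zero[OF presented_module assms(1) assms(3)]
        linear_map_uminus[OF presented_module assms(1) assms(2)]
        linear_map_uminus[OF presented_module assms(1) assms(3)])
  from presented_span[OF this _ assms(5)] show ?thesis by (simp add: assms(4) class_fgen_closed)
qed

context
  fixes P and f
  assumes P: "plain_module R P" and f: "f \<in> S \<rightarrow> carrier P"
    and rel: "\<And>\<phi>. \<phi> \<in> Q \<Longrightarrow> lin_ext R P f \<phi> = \<zero>\<^bsub>P\<^esub>"
begin

lemma lin_ext_kernel:
  assumes "\<phi> \<in> submodule_gen R (free_module R S) Q"
  shows "lin_ext R P f \<phi> = \<zero>\<^bsub>P\<^esub>"
  by (rule linear_map_submodule_gen[OF F.plain_module_axioms P plain_module.lin_ext_linear[OF P f]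
      relations_closed _ assms]) (rule rel)

lemma presented_lift_linear:
  "linear_map R (presented R S Q) P (\<lambda>C. THE y. \<exists>\<phi>\<in>C. y = lin_ext R P f \<phi>)"
  using F.quotient_the_linear(1)[OF kernel_submodule P plain_module.lin_ext_linear[OF P f] lin_ext_kernel]
  by (simp only: presented_def)

lemma presented_lift_class:
  assumes "s \<in> S"
  shows "(THE y. \<exists>\<phi>\<in>presented_class R S Q (fgen R s). y = lin_ext R P f \<phi>) = f s"
proof -
  have "(THE y. \<exists>\<phi>\<in>presented_class R S Q (fgen R s). y = lin_ext R P f \<phi>) = lin_ext R P f (fgen R s)"
    using F.quotient_the_linear(2)[OF kernel_submodule P plain_module.lin_ext_linear[OF P f]
        lin_ext_kernel fgen_closed[OF assms]]
    by (simp only: presented_class_def)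
  then show ?thesis by (simp only: plain_module.lin_ext_fgen[OF P f assms])
qed

end

end

section \<open>Alternating maps, left multiplication by a vector, and contraction\<close>

section \<open>Exterior powers\<close>

lemma ext_power_presented:
  "ext_power R M k = presented R (ext_tuples M k) (ext_relations R M k)"
  by (simp add: ext_power_def presented_def ext_kernel_def)

lemma wedge_presented:
  "wedge R M ms = presented_class R (ext_tuples M (length ms)) (ext_relations R M (length ms)) (fgen R ms)"
  by (simp add: wedge_def presented_class_def ext_kernel_def)

context plain_module
begin

lemma ext_presentation: "presentation R (ext_tuples M k) (ext_relations R M k)"
proof
  interpret F: plain_module R "free_module R (ext_tuples M k)" by (rule R.free_module_module)
  note c = F.minus_closed F.a_closed F.smult_closed R.fgen_closed
  show "ext_relations R M k \<subseteq> carrier (free_module R (ext_tuples M k))"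
    unfolding ext_relations_def Let_def
    by (intro Un_least subsetI; elim CollectE exE conjE; hypsubst; intro c)
      (simp_all add: ext_tuples_def)
qed

lemma ext_power_module: "plain_module R (ext_power R M k)"
  unfolding ext_power_presented by (rule presentation.presented_module[OF ext_presentation])

lemma wedge_closed:
  assumes "set ms \<subseteq> carrier M" "length ms = k"
  shows "wedge R M ms \<in> carrier (ext_power R M k)"
  using presentation.class_fgen_closed[OF ext_presentation, of ms "length ms"] assms
  by (simp add: wedge_presented ext_power_presented ext_tuples_def)

lemma wedge_add:
  assumes ms: "set xs \<subseteq> carrier M" "set ys \<subseteq> carrier M" "m \<in> carrier M" "m' \<in> carrier M"
    and k: "k = Suc (length xs + length ys)"
  shows "wedge R M (xs @ (m \<oplus>\<^bsub>M\<^esub> m') # ys) =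
    wedge R M (xs @ m # ys) \<oplus>\<^bsub>ext_power R M k\<^esub> wedge R M (xs @ m' # ys)"
proof -
  interpret E: presentation R "ext_tuples M k" "ext_relations R M k" by (rule ext_presentation)
  let ?F = "free_module R (ext_tuples M k)"
  have T: "xs @ a # ys \<in> ext_tuples M k" if "a \<in> carrier M" for a
    using ms k that by (simp add: ext_tuples_def)
  note g = R.fgen_closed[OF T]
  have "presented_class R (ext_tuples M k) (ext_relations R M k) (fgen R (xs @ (m \<oplus>\<^bsub>M\<^esub> m') # ys))
    = presented_class R (ext_tuples M k) (ext_relations R M k)
        (fgen R (xs @ m # ys) \<oplus>\<^bsub>?F\<^esub> fgen R (xs @ m' # ys))"
  proof (rule E.relation_class_eq)
    show "fgen R (xs @ (m \<oplus>\<^bsub>M\<^esub> m') # ys) \<ominus>\<^bsub>?F\<^esub> (fgen R (xs @ m # ys) \<oplus>\<^bsub>?F\<^esub> fgen R (xs @ m' # ys))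
      \<in> ext_relations R M k"
      unfolding ext_relations_def Let_def using T[OF ms(3)] ms(4) by (intro UnI1 CollectI) metis
  qed (intro g E.F.a_closed M.a_closed ms)+
  then show ?thesis
    using linear_map_add[OF E.class_linear g[OF ms(3)] g[OF ms(4)]] k
    by (simp add: wedge_presented ext_power_presented)
qed

lemma wedge_smult:
  assumes ms: "set xs \<subseteq> carrier M" "set ys \<subseteq> carrier M" "m \<in> carrier M" "r \<in> carrier R"
    and k: "k = Suc (length xs + length ys)"
  shows "wedge R M (xs @ (r \<odot>\<^bsub>M\<^esub> m) # ys) = r \<odot>\<^bsub>ext_power R M k\<^esub> wedge R M (xs @ m # ys)"
proof -
  interpret E: presentation R "ext_tuples M k" "ext_relations R M k" by (rule ext_presentation)
  let ?F = "free_module R (ext_tuples M k)"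
  have T: "xs @ a # ys \<in> ext_tuples M k" if "a \<in> carrier M" for a
    using ms k that by (simp add: ext_tuples_def)
  note g = R.fgen_closed[OF T]
  have "presented_class R (ext_tuples M k) (ext_relations R M k) (fgen R (xs @ (r \<odot>\<^bsub>M\<^esub> m) # ys))
    = presented_class R (ext_tuples M k) (ext_relations R M k) (r \<odot>\<^bsub>?F\<^esub> fgen R (xs @ m # ys))"
  proof (rule E.relation_class_eq)
    show "fgen R (xs @ (r \<odot>\<^bsub>M\<^esub> m) # ys) \<ominus>\<^bsub>?F\<^esub> (r \<odot>\<^bsub>?F\<^esub> fgen R (xs @ m # ys))
      \<in> ext_relations R M k"
      unfolding ext_relations_def Let_def using T[OF ms(3)] ms(4)
      by (intro UnI1[OF UnI2] CollectI) metis
  qed (intro g E.F.smult_closed smult_closed ms)+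
  then show ?thesis
    using linear_map_smult[OF E.class_linear ms(4) g[OF ms(3)]] k
    by (simp add: wedge_presented ext_power_presented)
qed

lemma wedge_not_distinct:
  assumes "set ms \<subseteq> carrier M" "length ms = k" "\<not> distinct ms"
  shows "wedge R M ms = \<zero>\<^bsub>ext_power R M k\<^esub>"
proof -
  interpret E: presentation R "ext_tuples M k" "ext_relations R M k" by (rule ext_presentation)
  have "fgen R ms \<in> ext_relations R M k"
    unfolding ext_relations_def Let_def using assms
    by (intro UnI2 CollectI exI[of _ ms]) (simp add: ext_tuples_def)
  from E.relation_class_zero[OF this] show ?thesis
    using assms(2) by (simp add: wedge_presented ext_power_presented)
qed

lemma ext_power_span:
  assumes "submodule N R (ext_power R M k)"
    and "\<And>ms. set ms \<subseteq> carrier M \<Longrightarrow> length ms = k \<Longrightarrow> wedge R M ms \<in> N"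
    and "\<theta> \<in> carrier (ext_power R M k)"
  shows "\<theta> \<in> N"
  using assms presentation.presented_span[OF ext_presentation, of N k \<theta>]
  by (simp add: wedge_presented ext_power_presented ext_tuples_def)

text \<open>A slot is exhibited by splitting the list as \<open>xs @ m # ys\<close>, and alternation
  means vanishing on repeated entries, in step with \<open>ext_relations\<close>.\<close>

definition multilinear_alternating :: "nat \<Rightarrow> ('a, 'n) module \<Rightarrow> ('m list \<Rightarrow> 'n) \<Rightarrow> bool" where
  "multilinear_alternating k P f \<longleftrightarrow> f \<in> ext_tuples M k \<rightarrow> carrier P \<and>
     (\<forall>xs ys m m'. xs @ m # ys \<in> ext_tuples M k \<and> m' \<in> carrier M \<longrightarrow>
        f (xs @ (m \<oplus>\<^bsub>M\<^esub> m') # ys) = f (xs @ m # ys) \<oplus>\<^bsub>P\<^esub> f (xs @ m' # ys)) \<and>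
     (\<forall>xs ys m r. xs @ m # ys \<in> ext_tuples M k \<and> r \<in> carrier R \<longrightarrow>
        f (xs @ (r \<odot>\<^bsub>M\<^esub> m) # ys) = r \<odot>\<^bsub>P\<^esub> f (xs @ m # ys)) \<and>
     (\<forall>ms\<in>ext_tuples M k. \<not> distinct ms \<longrightarrow> f ms = \<zero>\<^bsub>P\<^esub>)"

text \<open>The three families of relations are killed one by one by additivity, homogeneity and
  alternation; the presentation then supplies the lift.\<close>

lemma ext_lift:
  assumes P: "plain_module R P" and f: "multilinear_alternating k P f"
  shows "linear_map R (ext_power R M k) P (\<lambda>C. THE y. \<exists>\<phi>\<in>C. y = lin_ext R P f \<phi>)"
    and "set ms \<subseteq> carrier M \<Longrightarrow> length ms = k \<Longrightarrow>
      (THE y. \<exists>\<phi>\<in>wedge R M ms. y = lin_ext R P f \<phi>) = f ms"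
proof -
  interpret E: presentation R "ext_tuples M k" "ext_relations R M k" by (rule ext_presentation)
  interpret P: plain_module R P by (rule P)
  let ?F = "free_module R (ext_tuples M k)"
  have f0: "f \<in> ext_tuples M k \<rightarrow> carrier P"
    and f1: "\<And>xs ys m m'. xs @ m # ys \<in> ext_tuples M k \<Longrightarrow> m' \<in> carrier M \<Longrightarrow>
        f (xs @ (m \<oplus>\<^bsub>M\<^esub> m') # ys) = f (xs @ m # ys) \<oplus>\<^bsub>P\<^esub> f (xs @ m' # ys)"
    and f2: "\<And>xs ys m r. xs @ m # ys \<in> ext_tuples M k \<Longrightarrow> r \<in> carrier R \<Longrightarrow>
        f (xs @ (r \<odot>\<^bsub>M\<^esub> m) # ys) = r \<odot>\<^bsub>P\<^esub> f (xs @ m # ys)"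
    and f3: "\<And>ms. ms \<in> ext_tuples M k \<Longrightarrow> \<not> distinct ms \<Longrightarrow> f ms = \<zero>\<^bsub>P\<^esub>"
    using f unfolding multilinear_alternating_def by simp_all
  note lin = P.lin_ext_linear[OF f0]
  note fg = P.lin_ext_fgen[OF f0]
  note minus = linear_map_minus[OF E.F.plain_module_axioms P lin]
  have rel: "lin_ext R P f \<phi> = \<zero>\<^bsub>P\<^esub>" if \<phi>: "\<phi> \<in> ext_relations R M k" for \<phi>
    using \<phi>[unfolded ext_relations_def Let_def]
  proof (elim UnE CollectE exE conjE)
    fix xs ys m m'
    assume \<phi>: "\<phi> = fgen R (xs @ (m \<oplus>\<^bsub>M\<^esub> m') # ys) \<ominus>\<^bsub>?F\<^esub>
        (fgen R (xs @ m # ys) \<oplus>\<^bsub>?F\<^esub> fgen R (xs @ m' # ys))"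
      and T: "xs @ m # ys \<in> ext_tuples M k" and m': "m' \<in> carrier M"
    have T': "xs @ m' # ys \<in> ext_tuples M k" "xs @ (m \<oplus>\<^bsub>M\<^esub> m') # ys \<in> ext_tuples M k"
      using T m' by (simp_all add: ext_tuples_def)
    note g = R.fgen_closed[OF T] R.fgen_closed[OF T'(1)] R.fgen_closed[OF T'(2)]
    show ?thesis
      unfolding \<phi> minus[OF g(3) E.F.a_closed[OF g(1,2)]] linear_map_add[OF lin g(1,2)]
        fg[OF T] fg[OF T'(1)] fg[OF T'(2)] f1[OF T m']
      using funcset_mem[OF f0 T] funcset_mem[OF f0 T'(1)] by (simp add: P.minus_eq_zero_iff)
  next
    fix xs ys r m
    assume \<phi>: "\<phi> = fgen R (xs @ (r \<odot>\<^bsub>M\<^esub> m) # ys) \<ominus>\<^bsub>?F\<^esub> (r \<odot>\<^bsub>?F\<^esub> fgen R (xs @ m # ys))"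
      and T: "xs @ m # ys \<in> ext_tuples M k" and r: "r \<in> carrier R"
    have T': "xs @ (r \<odot>\<^bsub>M\<^esub> m) # ys \<in> ext_tuples M k"
      using T r by (simp add: ext_tuples_def)
    note g = R.fgen_closed[OF T] R.fgen_closed[OF T']
    show ?thesis
      unfolding \<phi> minus[OF g(2) E.F.smult_closed[OF r g(1)]] linear_map_smult[OF lin r g(1)]
        fg[OF T] fg[OF T'] f2[OF T r]
      using funcset_mem[OF f0 T] r by (simp add: P.minus_eq_zero_iff)
  next
    fix ms assume "\<phi> = fgen R ms" "ms \<in> ext_tuples M k" "\<not> distinct ms"
    then show ?thesis by (simp add: fg f3)
  qed
  show "linear_map R (ext_power R M k) P (\<lambda>C. THE y. \<exists>\<phi>\<in>C. y = lin_ext R P f \<phi>)"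
    unfolding ext_power_presented by (rule E.presented_lift_linear[OF P f0 rel])
  show "(THE y. \<exists>\<phi>\<in>wedge R M ms. y = lin_ext R P f \<phi>) = f ms"
    if "set ms \<subseteq> carrier M" "length ms = k"
    unfolding wedge_presented that(2)
    by (rule E.presented_lift_class[OF P f0 rel]) (use that in \<open>simp_all add: ext_tuples_def\<close>)
qed

text \<open>Prepending \<open>w\<close> moves every slot by one place and keeps repetitions, so it
  is multilinear and alternating; hence the value of \<open>wedge_left\<close> does not depend on
  the representative.\<close>

lemma wedge_left:
  assumes w: "w \<in> carrier M"
  shows wedge_left_linear: "linear_map R (ext_power R M k) (ext_power R M (Suc k)) (wedge_left R M k w)"
    and wedge_left_wedge: "set ms \<subseteq> carrier M \<Longrightarrow> length ms = k \<Longrightarrow>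
      wedge_left R M k w (wedge R M ms) = wedge R M (w # ms)"
proof -
  have eq: "wedge_left R M k w =
      (\<lambda>C. THE y. \<exists>\<phi>\<in>C. y = lin_ext R (ext_power R M (Suc k)) (\<lambda>ms. wedge R M (w # ms)) \<phi>)"
    by (simp add: wedge_left_def lin_ext_def fun_eq_iff)
  have "multilinear_alternating k (ext_power R M (Suc k)) (\<lambda>ms. wedge R M (w # ms))"
    unfolding multilinear_alternating_def
  proof (intro conjI allI impI ballI funcsetI)
    fix xs ys m m' assume "xs @ m # ys \<in> ext_tuples M k \<and> m' \<in> carrier M"
    then show "wedge R M (w # xs @ (m \<oplus>\<^bsub>M\<^esub> m') # ys) =
      wedge R M (w # xs @ m # ys) \<oplus>\<^bsub>ext_power R M (Suc k)\<^esub> wedge R M (w # xs @ m' # ys)"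
      using wedge_add[of "w # xs" ys m m' "Suc k"] w by (auto simp: ext_tuples_def)
  next
    fix xs ys m r assume "xs @ m # ys \<in> ext_tuples M k \<and> r \<in> carrier R"
    then show "wedge R M (w # xs @ (r \<odot>\<^bsub>M\<^esub> m) # ys) =
      r \<odot>\<^bsub>ext_power R M (Suc k)\<^esub> wedge R M (w # xs @ m # ys)"
      using wedge_smult[of "w # xs" ys m r "Suc k"] w by (auto simp: ext_tuples_def)
  next
    fix ms assume "ms \<in> ext_tuples M k"
    then show "wedge R M (w # ms) \<in> carrier (ext_power R M (Suc k))"
      using w by (intro wedge_closed) (auto simp: ext_tuples_def)
  next
    fix ms assume "ms \<in> ext_tuples M k" "\<not> distinct ms"
    then show "wedge R M (w # ms) = \<zero>\<^bsub>ext_power R M (Suc k)\<^esub>"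
      using w by (intro wedge_not_distinct) (auto simp: ext_tuples_def)
  qed
  note lift = ext_lift[OF ext_power_module this]
  show "linear_map R (ext_power R M k) (ext_power R M (Suc k)) (wedge_left R M k w)"
    unfolding eq by (rule lift)
  show "set ms \<subseteq> carrier M \<Longrightarrow> length ms = k \<Longrightarrow>
      wedge_left R M k w (wedge R M ms) = wedge R M (w # ms)"
    unfolding eq by (rule lift)
qed

lemma wedge_pair_simps:
  assumes "a \<in> carrier M" "b \<in> carrier M"
  shows "wedge R M [a, b] \<in> carrier (ext_power R M 2)"
    and "c \<in> carrier M \<Longrightarrow>
      wedge R M [a \<oplus>\<^bsub>M\<^esub> c, b] = wedge R M [a, b] \<oplus>\<^bsub>ext_power R M 2\<^esub> wedge R M [c, b]"
    and "c \<in> carrier M \<Longrightarrow>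
      wedge R M [a, b \<oplus>\<^bsub>M\<^esub> c] = wedge R M [a, b] \<oplus>\<^bsub>ext_power R M 2\<^esub> wedge R M [a, c]"
    and "r \<in> carrier R \<Longrightarrow> wedge R M [r \<odot>\<^bsub>M\<^esub> a, b] = r \<odot>\<^bsub>ext_power R M 2\<^esub> wedge R M [a, b]"
    and "r \<in> carrier R \<Longrightarrow> wedge R M [a, r \<odot>\<^bsub>M\<^esub> b] = r \<odot>\<^bsub>ext_power R M 2\<^esub> wedge R M [a, b]"
  using assms wedge_add[of "[]" "[b]" a c 2] wedge_add[of "[a]" "[]" b c 2]
    wedge_smult[of "[]" "[b]" a r 2] wedge_smult[of "[a]" "[]" b r 2]
  by (simp_all add: wedge_closed)

lemma wedge_self: "a \<in> carrier M \<Longrightarrow> wedge R M [a, a] = \<zero>\<^bsub>ext_power R M 2\<^esub>"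
  by (rule wedge_not_distinct) simp_all

lemma wedge_zero_left:
  assumes "b \<in> carrier M"
  shows "wedge R M [\<zero>\<^bsub>M\<^esub>, b] = \<zero>\<^bsub>ext_power R M 2\<^esub>"
proof -
  interpret E: plain_module R "ext_power R M 2" by (rule ext_power_module)
  show ?thesis
    using wedge_pair_simps(4)[OF M.zero_closed assms R.zero_closed] wedge_pair_simps(1)[OF M.zero_closed assms]
    by simp
qed

text \<open>Polarization: expand the vanishing square of a + b.\<close>

lemma wedge_pair_swap:
  assumes "a \<in> carrier M" "b \<in> carrier M"
  shows "wedge R M [a, b] \<oplus>\<^bsub>ext_power R M 2\<^esub> wedge R M [b, a] = \<zero>\<^bsub>ext_power R M 2\<^esub>"
proof -
  interpret E: plain_module R "ext_power R M 2" by (rule ext_power_module)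
  show ?thesis
    using wedge_self[OF M.a_closed[OF assms]] assms
    by (simp add: wedge_pair_simps wedge_self[OF assms(1)] wedge_self[OF assms(2)] E.a_comm)
qed

lemma linear_map_diff:
  assumes "plain_module R P" "linear_map R P M f" "linear_map R P M g"
  shows "linear_map R P M (\<lambda>x. f x \<ominus>\<^bsub>M\<^esub> g x)"
proof -
  interpret P: plain_module R P by fact
  note f = linear_mapD[OF assms(2)] and g = linear_mapD[OF assms(3)]
  show ?thesis
    by (rule linear_mapI)
      (simp_all add: f g M.a_ac M.minus_add smult_r_distr smult_r_minus a_minus_def)
qed

lemma linear_map_smult_const: "r \<in> carrier R \<Longrightarrow> linear_map R M M (\<lambda>x. r \<odot>\<^bsub>M\<^esub> x)"
  by (rule linear_mapI) (simp_all add: smult_r_distr smult_assoc1[symmetric] R.m_comm)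

text \<open>Contracting \<open>w \<and> \<theta>\<close> with \<open>v\<close> gives \<open>v(w) \<theta> - w \<and> i\<^sub>v \<theta>\<close>.\<close>
lemma contraction_of_wedge:
  assumes v: "linear_map R M (regular_module R) v" and w: "w \<in> carrier M"
    and \<theta>: "\<theta> \<in> carrier (ext_power R M 2)"
    and zero: "wedge_left R M 2 w \<theta> = \<zero>\<^bsub>ext_power R M 3\<^esub>"
  shows "v w \<odot>\<^bsub>ext_power R M 2\<^esub> \<theta> \<in> wedge_left R M 1 w ` carrier (ext_power R M 1)"
proof -
  let ?E = "\<lambda>k. ext_power R M k"
  interpret E1: plain_module R "?E 1" by (rule ext_power_module)
  interpret E2: plain_module R "?E 2" by (rule ext_power_module)
  interpret E3: plain_module R "?E 3" by (rule ext_power_module)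
  have v_closed: "v a \<in> carrier R" if "a \<in> carrier M" for a
    using linear_map_closed[OF v that] by (simp add: regular_module_def)
  have v_add: "v (a \<oplus>\<^bsub>M\<^esub> b) = v a \<oplus> v b" if "a \<in> carrier M" "b \<in> carrier M" for a b
    using linear_map_add[OF v that] by (simp add: regular_module_def)
  have v_smult: "v (r \<odot>\<^bsub>M\<^esub> a) = r \<otimes> v a" if "r \<in> carrier R" "a \<in> carrier M" for a r
    using linear_map_smult[OF v that] by (simp add: regular_module_def)
  \<comment> \<open>Contraction of a 3-form with \<open>v\<close> in cyclic form: v(a) b\<and>c +
    v(b) c\<and>a + v(c) a\<and>b. All signs are positive, so additivity in each slot is plain
    rearrangement.\<close>
  define \<iota> where "\<iota> = (\<lambda>ms. (v (ms ! 0) \<odot>\<^bsub>?E 2\<^esub> wedge R M [ms ! 1, ms ! 2] \<oplus>\<^bsub>?E 2\<^esub>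
    v (ms ! 1) \<odot>\<^bsub>?E 2\<^esub> wedge R M [ms ! 2, ms ! 0]) \<oplus>\<^bsub>?E 2\<^esub>
    v (ms ! 2) \<odot>\<^bsub>?E 2\<^esub> wedge R M [ms ! 0, ms ! 1])"
  have \<iota>: "\<iota> [a, b, c] = (v a \<odot>\<^bsub>?E 2\<^esub> wedge R M [b, c] \<oplus>\<^bsub>?E 2\<^esub>
    v b \<odot>\<^bsub>?E 2\<^esub> wedge R M [c, a]) \<oplus>\<^bsub>?E 2\<^esub> v c \<odot>\<^bsub>?E 2\<^esub> wedge R M [a, b]" for a b c
    by (simp add: \<iota>_def)
  note ws = wedge_pair_simps v_closed
  have swap: "r \<odot>\<^bsub>?E 2\<^esub> wedge R M [b, a] = \<ominus>\<^bsub>?E 2\<^esub> (r \<odot>\<^bsub>?E 2\<^esub> wedge R M [a, b])"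
    if "a \<in> carrier M" "b \<in> carrier M" "r \<in> carrier R" for a b r
    using E2.minus_equality[OF wedge_pair_swap[OF that(2,1)], symmetric] that
    by (simp add: ws E2.smult_r_minus)
  have cancel: "x \<oplus>\<^bsub>?E 2\<^esub> (y \<oplus>\<^bsub>?E 2\<^esub> \<ominus>\<^bsub>?E 2\<^esub> x) = y"
    if "x \<in> carrier (?E 2)" "y \<in> carrier (?E 2)" for x y
    using that by (simp add: E2.a_lcomm[of x y] E2.r_neg)
  have tuple3: "\<exists>a b c. ms = [a, b, c] \<and> a \<in> carrier M \<and> b \<in> carrier M \<and> c \<in> carrier M"
    if "ms \<in> ext_tuples M 3" for ms
    using that by (auto simp: ext_tuples_def numeral_eq_Suc length_Suc_conv)
  \<comment> \<open>Multilinearity is tested in each of three slots; the position of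
    \<open>m\<close> in the list decides which one.\<close>
  have cases3: thesis if "xs @ m # ys \<in> ext_tuples M 3"
    and "\<And>b c. xs = [] \<Longrightarrow> ys = [b, c] \<Longrightarrow> b \<in> carrier M \<Longrightarrow> c \<in> carrier M \<Longrightarrow> m \<in> carrier M \<Longrightarrow> thesis"
    and "\<And>a c. xs = [a] \<Longrightarrow> ys = [c] \<Longrightarrow> a \<in> carrier M \<Longrightarrow> c \<in> carrier M \<Longrightarrow> m \<in> carrier M \<Longrightarrow> thesis"
    and "\<And>a b. xs = [a, b] \<Longrightarrow> ys = [] \<Longrightarrow> a \<in> carrier M \<Longrightarrow> b \<in> carrier M \<Longrightarrow> m \<in> carrier M \<Longrightarrow> thesis"
    for xs ys m thesis
  proof -
    from tuple3[OF that(1)] obtain a b c where "xs @ m # ys = [a, b, c]"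
      "a \<in> carrier M" "b \<in> carrier M" "c \<in> carrier M" by blast
    then show thesis using that(2-4) by (auto simp: append_eq_Cons_conv)
  qed
  have "multilinear_alternating 3 (?E 2) \<iota>"
    unfolding multilinear_alternating_def
  proof (intro conjI allI impI ballI funcsetI)
    fix xs ys m m' assume "xs @ m # ys \<in> ext_tuples M 3 \<and> m' \<in> carrier M"
    then have T: "xs @ m # ys \<in> ext_tuples M 3" and m': "m' \<in> carrier M" by auto
    from T show "\<iota> (xs @ (m \<oplus>\<^bsub>M\<^esub> m') # ys) = \<iota> (xs @ m # ys) \<oplus>\<^bsub>?E 2\<^esub> \<iota> (xs @ m' # ys)"
      by (rule cases3)
        (use m' in \<open>simp_all add: \<iota> ws v_add E2.smult_l_distr E2.smult_r_distr E2.a_ac\<close>)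
  next
    fix xs ys m r assume "xs @ m # ys \<in> ext_tuples M 3 \<and> r \<in> carrier R"
    then have T: "xs @ m # ys \<in> ext_tuples M 3" and r: "r \<in> carrier R" by auto
    from T show "\<iota> (xs @ (r \<odot>\<^bsub>M\<^esub> m) # ys) = r \<odot>\<^bsub>?E 2\<^esub> \<iota> (xs @ m # ys)"
      by (rule cases3)
        (use r in \<open>simp_all add: \<iota> ws v_smult E2.smult_r_distr E2.smult_assoc1[symmetric] R.m_comm\<close>)
  next
    fix ms assume "ms \<in> ext_tuples M 3"
    from tuple3[OF this] show "\<iota> ms \<in> carrier (?E 2)" by (auto simp: \<iota> ws)
  next
    fix ms assume ms: "ms \<in> ext_tuples M 3" "\<not> distinct ms"
    then obtain a b c where abc: "ms = [a, b, c]" "a \<in> carrier M" "b \<in> carrier M" "c \<in> carrier M"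
      using tuple3[OF ms(1)] by blast
    with ms(2) consider "a = b" | "a = c" | "b = c" by auto
    then show "\<iota> ms = \<zero>\<^bsub>?E 2\<^esub>"
    proof cases
      case 1
      then show ?thesis
        using abc swap[of b c "v b"] by (simp add: \<iota> ws wedge_self E2.r_neg)
    next
      case 2
      then show ?thesis
        using abc swap[of b c "v c"] by (simp add: \<iota> ws wedge_self E2.l_neg E2.r_neg)
    next
      case 3
      then show ?thesis
        using abc swap[of a c "v c"] by (simp add: \<iota> ws wedge_self E2.l_neg E2.r_neg)
    qed
  qed
  note lift = ext_lift[OF ext_power_module this]
  define I where "I = (\<lambda>C. THE y. \<exists>\<phi>\<in>C. y = lin_ext R (?E 2) \<iota> \<phi>)"
  have I: "linear_map R (?E 3) (?E 2) I"
    and I_wedge: "I (wedge R M [a, b, c]) = \<iota> [a, b, c]"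
    if "a \<in> carrier M" "b \<in> carrier M" "c \<in> carrier M" for a b c
    unfolding I_def using lift(1) lift(2)[of "[a, b, c]"] that by simp_all
  have wl2: "linear_map R (?E 2) (?E 3) (wedge_left R M 2 w)"
    using wedge_left_linear[OF w, of 2] by (simp add: numeral_eq_Suc)
  have wl1: "linear_map R (?E 1) (?E 2) (wedge_left R M 1 w)"
    using wedge_left_linear[OF w, of 1] by (simp add: numeral_eq_Suc)
  note l1 = linear_mapD[OF wl1]
  have "I (wedge_left R M 2 w \<theta>) = \<zero>\<^bsub>?E 2\<^esub>"
    unfolding zero by (rule linear_map_zero[OF ext_power_module ext_power_module I[OF w w w]])
  \<comment> \<open>The congruence between v(w) \<theta> and the contraction of w \<and> \<theta>,
    modulo the image of left multiplication by \<open>w\<close>, cuts out a submodule of 2-forms, so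
    pure wedges suffice.\<close>
  moreover have "\<theta> \<in> {\<theta> \<in> carrier (?E 2). v w \<odot>\<^bsub>?E 2\<^esub> \<theta> \<ominus>\<^bsub>?E 2\<^esub> I (wedge_left R M 2 w \<theta>)
      \<in> wedge_left R M 1 w ` carrier (?E 1)}" (is "\<theta> \<in> ?N")
  proof (rule ext_power_span[OF _ _ \<theta>])
    show "submodule ?N R (?E 2)"
      by (rule linear_map_vimage_submodule[OF ext_power_module ext_power_module
          E2.linear_map_diff[OF ext_power_module E2.linear_map_smult_const linear_map_comp[OF wl2 I[OF w w w]]]
          linear_map_image_submodule[OF ext_power_module ext_power_module wl1]])
        (rule v_closed[OF w])
    fix ms assume "set ms \<subseteq> carrier M" "length ms = 2"
    then obtain a b where ab: "ms = [a, b]" "a \<in> carrier M" "b \<in> carrier M"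
      by (auto simp: numeral_eq_Suc length_Suc_conv)
    have W1: "wedge R M [c] \<in> carrier (?E 1)" if "c \<in> carrier M" for c
      using that by (simp add: wedge_closed)
    \<comment> \<open>The contraction of a \<and> b with \<open>v\<close>.\<close>
    let ?\<eta> = "v a \<odot>\<^bsub>?E 1\<^esub> wedge R M [b] \<ominus>\<^bsub>?E 1\<^esub> v b \<odot>\<^bsub>?E 1\<^esub> wedge R M [a]"
    have "wedge_left R M 1 w ?\<eta> = v a \<odot>\<^bsub>?E 2\<^esub> wedge R M [w, b] \<ominus>\<^bsub>?E 2\<^esub> v b \<odot>\<^bsub>?E 2\<^esub> wedge R M [w, a]"
      using ab w W1 v_closed
      by (simp add: linear_map_minus[OF ext_power_module ext_power_module wl1] l1 wedge_left_wedge
          del: One_nat_def)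
    also have "\<dots> = v w \<odot>\<^bsub>?E 2\<^esub> wedge R M [a, b] \<ominus>\<^bsub>?E 2\<^esub> \<iota> [w, a, b]"
      using ab w swap[of w b "v a"] by (simp add: \<iota> ws E2.a_ac E2.minus_add a_minus_def cancel)
    also have "\<dots> = v w \<odot>\<^bsub>?E 2\<^esub> wedge R M ms \<ominus>\<^bsub>?E 2\<^esub> I (wedge_left R M 2 w (wedge R M ms))"
      using ab w by (simp add: wedge_left_wedge I_wedge)
    finally have "v w \<odot>\<^bsub>?E 2\<^esub> wedge R M ms \<ominus>\<^bsub>?E 2\<^esub> I (wedge_left R M 2 w (wedge R M ms))
      = wedge_left R M 1 w ?\<eta>" by simp
    moreover have "?\<eta> \<in> carrier (?E 1)" using ab W1 v_closed by (simp del: One_nat_def)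
    moreover have "wedge R M ms \<in> carrier (?E 2)" using ab by (simp add: ws)
    ultimately show "wedge R M ms \<in> ?N" by (simp only: mem_Collect_eq imageI simp_thms)
  qed
  \<comment> \<open>Since w \<and> \<theta> = 0, the subtracted contraction is zero and the
    congruence puts v(w) \<theta> itself into the image.\<close>
  ultimately show ?thesis using \<theta> v_closed[OF w] E2.minus_equality[of "\<zero>\<^bsub>?E 2\<^esub>" "\<zero>\<^bsub>?E 2\<^esub>"]
    by (simp add: a_minus_def)
qed

end

section \<open>The universal derivation and the exterior derivative of 1-forms\<close>

section \<open>Kaehler differentials\<close>

lemma kaehler_presented: "kaehler R k = presented R (carrier R) (kaehler_relations R k)"
  by (simp add: kaehler_def presented_def kaehler_kernel_def)

lemma kaehler_d_presented:
  "kaehler_d R k a = presented_class R (carrier R) (kaehler_relations R k) (fgen R a)"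
  by (simp add: kaehler_d_def presented_class_def kaehler_kernel_def)

text \<open>The constants are a bare set \<open>k\<close>, as in \<open>kaehler_relations\<close>;
  for stalks it is the set of germs of constant functions.\<close>

definition derivation :: "('r, 'e) ring_scheme \<Rightarrow> 'r set \<Rightarrow> ('r, 'm) module \<Rightarrow> ('r \<Rightarrow> 'm) \<Rightarrow> bool" where
  "derivation R k P \<delta> \<longleftrightarrow> \<delta> \<in> carrier R \<rightarrow> carrier P \<and>
     (\<forall>a\<in>carrier R. \<forall>b\<in>carrier R. \<delta> (a \<oplus>\<^bsub>R\<^esub> b) = \<delta> a \<oplus>\<^bsub>P\<^esub> \<delta> b) \<and>
     (\<forall>a\<in>carrier R. \<forall>b\<in>carrier R.
        \<delta> (a \<otimes>\<^bsub>R\<^esub> b) = a \<odot>\<^bsub>P\<^esub> \<delta> b \<oplus>\<^bsub>P\<^esub> b \<odot>\<^bsub>P\<^esub> \<delta> a) \<and>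
     (\<forall>c\<in>k. \<delta> c = \<zero>\<^bsub>P\<^esub>)"

lemma derivationD:
  assumes "derivation R k P \<delta>"
  shows "a \<in> carrier R \<Longrightarrow> \<delta> a \<in> carrier P"
    and "a \<in> carrier R \<Longrightarrow> b \<in> carrier R \<Longrightarrow> \<delta> (a \<oplus>\<^bsub>R\<^esub> b) = \<delta> a \<oplus>\<^bsub>P\<^esub> \<delta> b"
    and "a \<in> carrier R \<Longrightarrow> b \<in> carrier R \<Longrightarrow>
      \<delta> (a \<otimes>\<^bsub>R\<^esub> b) = a \<odot>\<^bsub>P\<^esub> \<delta> b \<oplus>\<^bsub>P\<^esub> b \<odot>\<^bsub>P\<^esub> \<delta> a"
    and "c \<in> k \<Longrightarrow> \<delta> c = \<zero>\<^bsub>P\<^esub>"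
  using assms by (auto simp: derivation_def)

lemma derivationI:
  assumes "\<And>a. a \<in> carrier R \<Longrightarrow> \<delta> a \<in> carrier P"
    and "\<And>a b. a \<in> carrier R \<Longrightarrow> b \<in> carrier R \<Longrightarrow> \<delta> (a \<oplus>\<^bsub>R\<^esub> b) = \<delta> a \<oplus>\<^bsub>P\<^esub> \<delta> b"
    and "\<And>a b. a \<in> carrier R \<Longrightarrow> b \<in> carrier R \<Longrightarrow>
      \<delta> (a \<otimes>\<^bsub>R\<^esub> b) = a \<odot>\<^bsub>P\<^esub> \<delta> b \<oplus>\<^bsub>P\<^esub> b \<odot>\<^bsub>P\<^esub> \<delta> a"
    and "\<And>c. c \<in> k \<Longrightarrow> \<delta> c = \<zero>\<^bsub>P\<^esub>"
  shows "derivation R k P \<delta>"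
  using assms by (auto simp: derivation_def)

locale differentials = cring R for R (structure) +
  fixes k :: "'a set"
  assumes constants_closed: "k \<subseteq> carrier R"
begin

lemma kaehler_presentation: "presentation R (carrier R) (kaehler_relations R k)"
proof
  interpret F: plain_module R "free_module R (carrier R)" by (rule free_module_module)
  note c = F.minus_closed F.a_closed F.smult_closed fgen_closed
  show "kaehler_relations R k \<subseteq> carrier (free_module R (carrier R))"
    unfolding kaehler_relations_def Let_def
    by (intro Un_least subsetI; elim CollectE exE conjE; hypsubst; intro c)
      (use constants_closed in auto)
qed

sublocale K: presentation R "carrier R" "kaehler_relations R k"
  by (rule kaehler_presentation)

lemma kaehler_module: "plain_module R (kaehler R k)"
  unfolding kaehler_presented by (rule K.presented_module)

sublocale \<Omega>: plain_module R "kaehler R k" by (rule kaehler_module)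

text \<open>Each derivation rule is the trace of one family of generators in
  \<open>kaehler_relations\<close>.\<close>

lemma kaehler_d_derivation: "derivation R k (kaehler R k) (kaehler_d R k)"
proof (rule derivationI)
  let ?F = "free_module R (carrier R)"
  let ?c = "presented_class R (carrier R) (kaehler_relations R k)"
  note g = fgen_closed
  fix a assume a: "a \<in> carrier R"
  show "kaehler_d R k a \<in> carrier (kaehler R k)"
    unfolding kaehler_presented kaehler_d_presented by (rule K.class_fgen_closed[OF a])
  fix b assume b: "b \<in> carrier R"
  have "?c (fgen R (a \<oplus> b)) = ?c (fgen R a \<oplus>\<^bsub>?F\<^esub> fgen R b)"
  proof (rule K.relation_class_eq)
    show "fgen R (a \<oplus> b) \<ominus>\<^bsub>?F\<^esub> (fgen R a \<oplus>\<^bsub>?F\<^esub> fgen R b) \<in> kaehler_relations R k"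
      unfolding kaehler_relations_def Let_def using a b by (intro UnI1 CollectI) metis
  qed (intro g K.F.a_closed a_closed a b)+
  then show "kaehler_d R k (a \<oplus> b) = kaehler_d R k a \<oplus>\<^bsub>kaehler R k\<^esub> kaehler_d R k b"
    unfolding kaehler_presented kaehler_d_presented
    by (simp only: linear_map_add[OF K.class_linear g[OF a] g[OF b]])
  have "?c (fgen R (a \<otimes> b)) = ?c ((a \<odot>\<^bsub>?F\<^esub> fgen R b) \<oplus>\<^bsub>?F\<^esub> (b \<odot>\<^bsub>?F\<^esub> fgen R a))"
  proof (rule K.relation_class_eq)
    show "fgen R (a \<otimes> b) \<ominus>\<^bsub>?F\<^esub> ((a \<odot>\<^bsub>?F\<^esub> fgen R b) \<oplus>\<^bsub>?F\<^esub> (b \<odot>\<^bsub>?F\<^esub> fgen R a)) \<in> kaehler_relations R k"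
      unfolding kaehler_relations_def Let_def using a b by (intro UnI1[OF UnI2] CollectI) metis
  qed (intro g K.F.a_closed K.F.smult_closed m_closed a b)+
  then show "kaehler_d R k (a \<otimes> b) =
      a \<odot>\<^bsub>kaehler R k\<^esub> kaehler_d R k b \<oplus>\<^bsub>kaehler R k\<^esub> b \<odot>\<^bsub>kaehler R k\<^esub> kaehler_d R k a"
    unfolding kaehler_presented kaehler_d_presented
    by (simp only: linear_map_add[OF K.class_linear K.F.smult_closed[OF a g[OF b]] K.F.smult_closed[OF b g[OF a]]]
      linear_map_smult[OF K.class_linear a g[OF b]] linear_map_smult[OF K.class_linear b g[OF a]])
next
  fix c assume "c \<in> k"
  then have "fgen R c \<in> kaehler_relations R k" by (auto simp: kaehler_relations_def Let_def)
  then show "kaehler_d R k c = \<zero>\<^bsub>kaehler R k\<^esub>"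
    unfolding kaehler_presented kaehler_d_presented by (rule K.relation_class_zero)
qed

lemmas kaehler_d_simps = derivationD[OF kaehler_d_derivation]

lemma kaehler_linear_eq:
  assumes "plain_module R P" "linear_map R (kaehler R k) P f" "linear_map R (kaehler R k) P g"
    and "\<And>a. a \<in> carrier R \<Longrightarrow> f (kaehler_d R k a) = g (kaehler_d R k a)"
    and "x \<in> carrier (kaehler R k)"
  shows "f x = g x"
  using K.presented_linear_eq[OF assms(1), of f g x] assms(2-)
  unfolding kaehler_presented kaehler_d_presented by blast

text \<open>The universal property of Kaehler differentials: the three families of relations are
  killed by additivity, the Leibniz rule and vanishing on constants.\<close>

lemma derivation_lift:
  assumes P: "plain_module R P" and \<delta>: "derivation R k P \<delta>"
  obtains f where "linear_map R (kaehler R k) P f"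
    "\<And>a. a \<in> carrier R \<Longrightarrow> f (kaehler_d R k a) = \<delta> a"
proof
  let ?F = "free_module R (carrier R)"
  interpret P: plain_module R P by (rule P)
  note d = derivationD[OF \<delta>]
  have \<delta>_fun: "\<delta> \<in> carrier R \<rightarrow> carrier P" using d(1) by auto
  note lin = P.lin_ext_linear[OF \<delta>_fun] and fg = P.lin_ext_fgen[OF \<delta>_fun] and g = fgen_closed
  note minus = linear_map_minus[OF K.F.plain_module_axioms P lin]
  have rel: "lin_ext R P \<delta> \<phi> = \<zero>\<^bsub>P\<^esub>" if \<phi>: "\<phi> \<in> kaehler_relations R k" for \<phi>
    using \<phi>[unfolded kaehler_relations_def Let_def]
  proof (elim UnE CollectE exE conjE)
    fix a b assume \<phi>: "\<phi> = fgen R (a \<oplus> b) \<ominus>\<^bsub>?F\<^esub> (fgen R a \<oplus>\<^bsub>?F\<^esub> fgen R b)"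
      and a: "a \<in> carrier R" and b: "b \<in> carrier R"
    show ?thesis
      unfolding \<phi> minus[OF g[OF a_closed[OF a b]] K.F.a_closed[OF g[OF a] g[OF b]]]
        linear_map_add[OF lin g[OF a] g[OF b]] fg[OF a] fg[OF b] fg[OF a_closed[OF a b]] d(2)[OF a b]
      using d(1)[OF a] d(1)[OF b] by (simp add: P.minus_eq_zero_iff)
  next
    fix a b assume \<phi>: "\<phi> = fgen R (a \<otimes> b) \<ominus>\<^bsub>?F\<^esub> ((a \<odot>\<^bsub>?F\<^esub> fgen R b) \<oplus>\<^bsub>?F\<^esub> (b \<odot>\<^bsub>?F\<^esub> fgen R a))"
      and a: "a \<in> carrier R" and b: "b \<in> carrier R"
    note s = K.F.smult_closed[OF a g[OF b]] K.F.smult_closed[OF b g[OF a]]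
    show ?thesis
      unfolding \<phi> minus[OF g[OF m_closed[OF a b]] K.F.a_closed[OF s]]
        linear_map_add[OF lin s] linear_map_smult[OF lin a g[OF b]] linear_map_smult[OF lin b g[OF a]]
        fg[OF a] fg[OF b] fg[OF m_closed[OF a b]] d(3)[OF a b]
      using d(1)[OF a] d(1)[OF b] a b by (simp add: P.minus_eq_zero_iff)
  next
    fix c assume "\<phi> = fgen R c" "c \<in> k"
    then show ?thesis using fg d(4) constants_closed by auto
  qed
  show "linear_map R (kaehler R k) P (\<lambda>C. THE y. \<exists>\<phi>\<in>C. y = lin_ext R P \<delta> \<phi>)"
    unfolding kaehler_presented by (rule K.presented_lift_linear[OF P \<delta>_fun rel])
  show "(THE y. \<exists>\<phi>\<in>kaehler_d R k a. y = lin_ext R P \<delta> \<phi>) = \<delta> a" if "a \<in> carrier R" for a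
    unfolding kaehler_d_presented by (rule K.presented_lift_class[OF P \<delta>_fun rel that])
qed

subsection \<open>The exterior derivative\<close>

abbreviation "\<Lambda>2 \<equiv> ext_power R (kaehler R k) 2"
abbreviation "d \<equiv> kaehler_d R k"

text \<open>The coefficients are themselves differentiated, so this map on representatives is
  additive but not linear over \<open>R\<close>, and the lifting lemma for presentations does not
  apply to it.\<close>

definition pre_deriv :: "('a \<Rightarrow> 'a) \<Rightarrow> (('a \<Rightarrow> 'a) set list \<Rightarrow> 'a) set" where
  "pre_deriv \<phi> = finsum \<Lambda>2 (\<lambda>a. wedge R (kaehler R k) [d (\<phi> a), d a]) {a. \<phi> a \<noteq> \<zero>}"

lemma d_zero: "d \<zero> = \<zero>\<^bsub>kaehler R k\<^esub>"
  using kaehler_d_simps(2)[of \<zero> \<zero>] kaehler_d_simps(1)[of \<zero>] \<Omega>.add.r_cancel_one'[of "d \<zero>" "d \<zero>"]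
  by simp

text \<open>Terms off the support vanish because d 0 = 0, so any finite superset serves as index
  set.\<close>

lemma pre_deriv_eq:
  assumes "\<phi> \<in> carrier (free_module R (carrier R))"
    and "finite A" "A \<subseteq> carrier R" "{a. \<phi> a \<noteq> \<zero>} \<subseteq> A"
  shows "pre_deriv \<phi> = finsum \<Lambda>2 (\<lambda>a. wedge R (kaehler R k) [d (\<phi> a), d a]) A"
proof -
  interpret E: plain_module R \<Lambda>2 by (rule \<Omega>.ext_power_module)
  show ?thesis
    unfolding pre_deriv_def
    by (rule E.add.finprod_mono_neutral_cong_left)
      (use assms free_module_carrierD[OF assms(1)] in
        \<open>auto simp: subset_iff Pi_iff d_zero \<Omega>.wedge_zero_left \<Omega>.wedge_pair_simps(1) kaehler_d_simps(1)\<close>)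
qed

lemma pre_deriv_fgen:
  assumes "r \<in> carrier R" "a \<in> carrier R"
  shows "pre_deriv (r \<odot>\<^bsub>free_module R (carrier R)\<^esub> fgen R a) = wedge R (kaehler R k) [d r, d a]"
proof -
  interpret E: plain_module R \<Lambda>2 by (rule \<Omega>.ext_power_module)
  have "pre_deriv (r \<odot>\<^bsub>free_module R (carrier R)\<^esub> fgen R a) =
    finsum \<Lambda>2 (\<lambda>b. wedge R (kaehler R k) [d ((r \<odot>\<^bsub>free_module R (carrier R)\<^esub> fgen R a) b), d b]) {a}"
    using assms by (intro pre_deriv_eq K.F.smult_closed fgen_closed) (auto simp: fgen_def)
  then show ?thesis
    using assms by (simp add: fgen_def \<Omega>.wedge_pair_simps(1) kaehler_d_simps(1))
qed

lemma pre_deriv_closed: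
  assumes "\<phi> \<in> carrier (free_module R (carrier R))"
  shows "pre_deriv \<phi> \<in> carrier \<Lambda>2"
proof -
  interpret E: plain_module R \<Lambda>2 by (rule \<Omega>.ext_power_module)
  show ?thesis
    unfolding pre_deriv_def
  proof (intro E.finsum_closed funcsetI)
    fix a assume "a \<in> {a. \<phi> a \<noteq> \<zero>}"
    then have "a \<in> carrier R" using assms by (auto simp: free_module_carrier)
    then show "wedge R (kaehler R k) [d (\<phi> a), d a] \<in> carrier \<Lambda>2"
      using free_module_carrierD[OF assms] by (simp add: \<Omega>.wedge_pair_simps(1) kaehler_d_simps(1))
  qed
qed

lemma pre_deriv_add:
  assumes \<phi>: "\<phi> \<in> carrier (free_module R (carrier R))" and \<psi>: "\<psi> \<in> carrier (free_module R (carrier R))"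
  shows "pre_deriv (\<phi> \<oplus>\<^bsub>free_module R (carrier R)\<^esub> \<psi>) = pre_deriv \<phi> \<oplus>\<^bsub>\<Lambda>2\<^esub> pre_deriv \<psi>"
proof -
  interpret E: plain_module R \<Lambda>2 by (rule \<Omega>.ext_power_module)
  let ?A = "{a. \<phi> a \<noteq> \<zero>} \<union> {a. \<psi> a \<noteq> \<zero>}"
  have A: "finite ?A" "?A \<subseteq> carrier R" using \<phi> \<psi> by (auto simp: free_module_carrier)
  note cl = free_module_carrierD[OF \<phi>] free_module_carrierD[OF \<psi>] kaehler_d_simps(1)
  have "pre_deriv (\<phi> \<oplus>\<^bsub>free_module R (carrier R)\<^esub> \<psi>) =
      finsum \<Lambda>2 (\<lambda>a. wedge R (kaehler R k) [d (\<phi> a \<oplus> \<psi> a), d a]) ?A"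
    by (subst pre_deriv_eq[OF K.F.a_closed[OF \<phi> \<psi>] A]) auto
  also have "\<dots> = finsum \<Lambda>2 (\<lambda>a. wedge R (kaehler R k) [d (\<phi> a), d a] \<oplus>\<^bsub>\<Lambda>2\<^esub>
      wedge R (kaehler R k) [d (\<psi> a), d a]) ?A"
    using A(2) cl by (intro E.finsum_cong')
      (auto simp: kaehler_d_simps(2) \<Omega>.wedge_pair_simps(1,2) subset_iff)
  also have "\<dots> = finsum \<Lambda>2 (\<lambda>a. wedge R (kaehler R k) [d (\<phi> a), d a]) ?A \<oplus>\<^bsub>\<Lambda>2\<^esub>
      finsum \<Lambda>2 (\<lambda>a. wedge R (kaehler R k) [d (\<psi> a), d a]) ?A"
    using A(2) cl by (intro E.finsum_addf) (auto simp: \<Omega>.wedge_pair_simps(1) subset_iff)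
  also have "\<dots> = pre_deriv \<phi> \<oplus>\<^bsub>\<Lambda>2\<^esub> pre_deriv \<psi>"
    by (subst pre_deriv_eq[OF \<phi> A], blast, subst pre_deriv_eq[OF \<psi> A]) blast+
  finally show ?thesis .
qed

text \<open>The map on representatives is only additive, so the elements all of whose multiples it kills
  take the place of its kernel.\<close>
lemma pre_deriv_kernel:
  assumes "\<phi> \<in> submodule_gen R (free_module R (carrier R)) (kaehler_relations R k)"
  shows "pre_deriv \<phi> = \<zero>\<^bsub>\<Lambda>2\<^esub>"
proof -
  interpret E: plain_module R \<Lambda>2 by (rule \<Omega>.ext_power_module)
  let ?F = "free_module R (carrier R)"
  let ?N = "{\<phi> \<in> carrier ?F. \<forall>r\<in>carrier R. pre_deriv (r \<odot>\<^bsub>?F\<^esub> \<phi>) = \<zero>\<^bsub>\<Lambda>2\<^esub>}"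
  have pz: "pre_deriv \<zero>\<^bsub>?F\<^esub> = \<zero>\<^bsub>\<Lambda>2\<^esub>" by (simp add: pre_deriv_def)
  have N: "submodule ?N R ?F"
  proof (rule K.F.submoduleI)
    show "\<zero>\<^bsub>?F\<^esub> \<in> ?N" using pz K.F.smult_r_null by (simp del: free_module_simps)
    show "\<ominus>\<^bsub>?F\<^esub> \<phi> \<in> ?N" if "\<phi> \<in> ?N" for \<phi>
      using that by (simp add: K.F.smult_r_minus K.F.smult_l_minus[symmetric] del: free_module_simps)
    show "\<phi> \<oplus>\<^bsub>?F\<^esub> \<psi> \<in> ?N" if "\<phi> \<in> ?N" "\<psi> \<in> ?N" for \<phi> \<psi>
      using that by (simp add: K.F.smult_r_distr pre_deriv_add del: free_module_simps)
    show "r \<odot>\<^bsub>?F\<^esub> \<phi> \<in> ?N" if "r \<in> carrier R" "\<phi> \<in> ?N" for r \<phi>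
      using that by (simp add: K.F.smult_assoc1[symmetric] del: free_module_simps)
  qed auto
  \<comment> \<open>Differences are reached through additivity: replace the multiple of
    \<open>x\<close> by that of \<open>y\<close>, then use y + (-y) = 0.\<close>
  have minusN: "x \<ominus>\<^bsub>?F\<^esub> y \<in> ?N"
    if x: "x \<in> carrier ?F" and y: "y \<in> carrier ?F"
      and eq: "\<And>r. r \<in> carrier R \<Longrightarrow> pre_deriv (r \<odot>\<^bsub>?F\<^esub> x) = pre_deriv (r \<odot>\<^bsub>?F\<^esub> y)" for x y
  proof (intro CollectI conjI ballI)
    show "x \<ominus>\<^bsub>?F\<^esub> y \<in> carrier ?F" using x y by (rule K.F.minus_closed)
    fix r assume r: "r \<in> carrier R"
    let ?y = "r \<odot>\<^bsub>?F\<^esub> y"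
    have y': "?y \<in> carrier ?F" "\<ominus>\<^bsub>?F\<^esub> ?y \<in> carrier ?F"
      using r y by (simp_all del: free_module_simps)
    have "r \<odot>\<^bsub>?F\<^esub> (x \<ominus>\<^bsub>?F\<^esub> y) = (r \<odot>\<^bsub>?F\<^esub> x) \<oplus>\<^bsub>?F\<^esub> (\<ominus>\<^bsub>?F\<^esub> ?y)"
      using r x y by (simp add: a_minus_def K.F.smult_r_distr K.F.smult_r_minus del: free_module_simps)
    then have "pre_deriv (r \<odot>\<^bsub>?F\<^esub> (x \<ominus>\<^bsub>?F\<^esub> y)) = pre_deriv ?y \<oplus>\<^bsub>\<Lambda>2\<^esub> pre_deriv (\<ominus>\<^bsub>?F\<^esub> ?y)"
      using r x y' by (simp add: pre_deriv_add eq del: free_module_simps)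
    also have "\<dots> = pre_deriv (?y \<oplus>\<^bsub>?F\<^esub> (\<ominus>\<^bsub>?F\<^esub> ?y))" using y' by (rule pre_deriv_add[symmetric])
    also have "\<dots> = \<zero>\<^bsub>\<Lambda>2\<^esub>" using pz y' by (simp add: K.F.r_neg del: free_module_simps)
    finally show "pre_deriv (r \<odot>\<^bsub>?F\<^esub> (x \<ominus>\<^bsub>?F\<^esub> y)) = \<zero>\<^bsub>\<Lambda>2\<^esub>" .
  qed
  note g = fgen_closed and ws = \<Omega>.wedge_pair_simps kaehler_d_simps
  have "\<phi> \<in> ?N" if \<phi>: "\<phi> \<in> kaehler_relations R k" for \<phi>
    using \<phi>[unfolded kaehler_relations_def Let_def]
  proof (elim UnE CollectE exE conjE)
    fix a b assume \<phi>: "\<phi> = fgen R (a \<oplus> b) \<ominus>\<^bsub>?F\<^esub> (fgen R a \<oplus>\<^bsub>?F\<^esub> fgen R b)"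
      and a: "a \<in> carrier R" and b: "b \<in> carrier R"
    show "\<phi> \<in> ?N"
      unfolding \<phi>
    proof (rule minusN)
      fix r assume r: "r \<in> carrier R"
      show "pre_deriv (r \<odot>\<^bsub>?F\<^esub> fgen R (a \<oplus> b)) = pre_deriv (r \<odot>\<^bsub>?F\<^esub> (fgen R a \<oplus>\<^bsub>?F\<^esub> fgen R b))"
        using a b r by (simp add: K.F.smult_r_distr pre_deriv_add g pre_deriv_fgen ws del: free_module_simps)
    qed (intro g K.F.a_closed a_closed a b)+
  next
    fix a b assume \<phi>: "\<phi> = fgen R (a \<otimes> b) \<ominus>\<^bsub>?F\<^esub> ((a \<odot>\<^bsub>?F\<^esub> fgen R b) \<oplus>\<^bsub>?F\<^esub> (b \<odot>\<^bsub>?F\<^esub> fgen R a))"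
      and a: "a \<in> carrier R" and b: "b \<in> carrier R"
    show "\<phi> \<in> ?N"
      unfolding \<phi>
    proof (rule minusN)
      fix r assume r: "r \<in> carrier R"
      let ?w = "\<lambda>x y. wedge R (kaehler R k) [d x, d y]"
      have "pre_deriv (r \<odot>\<^bsub>?F\<^esub> ((a \<odot>\<^bsub>?F\<^esub> fgen R b) \<oplus>\<^bsub>?F\<^esub> (b \<odot>\<^bsub>?F\<^esub> fgen R a))) =
          ?w (r \<otimes> a) b \<oplus>\<^bsub>\<Lambda>2\<^esub> ?w (r \<otimes> b) a"
        using a b r by (simp add: K.F.smult_r_distr pre_deriv_add g K.F.smult_assoc1[symmetric]
            pre_deriv_fgen del: free_module_simps)
      \<comment> \<open>Besides dr \<and> d(ab), the sum d(ra) \<and> db + d(rb) \<and> da contains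
        r (da \<and> db + db \<and> da), which antisymmetry removes.\<close>
      also have "\<dots> = (a \<odot>\<^bsub>\<Lambda>2\<^esub> ?w r b \<oplus>\<^bsub>\<Lambda>2\<^esub> b \<odot>\<^bsub>\<Lambda>2\<^esub> ?w r a) \<oplus>\<^bsub>\<Lambda>2\<^esub> r \<odot>\<^bsub>\<Lambda>2\<^esub> (?w a b \<oplus>\<^bsub>\<Lambda>2\<^esub> ?w b a)"
        using a b r by (simp add: ws E.a_ac E.smult_r_distr)
      also have "\<dots> = a \<odot>\<^bsub>\<Lambda>2\<^esub> ?w r b \<oplus>\<^bsub>\<Lambda>2\<^esub> b \<odot>\<^bsub>\<Lambda>2\<^esub> ?w r a"
        using a b r by (simp add: \<Omega>.wedge_pair_swap ws)
      also have "\<dots> = pre_deriv (r \<odot>\<^bsub>?F\<^esub> fgen R (a \<otimes> b))"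
        using a b r by (simp add: pre_deriv_fgen ws del: free_module_simps)
      finally show "pre_deriv (r \<odot>\<^bsub>?F\<^esub> fgen R (a \<otimes> b)) =
          pre_deriv (r \<odot>\<^bsub>?F\<^esub> ((a \<odot>\<^bsub>?F\<^esub> fgen R b) \<oplus>\<^bsub>?F\<^esub> (b \<odot>\<^bsub>?F\<^esub> fgen R a)))" by simp
    qed (intro g K.F.a_closed K.F.smult_closed m_closed a b)+
  next
    fix c assume \<phi>: "\<phi> = fgen R c" and c: "c \<in> k"
    have c': "c \<in> carrier R" using c constants_closed by auto
    have "wedge R (kaehler R k) [d r, d c] = \<zero>\<^bsub>\<Lambda>2\<^esub>" if "r \<in> carrier R" for r
      using \<Omega>.wedge_pair_swap[of "d r" "d c"] \<Omega>.wedge_zero_left[of "d r"] c c' that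
      by (simp add: kaehler_d_simps(1) kaehler_d_simps(4)[OF c] \<Omega>.wedge_pair_simps(1))
    then show "\<phi> \<in> ?N"
      using c' by (simp add: \<phi> g pre_deriv_fgen del: free_module_simps)
  qed
  then have "submodule_gen R ?F (kaehler_relations R k) \<subseteq> ?N"
    by (intro submodule_gen_minimal[OF N] subsetI)
  with assms have "\<phi> \<in> ?N" by (rule subsetD[rotated])
  then have \<phi>: "\<phi> \<in> carrier ?F" and eq: "\<forall>r\<in>carrier R. pre_deriv (r \<odot>\<^bsub>?F\<^esub> \<phi>) = \<zero>\<^bsub>\<Lambda>2\<^esub>"
    by (simp_all del: free_module_simps)
  \<comment> \<open>The multiple by 1 is the element itself.\<close>
  show ?thesis using bspec[OF eq one_closed] by (simp only: K.F.smult_one[OF \<phi>])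
qed

text \<open>Well-definedness of the exterior derivative: two representatives differ by an element of
  the kernel, and additivity compares their values.\<close>

lemma ext_deriv_closed:
  assumes "\<eta> \<in> carrier (kaehler R k)"
  shows "ext_deriv R k \<eta> \<in> carrier \<Lambda>2"
proof -
  let ?F = "free_module R (carrier R)"
  let ?K = "submodule_gen R ?F (kaehler_relations R k)"
  interpret E: plain_module R \<Lambda>2 by (rule \<Omega>.ext_power_module)
  obtain \<phi> where \<phi>: "\<phi> \<in> carrier ?F" "\<eta> = ?K +>\<^bsub>?F\<^esub> \<phi>"
    using assms unfolding kaehler_presented K.presented_carrier presented_class_def by auto
  have "ext_deriv R k \<eta> = (THE y. \<exists>\<psi>\<in>?K +>\<^bsub>?F\<^esub> \<phi>. y = pre_deriv \<psi>)"
    by (simp only: ext_deriv_def \<phi>(2) pre_deriv_def)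
  also have "\<dots> = pre_deriv \<phi>"
  proof (rule K.F.quotient_the_eq[OF K.kernel_submodule _ \<phi>(1)])
    fix x y assume xy: "x \<in> carrier ?F" "y \<in> carrier ?F" "x \<ominus>\<^bsub>?F\<^esub> y \<in> ?K"
    have "x = (x \<ominus>\<^bsub>?F\<^esub> y) \<oplus>\<^bsub>?F\<^esub> y"
      using xy(1,2) by (simp add: a_minus_def K.F.a_assoc K.F.l_neg del: free_module_simps)
    then have "pre_deriv x = pre_deriv (x \<ominus>\<^bsub>?F\<^esub> y) \<oplus>\<^bsub>\<Lambda>2\<^esub> pre_deriv y"
      using pre_deriv_add[OF K.F.minus_closed[OF xy(1,2)] xy(2)] by simp
    then show "pre_deriv x = pre_deriv y"
      using pre_deriv_kernel[OF xy(3)] pre_deriv_closed[OF xy(2)] by simp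
  qed
  finally show ?thesis using pre_deriv_closed[OF \<phi>(1)] by simp
qed

end

section \<open>The tensor relations as rules for pure tensors\<close>

section \<open>Tensor products\<close>

locale tensor = cring R + M: plain_module R M + N: plain_module R N
  for R (structure) and M :: "('a, 'm) module" and N :: "('a, 'n) module"
begin

abbreviation "T \<equiv> tensor_module R M N"
abbreviation "pt \<equiv> pure_tensor R M N"

lemma tensor_presented:
  "T = presented R (carrier M \<times> carrier N) (tensor_relations R M N)"
  by (simp add: tensor_module_def presented_def tensor_kernel_def)

lemma pure_tensor_presented:
  "pt m n = presented_class R (carrier M \<times> carrier N) (tensor_relations R M N) (fgen R (m, n))"
  by (simp add: pure_tensor_def presented_class_def tensor_kernel_def)

lemma tensor_presentation: "presentation R (carrier M \<times> carrier N) (tensor_relations R M N)"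
proof
  interpret F: plain_module R "free_module R (carrier M \<times> carrier N)" by (rule free_module_module)
  note c = F.minus_closed F.a_closed F.smult_closed fgen_closed SigmaI M.M.a_closed N.M.a_closed
    M.smult_closed N.smult_closed
  show "tensor_relations R M N \<subseteq> carrier (free_module R (carrier M \<times> carrier N))"
    unfolding tensor_relations_def Let_def
    by (intro Un_least subsetI; elim CollectE exE conjE; hypsubst; intro c; assumption)
qed

sublocale P: presentation R "carrier M \<times> carrier N" "tensor_relations R M N"
  by (rule tensor_presentation)

lemma tensor_is_module: "plain_module R T"
  unfolding tensor_presented by (rule P.presented_module)

lemma pure_tensor_closed: "m \<in> carrier M \<Longrightarrow> n \<in> carrier N \<Longrightarrow> pt m n \<in> carrier T"
  unfolding tensor_presented pure_tensor_presented by (rule P.class_fgen_closed) simp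

text \<open>Allows a 2-form to be expanded under the tensor sign.\<close>

lemma pure_tensor_linear_left:
  assumes n: "n \<in> carrier N"
  shows "linear_map R M T (\<lambda>m. pt m n)"
proof (rule linear_mapI)
  let ?F = "free_module R (carrier M \<times> carrier N)"
  let ?c = "presented_class R (carrier M \<times> carrier N) (tensor_relations R M N)"
  show "pt m n \<in> carrier T" if "m \<in> carrier M" for m by (rule pure_tensor_closed[OF that n])
  have g: "fgen R (m, n) \<in> carrier ?F" if "m \<in> carrier M" for m
    using that n by (intro fgen_closed SigmaI)
  fix m assume m: "m \<in> carrier M"
  show "pt (m \<oplus>\<^bsub>M\<^esub> m') n = pt m n \<oplus>\<^bsub>T\<^esub> pt m' n" if m': "m' \<in> carrier M" for m'
  proof -
    have "?c (fgen R (m \<oplus>\<^bsub>M\<^esub> m', n)) = ?c (fgen R (m, n) \<oplus>\<^bsub>?F\<^esub> fgen R (m', n))"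
    proof (rule P.relation_class_eq)
      show "fgen R (m \<oplus>\<^bsub>M\<^esub> m', n) \<ominus>\<^bsub>?F\<^esub> (fgen R (m, n) \<oplus>\<^bsub>?F\<^esub> fgen R (m', n)) \<in> tensor_relations R M N"
        unfolding tensor_relations_def Let_def using m m' n by (intro UnI1 CollectI) metis
    qed (intro g P.F.a_closed M.M.a_closed m m')+
    then show ?thesis
      unfolding tensor_presented pure_tensor_presented
      by (simp only: linear_map_add[OF P.class_linear g[OF m] g[OF m']])
  qed
  show "pt (r \<odot>\<^bsub>M\<^esub> m) n = r \<odot>\<^bsub>T\<^esub> pt m n" if r: "r \<in> carrier R" for r
  proof -
    have "?c (fgen R (r \<odot>\<^bsub>M\<^esub> m, n)) = ?c (r \<odot>\<^bsub>?F\<^esub> fgen R (m, n))"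
    proof (rule P.relation_class_eq)
      show "fgen R (r \<odot>\<^bsub>M\<^esub> m, n) \<ominus>\<^bsub>?F\<^esub> (r \<odot>\<^bsub>?F\<^esub> fgen R (m, n)) \<in> tensor_relations R M N"
        unfolding tensor_relations_def Let_def using m r n by (intro UnI1[OF UnI2] CollectI) metis
    qed (intro g P.F.smult_closed M.smult_closed m r)+
    then show ?thesis
      unfolding tensor_presented pure_tensor_presented
      by (simp only: linear_map_smult[OF P.class_linear r g[OF m]])
  qed
qed

text \<open>Moves coefficients from the singular ideal across the tensor sign, onto the factor that
  they annihilate.\<close>

lemma pure_tensor_smult_right:
  assumes m: "m \<in> carrier M" and n: "n \<in> carrier N" and r: "r \<in> carrier R"
  shows "pt m (r \<odot>\<^bsub>N\<^esub> n) = r \<odot>\<^bsub>T\<^esub> pt m n"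
proof -
  let ?F = "free_module R (carrier M \<times> carrier N)"
  let ?c = "presented_class R (carrier M \<times> carrier N) (tensor_relations R M N)"
  have g: "fgen R (m, n) \<in> carrier ?F" if "n \<in> carrier N" for n
    using that m by (intro fgen_closed SigmaI)
  have "?c (fgen R (m, r \<odot>\<^bsub>N\<^esub> n)) = ?c (r \<odot>\<^bsub>?F\<^esub> fgen R (m, n))"
  proof (rule P.relation_class_eq)
    show "fgen R (m, r \<odot>\<^bsub>N\<^esub> n) \<ominus>\<^bsub>?F\<^esub> (r \<odot>\<^bsub>?F\<^esub> fgen R (m, n)) \<in> tensor_relations R M N"
      unfolding tensor_relations_def Let_def using m r n by (intro UnI2 CollectI) metis
  qed (intro g P.F.smult_closed N.smult_closed n r)+
  then show ?thesis
    unfolding tensor_presented pure_tensor_presented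
    by (simp only: linear_map_smult[OF P.class_linear r g[OF n]])
qed

text \<open>Zero on the right is the scalar 0 times itself, so
  \<open>pure_tensor_smult_right\<close> applies.\<close>

lemma pure_tensor_zero_right:
  assumes m: "m \<in> carrier M"
  shows "pt m \<zero>\<^bsub>N\<^esub> = \<zero>\<^bsub>T\<^esub>"
proof -
  interpret T: plain_module R T by (rule tensor_is_module)
  show ?thesis
    using pure_tensor_smult_right[OF m N.M.zero_closed zero_closed] pure_tensor_closed[OF m N.M.zero_closed]
    by simp
qed

end

section \<open>Local rings of a space with functions, and evaluation at a point\<close>

section \<open>Stalks of a sheaf of functions\<close>

text \<open>A germ is the set of all pairs that agree with a given one near \<open>x\<close>, so an
  equality of sets is at stake; one inclusion is proved for arbitrary data and used in both
  directions.\<close>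

lemma germ_eqI:
  assumes "openin (zar X) W" "x \<in> W" "W \<subseteq> U \<inter> V" "\<And>y. y \<in> W \<Longrightarrow> f y = g y"
  shows "germ X x U f = germ X x V g"
proof -
  have "(T, h) \<in> germ X x V g"
    if W: "W \<subseteq> U \<inter> V" "\<And>y. y \<in> W \<Longrightarrow> f y = g y" and Th: "(T, h) \<in> germ X x U f" for U V f g T h
  proof -
    from Th obtain W' where T: "openin (zar X) T" "x \<in> T" "h \<in> reg X T"
      and W': "openin (zar X) W'" "x \<in> W'" "W' \<subseteq> U \<inter> T" "\<And>y. y \<in> W' \<Longrightarrow> f y = h y"
      unfolding germ_def by auto
    have "openin (zar X) (W \<inter> W')" "x \<in> W \<inter> W'" "W \<inter> W' \<subseteq> V \<inter> T" "\<forall>y\<in>W \<inter> W'. g y = h y"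
      using assms(1,2) W W' by (auto intro: openin_Int) (metis W'(4))
    with T show ?thesis unfolding germ_def by blast
  qed
  from this[of U V f g] this[of V U g f] assms(3,4) show ?thesis by auto
qed

lemma openin_subset_topspace: "openin T U \<Longrightarrow> x \<in> U \<Longrightarrow> x \<in> topspace T"
  using openin_subset by blast

locale sheaf_of_functions =
  fixes X :: "'a fspace"
  assumes function_sheaf: "function_sheaf X"
begin

abbreviation "opn \<equiv> openin (zar X)"

lemma
  assumes U: "opn U"
  shows reg_const: "(\<lambda>x\<in>U. c) \<in> reg X U"
    and reg_add: "f \<in> reg X U \<Longrightarrow> g \<in> reg X U \<Longrightarrow> (\<lambda>x\<in>U. f x + g x) \<in> reg X U"
    and reg_mult: "f \<in> reg X U \<Longrightarrow> g \<in> reg X U \<Longrightarrow> (\<lambda>x\<in>U. f x * g x) \<in> reg X U"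
    and reg_restrict: "f \<in> reg X U \<Longrightarrow> opn V \<Longrightarrow> V \<subseteq> U \<Longrightarrow> restrict f V \<in> reg X V"
  using function_sheaf U unfolding function_sheaf_def by auto

lemma reg_glue:
  assumes "opn U" "f \<in> extensional U"
    and "\<And>x. x \<in> U \<Longrightarrow> \<exists>V. opn V \<and> x \<in> V \<and> V \<subseteq> U \<and> restrict f V \<in> reg X V"
  shows "f \<in> reg X U"
proof -
  have "\<forall>f\<in>extensional U. (\<forall>x\<in>U. \<exists>V. opn V \<and> x \<in> V \<and> V \<subseteq> U \<and> restrict f V \<in> reg X V)
      \<longrightarrow> f \<in> reg X U"
    using function_sheaf assms(1) unfolding function_sheaf_def by simp
  then show ?thesis using assms(2,3) by simp
qed

lemma germ_mem: "opn U \<Longrightarrow> x \<in> U \<Longrightarrow> f \<in> reg X U \<Longrightarrow> (U, f) \<in> germ X x U f"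
  unfolding germ_def by blast

lemma germ_eqD:
  assumes "germ X x U f = germ X x V g" "opn U" "x \<in> U" "f \<in> reg X U"
  obtains W where "opn W" "x \<in> W" "W \<subseteq> U \<inter> V" "\<And>y. y \<in> W \<Longrightarrow> f y = g y"
proof -
  have "(U, f) \<in> germ X x V g" using germ_mem[OF assms(2-4)] assms(1) by simp
  then obtain W where "opn W" "x \<in> W" "W \<subseteq> V \<inter> U" "\<forall>y\<in>W. g y = f y" unfolding germ_def by auto
  then show ?thesis using that[of W] by auto
qed

lemma germ_restrict: "opn V \<Longrightarrow> x \<in> V \<Longrightarrow> V \<subseteq> U \<Longrightarrow> germ X x V (restrict f V) = germ X x U f"
  by (rule germ_eqI[of X V]) auto

lemma germ_cong: "opn U \<Longrightarrow> x \<in> U \<Longrightarrow> (\<And>y. y \<in> U \<Longrightarrow> f y = g y) \<Longrightarrow> germ X x U f = germ X x U g"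
  by (rule germ_eqI[of X U]) auto

lemma germ_closed: "opn U \<Longrightarrow> x \<in> U \<Longrightarrow> f \<in> reg X U \<Longrightarrow> germ X x U f \<in> carrier (stalk X x)"
  by (auto simp: stalk_def)

lemma stalkE:
  assumes "a \<in> carrier (stalk X x)"
  obtains U f where "opn U" "x \<in> U" "f \<in> reg X U" "a = germ X x U f"
  using assms by (auto simp: stalk_def)

text \<open>Stalk operations are unions over representatives, and every member of the union is the
  same germ. A general \<open>F\<close> covers sum and product at once.\<close>

lemma germ_op:
  assumes "opn U" "x \<in> U" "f \<in> reg X U" "g \<in> reg X U"
  shows "(\<Union>(V, h)\<in>germ X x U f. \<Union>(W, k)\<in>germ X x U g. germ X x (V \<inter> W) (\<lambda>y\<in>V \<inter> W. F (h y) (k y)))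
    = germ X x U (\<lambda>y\<in>U. F (f y) (g y))"
proof -
  have "germ X x (V \<inter> W) (\<lambda>y\<in>V \<inter> W. F (h y) (k y)) = germ X x U (\<lambda>y\<in>U. F (f y) (g y))"
    if Vh: "(V, h) \<in> germ X x U f" and Wk: "(W, k) \<in> germ X x U g" for V h W k
  proof -
    obtain A where A: "opn A" "x \<in> A" "A \<subseteq> U \<inter> V" "\<And>y. y \<in> A \<Longrightarrow> f y = h y"
      using Vh unfolding germ_def by auto
    obtain B where B: "opn B" "x \<in> B" "B \<subseteq> U \<inter> W" "\<And>y. y \<in> B \<Longrightarrow> g y = k y"
      using Wk unfolding germ_def by auto
    show ?thesis
    proof (rule germ_eqI[of X "A \<inter> B"])
      fix y assume "y \<in> A \<inter> B"
      then show "(\<lambda>y\<in>V \<inter> W. F (h y) (k y)) y = (\<lambda>y\<in>U. F (f y) (g y)) y"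
        using A(3,4) B(3,4) by auto
    qed (use A B in auto)
  qed
  moreover have "(U, f) \<in> germ X x U f" "(U, g) \<in> germ X x U g" using assms germ_mem by auto
  ultimately show ?thesis by fast
qed

lemma
  assumes "opn U" "x \<in> U" "f \<in> reg X U" "g \<in> reg X U"
  shows germ_add: "germ X x U f \<oplus>\<^bsub>stalk X x\<^esub> germ X x U g = germ X x U (\<lambda>y\<in>U. f y + g y)"
    and germ_mult: "germ X x U f \<otimes>\<^bsub>stalk X x\<^esub> germ X x U g = germ X x U (\<lambda>y\<in>U. f y * g y)"
  using germ_op[OF assms] by (simp_all add: stalk_def)

lemma const_germ_eq:
  "opn U \<Longrightarrow> x \<in> U \<Longrightarrow> const_germ X x c = germ X x U (\<lambda>y\<in>U. c)"
  unfolding const_germ_def by (rule germ_eqI[of X U]) (use openin_subset in auto)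

text \<open>Brings two germs to one domain inside a prescribed neighbourhood, so that algebra in the
  stalk becomes algebra of functions.\<close>

lemma stalkE2:
  assumes "a \<in> carrier (stalk X x)" "b \<in> carrier (stalk X x)" "opn V" "x \<in> V"
  obtains U f g where "opn U" "x \<in> U" "U \<subseteq> V" "f \<in> reg X U" "g \<in> reg X U"
    "a = germ X x U f" "b = germ X x U g"
proof -
  obtain A f where A: "opn A" "x \<in> A" "f \<in> reg X A" "a = germ X x A f" using assms(1) by (rule stalkE)
  obtain B g where B: "opn B" "x \<in> B" "g \<in> reg X B" "b = germ X x B g" using assms(2) by (rule stalkE)
  let ?U = "A \<inter> B \<inter> V"
  have U: "opn ?U" "x \<in> ?U" "?U \<subseteq> A" "?U \<subseteq> B" "?U \<subseteq> V" using A B assms by auto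
  show ?thesis
    by (rule that[OF U(1,2,5) reg_restrict[OF A(1,3) U(1,3)] reg_restrict[OF B(1,3) U(1,4)]
        trans[OF A(4) germ_restrict[OF U(1-3), symmetric]]
        trans[OF B(4) germ_restrict[OF U(1,2,4), symmetric]]])
qed

lemma stalk_zero: "opn U \<Longrightarrow> x \<in> U \<Longrightarrow> \<zero>\<^bsub>stalk X x\<^esub> = germ X x U (\<lambda>y\<in>U. 0)"
  and stalk_one: "opn U \<Longrightarrow> x \<in> U \<Longrightarrow> \<one>\<^bsub>stalk X x\<^esub> = germ X x U (\<lambda>y\<in>U. 1)"
  using const_germ_eq by (simp_all add: stalk_def)

text \<open>With all germs involved on a common open set, each ring law is the pointwise law of
  complex numbers.\<close>

lemma stalk_cring:
  assumes "x \<in> topspace (zar X)"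
  shows "cring (stalk X x)"
proof -
  let ?S = "stalk X x"
  have top: "opn (topspace (zar X))" by simp
  have rep3: thesis
    if abc: "a \<in> carrier ?S" "b \<in> carrier ?S" "c \<in> carrier ?S"
      and *: "\<And>U f g h. opn U \<Longrightarrow> x \<in> U \<Longrightarrow> f \<in> reg X U \<Longrightarrow> g \<in> reg X U \<Longrightarrow> h \<in> reg X U \<Longrightarrow>
        a = germ X x U f \<Longrightarrow> b = germ X x U g \<Longrightarrow> c = germ X x U h \<Longrightarrow> thesis" for a b c thesis
  proof -
    obtain V f g where V: "opn V" "x \<in> V" "f \<in> reg X V" "g \<in> reg X V" "a = germ X x V f" "b = germ X x V g"
      using stalkE2[OF abc(1,2) top assms] by metis
    obtain U h where U: "opn U" "x \<in> U" "U \<subseteq> V" "h \<in> reg X U" "c = germ X x U h"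
      using stalkE2[OF abc(3,3) V(1,2)] by metis
    show thesis
      by (rule *[OF U(1,2) reg_restrict[OF V(1,3) U(1,3)] reg_restrict[OF V(1,4) U(1,3)] U(4)])
        (simp_all only: germ_restrict[OF U(1-3)] V(5,6) U(5))
  qed
  note gs = germ_add germ_mult reg_add reg_mult germ_closed
  have zero: "\<zero>\<^bsub>?S\<^esub> \<in> carrier ?S" and one: "\<one>\<^bsub>?S\<^esub> \<in> carrier ?S"
    using stalk_zero[OF top assms] stalk_one[OF top assms] germ_closed[OF top assms reg_const[OF top]]
    by simp_all
  show ?thesis
  proof (rule cringI)
    show "abelian_group ?S"
    proof (rule abelian_groupI)
      fix a b c assume abc: "a \<in> carrier ?S" "b \<in> carrier ?S" "c \<in> carrier ?S"
      from abc show "a \<oplus>\<^bsub>?S\<^esub> b \<in> carrier ?S"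
        by (rule rep3) (simp add: gs)
      from abc show "a \<oplus>\<^bsub>?S\<^esub> b \<oplus>\<^bsub>?S\<^esub> c = a \<oplus>\<^bsub>?S\<^esub> (b \<oplus>\<^bsub>?S\<^esub> c)"
        by (rule rep3) (simp add: gs, rule germ_cong, simp_all add: add.assoc)
      from abc show "a \<oplus>\<^bsub>?S\<^esub> b = b \<oplus>\<^bsub>?S\<^esub> a"
        by (rule rep3) (simp add: gs add.commute)
    next
      fix a assume a: "a \<in> carrier ?S"
      from a a a show "\<zero>\<^bsub>?S\<^esub> \<oplus>\<^bsub>?S\<^esub> a = a"
        by (rule rep3) (simp add: gs reg_const stalk_zero, rule germ_cong, simp_all)
      from a a a show "\<exists>b\<in>carrier ?S. b \<oplus>\<^bsub>?S\<^esub> a = \<zero>\<^bsub>?S\<^esub>"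
      proof (rule rep3)
        fix U f assume U: "opn U" "x \<in> U" "f \<in> reg X U" "a = germ X x U f"
        \<comment> \<open>A sheaf of functions provides constants, sums and products; the additive
          inverse is the product with the constant -1.\<close>
        have m: "(\<lambda>y\<in>U. (\<lambda>y\<in>U. -1) y * f y) \<in> reg X U"
          using U reg_mult[OF U(1) reg_const[OF U(1)] U(3)] by simp
        have "germ X x U (\<lambda>y\<in>U. (\<lambda>y\<in>U. -1) y * f y) \<oplus>\<^bsub>?S\<^esub> a = \<zero>\<^bsub>?S\<^esub>"
          using U m by (simp only: germ_add stalk_zero) (rule germ_cong, auto)
        then show ?thesis using germ_closed[OF U(1,2) m] by blast
      qed
    qed (rule zero)
    show "comm_monoid ?S"
    proof (rule comm_monoidI)
      fix a b c assume abc: "a \<in> carrier ?S" "b \<in> carrier ?S" "c \<in> carrier ?S"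
      from abc show "a \<otimes>\<^bsub>?S\<^esub> b \<in> carrier ?S"
        by (rule rep3) (simp add: gs)
      from abc show "a \<otimes>\<^bsub>?S\<^esub> b \<otimes>\<^bsub>?S\<^esub> c = a \<otimes>\<^bsub>?S\<^esub> (b \<otimes>\<^bsub>?S\<^esub> c)"
        by (rule rep3) (simp add: gs, rule germ_cong, simp_all)
      from abc show "a \<otimes>\<^bsub>?S\<^esub> b = b \<otimes>\<^bsub>?S\<^esub> a"
        by (rule rep3) (simp add: gs mult.commute)
    next
      fix a assume a: "a \<in> carrier ?S"
      from a a a show "\<one>\<^bsub>?S\<^esub> \<otimes>\<^bsub>?S\<^esub> a = a"
        by (rule rep3) (simp add: gs reg_const stalk_one, rule germ_cong, simp_all)
    qed (rule one)
    fix a b c assume abc: "a \<in> carrier ?S" "b \<in> carrier ?S" "c \<in> carrier ?S"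
    from abc show "(a \<oplus>\<^bsub>?S\<^esub> b) \<otimes>\<^bsub>?S\<^esub> c = a \<otimes>\<^bsub>?S\<^esub> c \<oplus>\<^bsub>?S\<^esub> b \<otimes>\<^bsub>?S\<^esub> c"
      by (rule rep3) (simp add: gs, rule germ_cong, simp_all add: distrib_right)
  qed
qed

lemma stalk_differentials:
  assumes "x \<in> topspace (zar X)"
  shows "differentials (stalk X x) (range (const_germ X x))"
proof (intro differentials.intro differentials_axioms.intro stalk_cring[OF assms])
  show "range (const_germ X x) \<subseteq> carrier (stalk X x)"
    using germ_closed[OF openin_topspace assms reg_const[OF openin_topspace]]
    by (auto simp: const_germ_def)
qed

text \<open>Evaluation at \<open>x\<close>, well defined since representatives agree on a
  neighbourhood containing \<open>x\<close>.\<close>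

definition germ_value :: "'a \<Rightarrow> 'a germ \<Rightarrow> complex" where
  "germ_value x a = (THE c. \<exists>(U, f)\<in>a. c = f x)"

lemma germ_value_germ:
  assumes "opn U" "x \<in> U" "f \<in> reg X U"
  shows "germ_value x (germ X x U f) = f x"
  unfolding germ_value_def
proof (rule the_equality)
  show "\<exists>(V, g)\<in>germ X x U f. f x = g x" using germ_mem[OF assms] by auto
  show "c = f x" if "\<exists>(V, g)\<in>germ X x U f. c = g x" for c
    using that unfolding germ_def by auto
qed

text \<open>The residue field at \<open>x\<close>, on which germs act through their value. Linear
  maps to it from the stalk of differentials are the tangent vectors at \<open>x\<close>.\<close>

definition residue_module :: "'a \<Rightarrow> ('a germ, complex) module" where
  "residue_module x = \<lparr>carrier = UNIV, mult = undefined, one = undefined, zero = 0, add = (+),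
     smult = (\<lambda>a c. germ_value x a * c)\<rparr>"

lemma residue_module_simps [simp]:
  "carrier (residue_module x) = UNIV"
  "\<zero>\<^bsub>residue_module x\<^esub> = 0"
  "c \<oplus>\<^bsub>residue_module x\<^esub> e = c + e"
  "a \<odot>\<^bsub>residue_module x\<^esub> c = germ_value x a * c"
  by (simp_all add: residue_module_def)

lemma germ_value_simps:
  assumes x: "x \<in> topspace (zar X)" and "a \<in> carrier (stalk X x)" "b \<in> carrier (stalk X x)"
  shows "germ_value x (a \<oplus>\<^bsub>stalk X x\<^esub> b) = germ_value x a + germ_value x b"
    and "germ_value x (a \<otimes>\<^bsub>stalk X x\<^esub> b) = germ_value x a * germ_value x b"
proof -
  obtain U f g where "opn U" "x \<in> U" "f \<in> reg X U" "g \<in> reg X U" "a = germ X x U f" "b = germ X x U g"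
    using stalkE2[OF assms(2,3) openin_topspace x] by metis
  then show "germ_value x (a \<oplus>\<^bsub>stalk X x\<^esub> b) = germ_value x a + germ_value x b"
    "germ_value x (a \<otimes>\<^bsub>stalk X x\<^esub> b) = germ_value x a * germ_value x b"
    by (simp_all add: germ_add germ_mult germ_value_germ reg_add reg_mult)
qed

lemma residue_module_module:
  assumes x: "x \<in> topspace (zar X)"
  shows "plain_module (stalk X x) (residue_module x)"
proof (intro plain_module.intro moduleI stalk_cring[OF x])
  show "abelian_group (residue_module x)"
    by (rule abelian_groupI) (auto simp: add.commute intro: exI[of _ "- z" for z] add.left_inverse)
  show "\<one>\<^bsub>stalk X x\<^esub> \<odot>\<^bsub>residue_module x\<^esub> c = c" for c
    using stalk_one[OF openin_topspace x] germ_value_germ[OF openin_topspace x reg_const[OF openin_topspace]] x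
    by simp
qed (auto simp: germ_value_simps[OF x] distrib_left distrib_right)

end

lemma (in cring) regular_module_module: "plain_module R (regular_module R)"
proof (intro plain_module.intro moduleI is_cring)
  show "abelian_group (regular_module R)"
    by (rule abelian_groupI) (auto simp: regular_module_def a_ac intro: bexI[of _ "\<ominus> x" for x] l_neg)
qed (auto simp: regular_module_def l_distr r_distr m_assoc)

lemma regular_module_simps [simp]:
  "carrier (regular_module R) = carrier R"
  "\<zero>\<^bsub>regular_module R\<^esub> = \<zero>\<^bsub>R\<^esub>"
  "a \<oplus>\<^bsub>regular_module R\<^esub> b = a \<oplus>\<^bsub>R\<^esub> b"
  "a \<odot>\<^bsub>regular_module R\<^esub> b = a \<otimes>\<^bsub>R\<^esub> b"
  by (simp_all add: regular_module_def)

section \<open>Local shape of 1-forms, and vector fields on stalks and at points\<close>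

section \<open>Differential forms and vector fields\<close>

context sheaf_of_functions
begin

definition d_section :: "'a set \<Rightarrow> ('a \<Rightarrow> complex) \<Rightarrow> 'a \<Rightarrow> 'a cotangent" where
  "d_section U g = (\<lambda>y\<in>U. d_stalk X y (germ X y U g))"

text \<open>The local normal form of a 1-form, packaged as a section so that sheaf morphisms can be
  applied to it.\<close>

definition form_sum ::
    "'a set \<Rightarrow> (nat \<Rightarrow> 'a \<Rightarrow> complex) \<Rightarrow> (nat \<Rightarrow> 'a \<Rightarrow> complex) \<Rightarrow> nat \<Rightarrow> 'a \<Rightarrow> 'a cotangent" where
  "form_sum U f g n = (\<lambda>y\<in>U. finsum (Omega_stalk X y)
     (\<lambda>i. germ X y U (f i) \<odot>\<^bsub>Omega_stalk X y\<^esub> d_stalk X y (germ X y U (g i))) {..<n})"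

lemma Omega_sectionsE:
  assumes "s \<in> Omega_sections X U" "x \<in> U"
  obtains V n f g where "opn V" "x \<in> V" "V \<subseteq> U" "\<And>i. i < n \<Longrightarrow> f i \<in> reg X V" "\<And>i. i < n \<Longrightarrow> g i \<in> reg X V"
    "restrict s V = form_sum V f g n"
proof -
  obtain V f g and n :: nat where V: "opn V" "x \<in> V" "V \<subseteq> U" "\<forall>i<n. f i \<in> reg X V \<and> g i \<in> reg X V"
    "\<forall>y\<in>V. s y = finsum (Omega_stalk X y)
           (\<lambda>i. germ X y V (f i) \<odot>\<^bsub>Omega_stalk X y\<^esub> d_stalk X y (germ X y V (g i))) {..<n}"
    using assms unfolding Omega_sections_def by blast
  show ?thesis
    by (rule that[of V n f g]) (use V in \<open>auto simp: form_sum_def intro!: restrict_ext\<close>)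
qed

lemma form_sum_section:
  assumes "opn U" "\<And>i. i < n \<Longrightarrow> f i \<in> reg X U" "\<And>i. i < n \<Longrightarrow> g i \<in> reg X U"
  shows "form_sum U f g n \<in> Omega_sections X U"
  unfolding Omega_sections_def
proof (intro CollectI conjI ballI)
  show "form_sum U f g n \<in> extensional U" by (simp add: form_sum_def)
  fix x assume "x \<in> U"
  show "\<exists>V. opn V \<and> x \<in> V \<and> V \<subseteq> U \<and> (\<exists>(m :: nat) f' g'. (\<forall>i<m. f' i \<in> reg X V \<and> g' i \<in> reg X V) \<and>
      (\<forall>y\<in>V. form_sum U f g n y = finsum (Omega_stalk X y)
        (\<lambda>i. germ X y V (f' i) \<odot>\<^bsub>Omega_stalk X y\<^esub> d_stalk X y (germ X y V (g' i))) {..<m}))"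
  proof (rule exI[of _ U], intro conjI)
    have "(\<forall>i<n. f i \<in> reg X U \<and> g i \<in> reg X U) \<and> (\<forall>y\<in>U. form_sum U f g n y = finsum (Omega_stalk X y)
        (\<lambda>i. germ X y U (f i) \<odot>\<^bsub>Omega_stalk X y\<^esub> d_stalk X y (germ X y U (g i))) {..<n})"
      using assms by (simp add: form_sum_def)
    then show "\<exists>(m :: nat) f' g'. (\<forall>i<m. f' i \<in> reg X U \<and> g' i \<in> reg X U) \<and>
      (\<forall>y\<in>U. form_sum U f g n y = finsum (Omega_stalk X y)
        (\<lambda>i. germ X y U (f' i) \<odot>\<^bsub>Omega_stalk X y\<^esub> d_stalk X y (germ X y U (g' i))) {..<m})"
      by (intro exI)
  qed (use assms(1) \<open>x \<in> U\<close> in simp_all)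
qed

lemma germ_d_closed:
  assumes "opn U" "y \<in> U" "f \<in> reg X U" "g \<in> reg X U"
  shows "d_stalk X y (germ X y U g) \<in> carrier (Omega_stalk X y)"
    and "germ X y U f \<odot>\<^bsub>Omega_stalk X y\<^esub> d_stalk X y (germ X y U g) \<in> carrier (Omega_stalk X y)"
proof -
  interpret D: differentials "stalk X y" "range (const_germ X y)"
    by (rule stalk_differentials[OF openin_subset_topspace[OF assms(1,2)]])
  show "d_stalk X y (germ X y U g) \<in> carrier (Omega_stalk X y)"
    by (rule D.kaehler_d_simps(1)[OF germ_closed[OF assms(1,2,4)]])
  then show "germ X y U f \<odot>\<^bsub>Omega_stalk X y\<^esub> d_stalk X y (germ X y U g) \<in> carrier (Omega_stalk X y)"
    by (rule D.\<Omega>.smult_closed[OF germ_closed[OF assms(1-3)]])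
qed

lemma form_sum_0:
  assumes U: "opn U"
  shows "form_sum U f g 0 = (\<lambda>y\<in>U. \<zero>\<^bsub>Omega_stalk X y\<^esub>)"
  unfolding form_sum_def
proof (rule restrict_ext)
  fix y assume y: "y \<in> U"
  interpret D: differentials "stalk X y" "range (const_germ X y)"
    by (rule stalk_differentials[OF openin_subset_topspace[OF U y]])
  show "finsum (Omega_stalk X y) (\<lambda>i. germ X y U (f i) \<odot>\<^bsub>Omega_stalk X y\<^esub>
      d_stalk X y (germ X y U (g i))) {..<0} = \<zero>\<^bsub>Omega_stalk X y\<^esub>"
    by simp
qed

text \<open>Phrased with the sum and scalar action of sections of \<open>Omega X\<close>, so that
  additivity and homogeneity of a vector field apply literally.\<close>

lemma form_sum_Suc:
  assumes U: "opn U" and f: "\<And>i. i < Suc n \<Longrightarrow> f i \<in> reg X U" and g: "\<And>i. i < Suc n \<Longrightarrow> g i \<in> reg X U"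
  shows "form_sum U f g (Suc n) = (\<lambda>y\<in>U. form_sum U f g n y \<oplus>\<^bsub>Omega_stalk X y\<^esub>
    (\<lambda>y\<in>U. germ X y U (f n) \<odot>\<^bsub>Omega_stalk X y\<^esub> d_section U (g n) y) y)"
  unfolding form_sum_def
proof (rule restrict_ext)
  fix y assume y: "y \<in> U"
  interpret D: differentials "stalk X y" "range (const_germ X y)"
    by (rule stalk_differentials[OF openin_subset_topspace[OF U y]])
  let ?t = "\<lambda>i. germ X y U (f i) \<odot>\<^bsub>Omega_stalk X y\<^esub> d_stalk X y (germ X y U (g i))"
  have c: "?t i \<in> carrier (Omega_stalk X y)" if "i < Suc n" for i
    by (rule germ_d_closed(2)[OF U y f[OF that] g[OF that]])
  then have "finsum (Omega_stalk X y) ?t (insert n {..<n}) = ?t n \<oplus>\<^bsub>Omega_stalk X y\<^esub> finsum (Omega_stalk X y) ?t {..<n}"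
    by (intro D.\<Omega>.M.finsum_insert) auto
  also have "\<dots> = finsum (Omega_stalk X y) ?t {..<n} \<oplus>\<^bsub>Omega_stalk X y\<^esub> ?t n"
    using c by (intro D.\<Omega>.M.a_comm D.\<Omega>.M.finsum_closed) auto
  finally show "finsum (Omega_stalk X y) ?t {..<Suc n} =
    (\<lambda>y\<in>U. finsum (Omega_stalk X y) (\<lambda>i. germ X y U (f i) \<odot>\<^bsub>Omega_stalk X y\<^esub>
       d_stalk X y (germ X y U (g i))) {..<n}) y \<oplus>\<^bsub>Omega_stalk X y\<^esub>
    (\<lambda>y\<in>U. germ X y U (f n) \<odot>\<^bsub>Omega_stalk X y\<^esub> d_section U (g n) y) y"
    using y by (simp add: lessThan_Suc d_section_def)
qed

lemma Omega_section_closed: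
  assumes "s \<in> Omega_sections X U" "x \<in> U"
  shows "s x \<in> carrier (Omega_stalk X x)"
proof -
  obtain V n f g where V: "opn V" "x \<in> V" "V \<subseteq> U" "\<And>i. i < n \<Longrightarrow> f i \<in> reg X V" "\<And>i. i < n \<Longrightarrow> g i \<in> reg X V"
    "restrict s V = form_sum V f g n"
    using assms by (rule Omega_sectionsE) (rule that)
  interpret D: differentials "stalk X x" "range (const_germ X x)"
    by (rule stalk_differentials[OF openin_subset_topspace[OF V(1,2)]])
  have "form_sum V f g n x \<in> carrier (Omega_stalk X x)"
    using V by (auto simp: form_sum_def intro!: D.\<Omega>.M.finsum_closed germ_d_closed)
  then show ?thesis using V(2) by (simp flip: V(6))
qed

text \<open>Both are sums with a single term; for dg the coefficient is 1.\<close>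

lemma d_section_section:
  assumes U: "opn U" and f: "f \<in> reg X U" and g: "g \<in> reg X U"
  shows "d_section U g \<in> Omega_sections X U"
    and "(\<lambda>y\<in>U. germ X y U f \<odot>\<^bsub>Omega_stalk X y\<^esub> d_section U g y) \<in> Omega_sections X U"
proof -
  have eq: "(\<lambda>y\<in>U. germ X y U f \<odot>\<^bsub>Omega_stalk X y\<^esub> d_section U g y) = form_sum U (\<lambda>i. f) (\<lambda>i. g) 1"
    if f: "f \<in> reg X U" for f
    unfolding form_sum_def
  proof (rule restrict_ext)
    fix y assume y: "y \<in> U"
    interpret D: differentials "stalk X y" "range (const_germ X y)"
      by (rule stalk_differentials[OF openin_subset_topspace[OF U y]])
    show "germ X y U f \<odot>\<^bsub>Omega_stalk X y\<^esub> d_section U g y = finsum (Omega_stalk X y)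
        (\<lambda>i. germ X y U f \<odot>\<^bsub>Omega_stalk X y\<^esub> d_stalk X y (germ X y U g)) {..<1::nat}"
      using germ_d_closed(2)[OF U y f g] y by (simp add: lessThan_Suc d_section_def)
  qed
  show "(\<lambda>y\<in>U. germ X y U f \<odot>\<^bsub>Omega_stalk X y\<^esub> d_section U g y) \<in> Omega_sections X U"
    unfolding eq[OF f] using U f g by (rule form_sum_section)
  have "d_section U g = (\<lambda>y\<in>U. germ X y U (\<lambda>y\<in>U. 1) \<odot>\<^bsub>Omega_stalk X y\<^esub> d_section U g y)"
  proof
    fix y
    show "d_section U g y = (\<lambda>y\<in>U. germ X y U (\<lambda>y\<in>U. 1) \<odot>\<^bsub>Omega_stalk X y\<^esub> d_section U g y) y"
    proof (cases "y \<in> U")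
      case True
      interpret D: differentials "stalk X y" "range (const_germ X y)"
        by (rule stalk_differentials[OF openin_subset_topspace[OF U True]])
      show ?thesis
        using True germ_d_closed(1)[OF U True g g] stalk_one[OF U True, symmetric]
        by (simp add: d_section_def)
    qed (simp add: d_section_def)
  qed
  also have "\<dots> = form_sum U (\<lambda>i. \<lambda>y\<in>U. 1) (\<lambda>i. g) 1"
    by (rule eq[OF reg_const[OF U]])
  finally show "d_section U g \<in> Omega_sections X U"
    using form_sum_section[OF U, of 1 "\<lambda>i. \<lambda>y\<in>U. 1" "\<lambda>i. g"] reg_const[OF U] g by simp
qed

lemma zero_section: "opn U \<Longrightarrow> (\<lambda>y\<in>U. \<zero>\<^bsub>Omega_stalk X y\<^esub>) \<in> Omega_sections X U"
  using form_sum_section[of U 0] by (simp add: form_sum_0)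

lemma
  assumes v: "v \<in> tangent_sections X V" and W: "opn W" "W \<subseteq> V" and s: "s \<in> Omega_sections X W"
  shows tangent_closed: "v W s \<in> reg X W"
    and tangent_add: "t \<in> Omega_sections X W \<Longrightarrow>
      v W (\<lambda>y\<in>W. s y \<oplus>\<^bsub>Omega_stalk X y\<^esub> t y) = (\<lambda>y\<in>W. v W s y + v W t y)"
    and tangent_smult: "f \<in> reg X W \<Longrightarrow>
      v W (\<lambda>y\<in>W. germ X y W f \<odot>\<^bsub>Omega_stalk X y\<^esub> s y) = (\<lambda>y\<in>W. f y * v W s y)"
    and tangent_restrict: "opn W' \<Longrightarrow> W' \<subseteq> W \<Longrightarrow> v W' (restrict s W') = restrict (v W s) W'"
  using v[unfolded tangent_sections_def sheaf_hom_def] W s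
  by (simp_all add: Omega_def structure_sheaf_def reg_ring_def)

text \<open>Scale the zero form by the function 0 and use homogeneity.\<close>

lemma tangent_zero:
  assumes "v \<in> tangent_sections X V" "opn W" "W \<subseteq> V"
  shows "v W (\<lambda>y\<in>W. \<zero>\<^bsub>Omega_stalk X y\<^esub>) = (\<lambda>y\<in>W. 0)"
proof -
  have "(\<lambda>y\<in>W. germ X y W (\<lambda>y\<in>W. 0) \<odot>\<^bsub>Omega_stalk X y\<^esub> (\<lambda>y\<in>W. \<zero>\<^bsub>Omega_stalk X y\<^esub>) y) =
    (\<lambda>y\<in>W. \<zero>\<^bsub>Omega_stalk X y\<^esub>)"
  proof (rule restrict_ext)
    fix y assume y: "y \<in> W"
    interpret D: differentials "stalk X y" "range (const_germ X y)"
      by (rule stalk_differentials[OF openin_subset_topspace[OF assms(2) y]])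
    show "germ X y W (\<lambda>y\<in>W. 0) \<odot>\<^bsub>Omega_stalk X y\<^esub> (\<lambda>y\<in>W. \<zero>\<^bsub>Omega_stalk X y\<^esub>) y = \<zero>\<^bsub>Omega_stalk X y\<^esub>"
      using y D.\<Omega>.smult_r_null[OF germ_closed[OF assms(2) y reg_const[OF assms(2)]]] by simp
  qed
  then show ?thesis
    using tangent_smult[OF assms zero_section[OF assms(2)] reg_const[OF assms(2), of 0]]
    by (simp cong: restrict_cong)
qed

text \<open>A vector field acts on germs of functions as a derivation, which extends to germs of forms.\<close>
lemma tangent_stalk_map:
  assumes v: "v \<in> tangent_sections X V" and V: "opn V" and x: "x \<in> V"
  obtains v' where "linear_map (stalk X x) (Omega_stalk X x) (regular_module (stalk X x)) v'"
    "\<And>W s. opn W \<Longrightarrow> x \<in> W \<Longrightarrow> W \<subseteq> V \<Longrightarrow> s \<in> Omega_sections X W \<Longrightarrow> v' (s x) = germ X x W (v W s)"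
proof -
  let ?S = "stalk X x" and ?R = "regular_module (stalk X x)"
  interpret D: differentials ?S "range (const_germ X x)"
    by (rule stalk_differentials[OF openin_subset_topspace[OF V x]])
  \<comment> \<open>The action on a germ: apply \<open>v\<close> to dg for any representative
    \<open>g\<close>. Independence of the choice follows from compatibility with
    restriction.\<close>
  define \<delta> where "\<delta> a = (THE b. \<exists>W g. opn W \<and> x \<in> W \<and> W \<subseteq> V \<and> g \<in> reg X W \<and> a = germ X x W g \<and>
    b = germ X x W (v W (d_section W g)))" for a
  note ds = d_section_section(1)
  have res: "germ X x W (v W (d_section W g)) = germ X x W' (v W' (d_section W' (restrict g W')))"
    if W: "opn W" "W \<subseteq> V" "g \<in> reg X W" and W': "opn W'" "x \<in> W'" "W' \<subseteq> W" for W W' g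
  proof -
    have "d_section W' (restrict g W') = restrict (d_section W g) W'"
    proof
      fix y
      show "d_section W' (restrict g W') y = restrict (d_section W g) W' y"
        using W' germ_restrict[of W' y W g] by (cases "y \<in> W'") (auto simp: d_section_def)
    qed
    then show ?thesis
      using tangent_restrict[OF v W(1,2) ds[OF W(1,3,3)] W'(1,3)] germ_restrict[OF W'] by simp
  qed
  have \<delta>: "\<delta> (germ X x W g) = germ X x W (v W (d_section W g))"
    if W: "opn W" "x \<in> W" "W \<subseteq> V" "g \<in> reg X W" for W g
    unfolding \<delta>_def
  proof (rule the_equality)
    show "\<exists>W' g'. opn W' \<and> x \<in> W' \<and> W' \<subseteq> V \<and> g' \<in> reg X W' \<and> germ X x W g = germ X x W' g' \<and>
        germ X x W (v W (d_section W g)) = germ X x W' (v W' (d_section W' g'))"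
      using W by blast
    fix b assume "\<exists>W' g'. opn W' \<and> x \<in> W' \<and> W' \<subseteq> V \<and> g' \<in> reg X W' \<and> germ X x W g = germ X x W' g' \<and>
        b = germ X x W' (v W' (d_section W' g'))"
    then obtain W' g' where W': "opn W'" "x \<in> W'" "W' \<subseteq> V" "g' \<in> reg X W'"
      and eq: "germ X x W g = germ X x W' g'" and b: "b = germ X x W' (v W' (d_section W' g'))" by blast
    obtain A where A: "opn A" "x \<in> A" "A \<subseteq> W \<inter> W'" "\<And>y. y \<in> A \<Longrightarrow> g y = g' y"
      using eq W(1,2,4) by (rule germ_eqD) blast
    have "restrict g A = restrict g' A" using A(4) by (rule restrict_ext)
    then show "b = germ X x W (v W (d_section W g))"
      unfolding b using res[OF W(1,3,4) A(1,2)] res[OF W'(1,3,4) A(1,2)] A(3) by simp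
  qed
  have derivation: "derivation ?S (range (const_germ X x)) ?R \<delta>"
  proof (rule derivationI)
    fix a b assume ab: "a \<in> carrier ?S" "b \<in> carrier ?S"
    obtain W f g where W: "opn W" "x \<in> W" "W \<subseteq> V" "f \<in> reg X W" "g \<in> reg X W"
      "a = germ X x W f" "b = germ X x W g"
      using stalkE2[OF ab V x] by metis
    note vc = tangent_closed[OF v W(1,3) ds[OF W(1,4,4)]] tangent_closed[OF v W(1,3) ds[OF W(1,5,5)]]
    show "\<delta> a \<in> carrier ?R"
      using W vc by (simp add: \<delta> germ_closed)
    have "d_section W (\<lambda>y\<in>W. f y + g y) = (\<lambda>y\<in>W. d_section W f y \<oplus>\<^bsub>Omega_stalk X y\<^esub> d_section W g y)"
      unfolding d_section_def
    proof (rule restrict_ext)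
      fix y assume y: "y \<in> W"
      interpret Dy: differentials "stalk X y" "range (const_germ X y)"
        by (rule stalk_differentials[OF openin_subset_topspace[OF W(1) y]])
      show "d_stalk X y (germ X y W (\<lambda>y\<in>W. f y + g y)) = (\<lambda>y\<in>W. d_stalk X y (germ X y W f)) y
          \<oplus>\<^bsub>Omega_stalk X y\<^esub> (\<lambda>y\<in>W. d_stalk X y (germ X y W g)) y"
        using W y by (simp add: germ_add[symmetric] germ_closed Dy.kaehler_d_simps)
    qed
    then show "\<delta> (a \<oplus>\<^bsub>?S\<^esub> b) = \<delta> a \<oplus>\<^bsub>?R\<^esub> \<delta> b"
      using W vc by (simp add: \<delta> germ_add reg_add tangent_add[OF v W(1,3)] ds)
    have "d_section W (\<lambda>y\<in>W. f y * g y) = (\<lambda>y\<in>W.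
        (\<lambda>y\<in>W. germ X y W f \<odot>\<^bsub>Omega_stalk X y\<^esub> d_section W g y) y \<oplus>\<^bsub>Omega_stalk X y\<^esub>
        (\<lambda>y\<in>W. germ X y W g \<odot>\<^bsub>Omega_stalk X y\<^esub> d_section W f y) y)"
      unfolding d_section_def
    proof (rule restrict_ext)
      fix y assume y: "y \<in> W"
      interpret Dy: differentials "stalk X y" "range (const_germ X y)"
        by (rule stalk_differentials[OF openin_subset_topspace[OF W(1) y]])
      show "d_stalk X y (germ X y W (\<lambda>y\<in>W. f y * g y)) =
        (\<lambda>y\<in>W. germ X y W f \<odot>\<^bsub>Omega_stalk X y\<^esub> (\<lambda>y\<in>W. d_stalk X y (germ X y W g)) y) y \<oplus>\<^bsub>Omega_stalk X y\<^esub>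
        (\<lambda>y\<in>W. germ X y W g \<odot>\<^bsub>Omega_stalk X y\<^esub> (\<lambda>y\<in>W. d_stalk X y (germ X y W f)) y) y"
        using W y by (simp add: germ_mult[symmetric] germ_closed Dy.kaehler_d_simps)
    qed
    then show "\<delta> (a \<otimes>\<^bsub>?S\<^esub> b) = a \<odot>\<^bsub>?R\<^esub> \<delta> b \<oplus>\<^bsub>?R\<^esub> b \<odot>\<^bsub>?R\<^esub> \<delta> a"
      using W vc by (simp add: \<delta> germ_mult germ_add reg_mult tangent_add[OF v W(1,3)]
          tangent_smult[OF v W(1,3)] d_section_section del: restrict_apply)
  next
    fix c assume "c \<in> range (const_germ X x)"
    then obtain e where c: "c = germ X x V (\<lambda>y\<in>V. e)" using const_germ_eq[OF V x] by auto
    have "d_section V (\<lambda>y\<in>V. e) = (\<lambda>y\<in>V. \<zero>\<^bsub>Omega_stalk X y\<^esub>)"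
      unfolding d_section_def
    proof (rule restrict_ext)
      fix y assume y: "y \<in> V"
      interpret Dy: differentials "stalk X y" "range (const_germ X y)"
        by (rule stalk_differentials[OF openin_subset_topspace[OF V y]])
      show "d_stalk X y (germ X y V (\<lambda>y\<in>V. e)) = \<zero>\<^bsub>Omega_stalk X y\<^esub>"
        using const_germ_eq[OF V y, of e, symmetric] by (simp add: Dy.kaehler_d_simps(4))
    qed
    then show "\<delta> c = \<zero>\<^bsub>?R\<^esub>"
      using V x reg_const[OF V] by (simp add: c \<delta> tangent_zero[OF v V] stalk_zero[OF V x])
  qed
  obtain v' where v': "linear_map ?S (Omega_stalk X x) ?R v'"
    "\<And>a. a \<in> carrier ?S \<Longrightarrow> v' (d_stalk X x a) = \<delta> a"
    using D.derivation_lift[OF D.regular_module_module derivation] by metis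
  show ?thesis
  proof (rule that[OF v'(1)])
    fix W s assume W: "opn W" "x \<in> W" "W \<subseteq> V" and s: "s \<in> Omega_sections X W"
    obtain U n f g where U: "opn U" "x \<in> U" "U \<subseteq> W"
      and fg: "\<And>i. i < n \<Longrightarrow> f i \<in> reg X U" "\<And>i. i < n \<Longrightarrow> g i \<in> reg X U"
      and eq: "restrict s U = form_sum U f g n"
      using s W(2) by (rule Omega_sectionsE) (rule that)
    have UV: "U \<subseteq> V" using U W by auto
    \<comment> \<open>Near \<open>x\<close> the form is a finite sum of f_i dg_i. Both sides are
      additive and homogeneous, so the comparison reduces to exact forms, where it is the definition
      of \<open>\<delta>\<close>.\<close>
    have sum: "v' (form_sum U f g m x) = germ X x U (v U (form_sum U f g m))" if "m \<le> n" for m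
      using that
    proof (induction m)
      case 0
      then show ?case
        using U linear_map_zero[OF D.kaehler_module D.regular_module_module v'(1)]
        by (simp add: form_sum_0[OF U(1)] tangent_zero[OF v U(1) UV] stalk_zero[OF U(1,2)] restrict_apply'
            del: restrict_apply)
    next
      case (Suc m)
      then have m: "f m \<in> reg X U" "g m \<in> reg X U" "m < n" and le: "m \<le> n" using fg by auto
      have Sm: "form_sum U f g m \<in> Omega_sections X U"
        by (rule form_sum_section[OF U(1)]) (use fg le in auto)
      note sec = d_section_section[OF U(1) m(1,2)]
      note Suc_eq = form_sum_Suc[OF U(1), of m f g, OF fg(1) fg(2)]
      have "v' (form_sum U f g (Suc m) x) = v' (form_sum U f g m x) \<oplus>\<^bsub>?S\<^esub>
          v' (germ X x U (f m) \<odot>\<^bsub>Omega_stalk X x\<^esub> d_stalk X x (germ X x U (g m)))"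
        using Suc.prems U(2) Omega_section_closed[OF Sm U(2)] germ_d_closed(2)[OF U(1,2) m(1,2)]
        by (subst Suc_eq) (simp_all add: d_section_def linear_map_add[OF v'(1)])
      also have "v' (germ X x U (f m) \<odot>\<^bsub>Omega_stalk X x\<^esub> d_stalk X x (germ X x U (g m))) =
          germ X x U (f m) \<otimes>\<^bsub>?S\<^esub> germ X x U (v U (d_section U (g m)))"
        using linear_map_smult[OF v'(1) germ_closed[OF U(1,2) m(1)] germ_d_closed(1)[OF U(1,2) m(1,2)]]
          v'(2)[OF germ_closed[OF U(1,2) m(2)]] \<delta>[OF U(1,2) UV m(2)] by simp
      also have "v' (form_sum U f g m x) = germ X x U (v U (form_sum U f g m))"
        by (rule Suc.IH[OF le])
      also have "germ X x U (v U (form_sum U f g m)) \<oplus>\<^bsub>?S\<^esub>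
          germ X x U (f m) \<otimes>\<^bsub>?S\<^esub> germ X x U (v U (d_section U (g m))) =
          germ X x U (v U (form_sum U f g (Suc m)))"
        using Suc.prems by (subst Suc_eq)
          (simp_all add: germ_mult[OF U(1,2)] germ_add[OF U(1,2)] m tangent_closed[OF v U(1) UV] Sm sec
            reg_mult[OF U(1)] tangent_add[OF v U(1) UV] tangent_smult[OF v U(1) UV]
            del: restrict_apply)
      finally show ?case .
    qed
    have "v' (s x) = v' (form_sum U f g n x)" using U(2) by (simp flip: eq)
    also have "\<dots> = germ X x U (v U (restrict s U))" using sum[of n] by (simp add: eq)
    also have "\<dots> = germ X x W (v W s)"
      using tangent_restrict[OF v W(1,3) s U(1,3)] germ_restrict[OF U] by simp
    finally show "v' (s x) = germ X x W (v W s)" .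
  qed
qed

text \<open>The passage in the other direction: functions are determined by their values, so a
  vector field may be prescribed by tangent vectors at points. Forms are locally sums of f dg, hence
  it is enough to know regularity on exact forms.\<close>

lemma tangent_section_of_pointwise:
  assumes V: "opn V"
    and lin: "\<And>y. y \<in> V \<Longrightarrow> linear_map (stalk X y) (Omega_stalk X y) (residue_module y) (e y)"
    and reg: "\<And>W g. opn W \<Longrightarrow> W \<subseteq> V \<Longrightarrow> g \<in> reg X W \<Longrightarrow> (\<lambda>y\<in>W. e y (d_section W g y)) \<in> reg X W"
  shows "(\<lambda>W s. \<lambda>y\<in>W. e y (s y)) \<in> tangent_sections X V"
proof -
  \<comment> \<open>Regularity is proved on neighbourhoods where the form is a finite sum, and then
    glued.\<close>
  have closed: "(\<lambda>y\<in>W. e y (s y)) \<in> reg X W"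
    if W: "opn W" "W \<subseteq> V" and s: "s \<in> Omega_sections X W" for W s
  proof (rule reg_glue[OF W(1)])
    fix x assume x: "x \<in> W"
    obtain U n f g where U: "opn U" "x \<in> U" "U \<subseteq> W"
      and fg: "\<And>i. i < n \<Longrightarrow> f i \<in> reg X U" "\<And>i. i < n \<Longrightarrow> g i \<in> reg X U"
      and eq: "restrict s U = form_sum U f g n"
      using s x by (rule Omega_sectionsE) (rule that)
    have UV: "U \<subseteq> V" using U W by auto
    have "(\<lambda>y\<in>U. e y (form_sum U f g m y)) \<in> reg X U" if "m \<le> n" for m
      using that
    proof (induction m)
      case 0
      have "(\<lambda>y\<in>U. e y (form_sum U f g 0 y)) = (\<lambda>y\<in>U. 0)"
      proof (rule restrict_ext)
        fix y assume y: "y \<in> U"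
        then have yX: "y \<in> topspace (zar X)" using openin_subset_topspace[OF U(1)] by blast
        interpret D: differentials "stalk X y" "range (const_germ X y)"
          by (rule stalk_differentials[OF yX])
        show "e y (form_sum U f g 0 y) = 0"
          using y UV linear_map_zero[OF D.kaehler_module residue_module_module[OF yX] lin[of y]]
          by (auto simp: form_sum_0[OF U(1)])
      qed
      then show ?case using reg_const[OF U(1)] by (simp del: restrict_apply)
    next
      case (Suc m)
      then have m: "f m \<in> reg X U" "g m \<in> reg X U" and le: "m \<le> n" using fg by auto
      have Sm: "form_sum U f g m \<in> Omega_sections X U"
        by (rule form_sum_section[OF U(1)]) (use fg le in auto)
      have "(\<lambda>y\<in>U. e y (form_sum U f g (Suc m) y)) =
        (\<lambda>y\<in>U. (\<lambda>y\<in>U. e y (form_sum U f g m y)) y + (\<lambda>y\<in>U. f m y * (\<lambda>y\<in>U. e y (d_section U (g m) y)) y) y)"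
      proof (rule restrict_ext)
        fix y assume y: "y \<in> U"
        then have yV: "y \<in> V" using UV by auto
        have "e y (form_sum U f g (Suc m) y) = e y (form_sum U f g m y \<oplus>\<^bsub>Omega_stalk X y\<^esub>
          germ X y U (f m) \<odot>\<^bsub>Omega_stalk X y\<^esub> d_section U (g m) y)"
          using y Suc.prems fg by (subst form_sum_Suc[OF U(1)]) auto
        also have "\<dots> = e y (form_sum U f g m y) + germ_value y (germ X y U (f m)) * e y (d_section U (g m) y)"
          using y linear_map_add[OF lin[OF yV] Omega_section_closed[OF Sm y] germ_d_closed(2)[OF U(1) y m]]
            linear_map_smult[OF lin[OF yV] germ_closed[OF U(1) y m(1)] germ_d_closed(1)[OF U(1) y m]]
          by (simp add: d_section_def)
        finally show "e y (form_sum U f g (Suc m) y) = (\<lambda>y\<in>U. e y (form_sum U f g m y)) y +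
            (\<lambda>y\<in>U. f m y * (\<lambda>y\<in>U. e y (d_section U (g m) y)) y) y"
          using y germ_value_germ[OF U(1) y m(1)] by simp
      qed
      then show ?case
        using Suc.IH[OF le] reg[OF U(1) UV m(2)] m by (simp add: reg_add[OF U(1)] reg_mult[OF U(1)] del: restrict_apply)
    qed
    from this[OF order_refl] have "(\<lambda>y\<in>U. e y (form_sum U f g n y)) \<in> reg X U" .
    moreover have "form_sum U f g n y = s y" if "y \<in> U" for y
      using fun_cong[OF eq, of y] that by simp
    then have "(\<lambda>y\<in>U. e y (form_sum U f g n y)) = restrict (\<lambda>y\<in>W. e y (s y)) U"
      using U(3) by (auto simp: restrict_def fun_eq_iff)
    ultimately have "restrict (\<lambda>y\<in>W. e y (s y)) U \<in> reg X U" by (simp only:)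
    with U show "\<exists>U. opn U \<and> x \<in> U \<and> U \<subseteq> W \<and> restrict (\<lambda>y\<in>W. e y (s y)) U \<in> reg X U" by blast
  qed simp
  show ?thesis
    unfolding tangent_sections_def sheaf_hom_def
  proof (intro CollectI allI impI ballI conjI)
    fix W s assume W: "opn W \<and> W \<subseteq> V" and s: "s \<in> carrier (sect (Omega X) W)"
    then have s': "s \<in> Omega_sections X W" by (simp add: Omega_def)
    show "(\<lambda>y\<in>W. e y (s y)) \<in> carrier (sect (structure_sheaf X) W)"
      using closed[OF _ _ s'] W by (simp add: structure_sheaf_def reg_ring_def)
    fix t assume "t \<in> carrier (sect (Omega X) W)"
    then have t: "t \<in> Omega_sections X W" by (simp add: Omega_def)
    show "(\<lambda>y\<in>W. e y ((s \<oplus>\<^bsub>sect (Omega X) W\<^esub> t) y)) =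
        (\<lambda>y\<in>W. e y (s y)) \<oplus>\<^bsub>sect (structure_sheaf X) W\<^esub> (\<lambda>y\<in>W. e y (t y))"
      using W linear_map_add[OF lin Omega_section_closed[OF s'] Omega_section_closed[OF t]]
      by (auto simp: structure_sheaf_def reg_ring_def Omega_def intro!: restrict_ext)
  next
    fix W s f assume W: "opn W \<and> W \<subseteq> V" and s: "s \<in> carrier (sect (Omega X) W)" and f: "f \<in> reg X W"
    then have s': "s \<in> Omega_sections X W" by (simp add: Omega_def)
    show "(\<lambda>y\<in>W. e y ((f \<odot>\<^bsub>sect (Omega X) W\<^esub> s) y)) = f \<odot>\<^bsub>sect (structure_sheaf X) W\<^esub> (\<lambda>y\<in>W. e y (s y))"
      using W f linear_map_smult[OF lin germ_closed Omega_section_closed[OF s']]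
      by (auto simp: structure_sheaf_def reg_ring_def Omega_def germ_value_germ intro!: restrict_ext)
  next
    fix W s W' assume "opn W' \<and> W' \<subseteq> W"
    then show "(\<lambda>y\<in>W'. e y (res (Omega X) W W' s y)) = res (structure_sheaf X) W W' (\<lambda>y\<in>W. e y (s y))"
      by (auto simp: structure_sheaf_def Omega_def restrict_def fun_eq_iff)
  qed
qed

end

section \<open>Koszul boundaries, the singular ideal, and the two inclusions\<close>

section \<open>The three ideals\<close>

text \<open>Restricting the carrier to cycles leaves cosets and scalar action unchanged, so the
  question is settled in the quotient of the whole degree 2 module by the boundaries.\<close>

lemma (in plain_module) koszul_class_annihilated_iff:
  assumes w: "w \<in> carrier M" and \<theta>: "\<theta> \<in> carrier (ext_power R M 2)" and h: "h \<in> carrier R"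
  shows "h \<odot>\<^bsub>koszul_cohomology R M w 2\<^esub> koszul_class R M w 2 \<theta> = \<zero>\<^bsub>koszul_cohomology R M w 2\<^esub> \<longleftrightarrow>
    h \<odot>\<^bsub>ext_power R M 2\<^esub> \<theta> \<in> wedge_left R M 1 w ` carrier (ext_power R M 1)"
proof -
  let ?E = "ext_power R M 2" and ?B = "wedge_left R M 1 w ` carrier (ext_power R M 1)"
  interpret E: plain_module R ?E by (rule ext_power_module)
  have B: "koszul_boundaries R M w 2 = ?B" by (simp add: numeral_eq_Suc)
  have sub: "submodule ?B R ?E"
    using linear_map_image_submodule[OF ext_power_module ext_power_module wedge_left_linear[OF w, of 1]]
    by (simp add: numeral_eq_Suc)
  have "h \<odot>\<^bsub>koszul_cohomology R M w 2\<^esub> koszul_class R M w 2 \<theta> =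
      h \<odot>\<^bsub>quotient_module ?E ?B\<^esub> (?B +>\<^bsub>?E\<^esub> \<theta>)"
    unfolding koszul_cohomology_def koszul_class_def B quotient_module_simps(4)
    by (simp add: a_r_coset_def r_coset_def)
  also have "\<dots> = ?B +>\<^bsub>?E\<^esub> (h \<odot>\<^bsub>?E\<^esub> \<theta>)" by (rule E.quotient_smult[OF sub h \<theta>])
  finally show ?thesis
    unfolding koszul_cohomology_def quotient_module_simps(2) B
    by (simp only: E.coset_eq_self_iff[OF sub E.smult_closed[OF h \<theta>]])
qed

text \<open>The data common to both inclusions; integrability and smoothness enter as hypotheses of
  the respective lemmas.\<close>

locale twisted_form = sheaf_of_functions X for X :: "'a fspace" +
  fixes L :: "('a, 'l) mod_presheaf" and \<omega> :: "'a set \<Rightarrow> 'l \<Rightarrow> 'a \<Rightarrow> 'a cotangent"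
  assumes L: "module_sheaf X L" and \<omega>: "\<omega> \<in> sheaf_hom X (topspace (zar X)) L (Omega X)"
begin

lemma
  assumes V: "opn V" and s: "s \<in> carrier (sect L V)"
  shows form_section: "\<omega> V s \<in> Omega_sections X V"
    and form_smult: "f \<in> reg X V \<Longrightarrow>
      \<omega> V (f \<odot>\<^bsub>sect L V\<^esub> s) = (\<lambda>y\<in>V. germ X y V f \<odot>\<^bsub>Omega_stalk X y\<^esub> \<omega> V s y)"
    and form_restrict: "opn W \<Longrightarrow> W \<subseteq> V \<Longrightarrow> \<omega> W (res L V W s) = restrict (\<omega> V s) W"
  using \<omega>[unfolded sheaf_hom_def] V s openin_subset[OF V] by (simp_all add: Omega_def)

lemma
  assumes V: "opn V" and s: "s \<in> carrier (sect L V)"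
  shows section_smult_closed: "f \<in> reg X V \<Longrightarrow> f \<odot>\<^bsub>sect L V\<^esub> s \<in> carrier (sect L V)"
    and section_restrict_closed: "opn W \<Longrightarrow> W \<subseteq> V \<Longrightarrow> res L V W s \<in> carrier (sect L W)"
proof -
  have "module (reg_ring X V) (sect L V)" using L V unfolding module_sheaf_def by simp
  from module.smult_closed[OF this] s
  show "f \<in> reg X V \<Longrightarrow> f \<odot>\<^bsub>sect L V\<^esub> s \<in> carrier (sect L V)" by (simp add: reg_ring_def)
  show "opn W \<Longrightarrow> W \<subseteq> V \<Longrightarrow> res L V W s \<in> carrier (sect L W)"
    using L V s unfolding module_sheaf_def by simp
qed

text \<open>The local witness inside \<open>sing_ideal\<close>. It constrains \<open>h\<close> on
  \<open>V\<close> only, so \<open>h\<close> may be altered outside.\<close>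

definition contraction_sum :: "'a set \<Rightarrow> ('a \<Rightarrow> complex) \<Rightarrow> bool" where
  "contraction_sum V h \<longleftrightarrow>
     (\<exists>(n :: nat) v s. (\<forall>i<n. v i \<in> tangent_sections X V \<and> s i \<in> carrier (sect L V)) \<and>
        (\<forall>y\<in>V. h y = (\<Sum>i<n. v i V (\<omega> V (s i)) y)))"

lemma contraction_sumE:
  assumes "contraction_sum V h"
  obtains n :: nat and v s where "\<And>i. i < n \<Longrightarrow> v i \<in> tangent_sections X V"
    "\<And>i. i < n \<Longrightarrow> s i \<in> carrier (sect L V)" "\<And>y. y \<in> V \<Longrightarrow> h y = (\<Sum>i<n. v i V (\<omega> V (s i)) y)"
  using assms unfolding contraction_sum_def by (elim exE conjE) (rule that, simp_all)

lemma tangent_sections_mono: "W \<subseteq> V \<Longrightarrow> tangent_sections X V \<subseteq> tangent_sections X W"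
  unfolding tangent_sections_def sheaf_hom_def by auto

lemma contraction_sum_cong:
  "contraction_sum V h \<Longrightarrow> (\<And>y. y \<in> V \<Longrightarrow> h y = k y) \<Longrightarrow> contraction_sum V k"
  unfolding contraction_sum_def by simp

text \<open>The sections are restricted while the vector fields stay: a morphism on \<open>V\<close>
  already contains its components on smaller open sets.\<close>

lemma contraction_sum_restrict:
  assumes "contraction_sum V h" "opn V" "opn W" "W \<subseteq> V"
  shows "contraction_sum W h"
proof -
  obtain n :: nat and v s where vs: "\<And>i. i < n \<Longrightarrow> v i \<in> tangent_sections X V"
    "\<And>i. i < n \<Longrightarrow> s i \<in> carrier (sect L V)" "\<And>y. y \<in> V \<Longrightarrow> h y = (\<Sum>i<n. v i V (\<omega> V (s i)) y)"
    using assms(1) by (rule contraction_sumE) (rule that)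
  have "v i W (\<omega> W (res L V W (s i))) y = v i V (\<omega> V (s i)) y" if "i < n" "y \<in> W" for i y
    using tangent_restrict[OF vs(1)[OF that(1)] assms(2) order_refl form_section[OF assms(2) vs(2)[OF that(1)]]
      assms(3,4)] form_restrict[OF assms(2) vs(2)[OF that(1)] assms(3,4)] that(2) by simp
  moreover have "\<And>i. i < n \<Longrightarrow> v i \<in> tangent_sections X W"
    using vs(1) tangent_sections_mono[OF assms(4)] by auto
  ultimately show ?thesis
    unfolding contraction_sum_def using vs(3) assms(4)
    by (intro exI[of _ n] exI[of _ v] exI[of _ "\<lambda>i. res L V W (s i)"])
      (auto simp: section_restrict_closed[OF assms(2) vs(2) assms(3,4)])
qed

lemma contraction_sum_zero: "contraction_sum V (\<lambda>y. 0)"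
  unfolding contraction_sum_def by (rule exI[of _ 0]) simp

lemma contraction_sum_single:
  "v \<in> tangent_sections X V \<Longrightarrow> s \<in> carrier (sect L V) \<Longrightarrow> contraction_sum V (v V (\<omega> V s))"
  unfolding contraction_sum_def
  by (rule exI[of _ 1], rule exI[of _ "\<lambda>i. v"], rule exI[of _ "\<lambda>i. s"]) simp

text \<open>Concatenate the two families, the second shifted by \<open>n\<close>.\<close>

lemma contraction_sum_add:
  assumes "contraction_sum V h" "contraction_sum V k"
  shows "contraction_sum V (\<lambda>y. h y + k y)"
proof -
  obtain n :: nat and v s where vs: "\<And>i. i < n \<Longrightarrow> v i \<in> tangent_sections X V"
    "\<And>i. i < n \<Longrightarrow> s i \<in> carrier (sect L V)" "\<And>y. y \<in> V \<Longrightarrow> h y = (\<Sum>i<n. v i V (\<omega> V (s i)) y)"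
    using assms(1) by (rule contraction_sumE) (rule that)
  obtain m :: nat and v' s' where vs': "\<And>i. i < m \<Longrightarrow> v' i \<in> tangent_sections X V"
    "\<And>i. i < m \<Longrightarrow> s' i \<in> carrier (sect L V)" "\<And>y. y \<in> V \<Longrightarrow> k y = (\<Sum>i<m. v' i V (\<omega> V (s' i)) y)"
    using assms(2) by (rule contraction_sumE) (rule that)
  define u where "u i = (if i < n then v i else v' (i - n))" for i
  define t where "t i = (if i < n then s i else s' (i - n))" for i
  have split: "(\<Sum>i<n + m. F i) = (\<Sum>i<n. F i) + (\<Sum>i<m. F (n + i))" for F :: "nat \<Rightarrow> complex"
    by (induction m) (simp_all add: algebra_simps)
  have "\<And>i. i < n + m \<Longrightarrow> u i \<in> tangent_sections X V \<and> t i \<in> carrier (sect L V)"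
    using vs vs' by (auto simp: u_def t_def)
  moreover have "h y + k y = (\<Sum>i<n + m. u i V (\<omega> V (t i)) y)" if "y \<in> V" for y
    unfolding split using that by (simp add: u_def t_def vs(3) vs'(3))
  ultimately show ?thesis
    unfolding contraction_sum_def by (intro exI[of _ "n + m"] exI[of _ u] exI[of _ t]) auto
qed

text \<open>The factor is absorbed by the section of \<open>L\<close>: f v(\<omega>(s)) =
  v(\<omega>(f s)).\<close>

lemma contraction_sum_mult:
  assumes "contraction_sum V h" "opn V" "f \<in> reg X V"
  shows "contraction_sum V (\<lambda>y. f y * h y)"
proof -
  obtain n :: nat and v s where vs: "\<And>i. i < n \<Longrightarrow> v i \<in> tangent_sections X V"
    "\<And>i. i < n \<Longrightarrow> s i \<in> carrier (sect L V)" "\<And>y. y \<in> V \<Longrightarrow> h y = (\<Sum>i<n. v i V (\<omega> V (s i)) y)"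
    using assms(1) by (rule contraction_sumE) (rule that)
  have "v i V (\<omega> V (f \<odot>\<^bsub>sect L V\<^esub> s i)) y = f y * v i V (\<omega> V (s i)) y" if "i < n" "y \<in> V" for i y
    using form_smult[OF assms(2) vs(2)[OF that(1)] assms(3)]
      tangent_smult[OF vs(1)[OF that(1)] assms(2) order_refl form_section[OF assms(2) vs(2)[OF that(1)]] assms(3)]
      that(2) by simp
  then have "f y * h y = (\<Sum>i<n. v i V (\<omega> V (f \<odot>\<^bsub>sect L V\<^esub> s i)) y)" if "y \<in> V" for y
    using that vs(3) by (simp add: sum_distrib_left)
  then show ?thesis
    unfolding contraction_sum_def using vs(1) section_smult_closed[OF assms(2) vs(2) assms(3)]
    by (intro exI[of _ n] exI[of _ v] exI[of _ "\<lambda>i. f \<odot>\<^bsub>sect L V\<^esub> s i"]) auto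
qed

lemma sing_idealD:
  assumes "h \<in> sing_ideal X L \<omega> U"
  shows "h \<in> reg X U"
    and "x \<in> U \<Longrightarrow> \<exists>V. opn V \<and> x \<in> V \<and> V \<subseteq> U \<and> contraction_sum V h"
  using assms unfolding sing_ideal_def contraction_sum_def by auto

lemma sing_ideal_stalkI:
  assumes "opn V" "x \<in> V" "h \<in> reg X V" "contraction_sum V h"
  shows "germ X x V h \<in> sing_ideal_stalk X L \<omega> x"
proof -
  have "h \<in> sing_ideal X L \<omega> V"
    unfolding sing_ideal_def
  proof (intro CollectI conjI ballI assms(3))
    fix z assume "z \<in> V"
    then show "\<exists>W. opn W \<and> z \<in> W \<and> W \<subseteq> V \<and>
      (\<exists>(n :: nat) v s. (\<forall>i<n. v i \<in> tangent_sections X W \<and> s i \<in> carrier (sect L W)) \<and>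
        (\<forall>y\<in>W. h y = (\<Sum>i<n. v i W (\<omega> W (s i)) y)))"
      using assms(1,4) unfolding contraction_sum_def by (intro exI[of _ V]) simp
  qed
  then show ?thesis unfolding sing_ideal_stalk_def using assms(1,2) by blast
qed

text \<open>Membership in the ideal is a local condition; the neighbourhood is shrunk until one sum
  witnesses it.\<close>

lemma sing_ideal_stalkE:
  assumes "a \<in> sing_ideal_stalk X L \<omega> x"
  obtains V h where "opn V" "x \<in> V" "h \<in> reg X V" "contraction_sum V h" "a = germ X x V h"
proof -
  obtain U h where U: "opn U" "x \<in> U" "h \<in> sing_ideal X L \<omega> U" "a = germ X x U h"
    using assms unfolding sing_ideal_stalk_def by auto
  obtain V where V: "opn V" "x \<in> V" "V \<subseteq> U" "contraction_sum V h"
    using sing_idealD(2)[OF U(3,2)] by auto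
  show ?thesis
    by (rule that[OF V(1,2) reg_restrict[OF U(1) sing_idealD(1)[OF U(3)] V(1,3)]
        contraction_sum_cong[OF V(4)]])
      (simp_all add: germ_restrict[OF V(1-3)] U(4))
qed

text \<open>Makes \<open>O_Sing_stalk\<close> a module, so that the tensor product in
  \<open>kupka_ideal\<close> obeys the module laws.\<close>

lemma sing_ideal_stalk_submodule:
  assumes x: "x \<in> topspace (zar X)"
  shows "submodule (sing_ideal_stalk X L \<omega> x) (stalk X x) (regular_module (stalk X x))"
proof -
  let ?S = "stalk X x" and ?J = "sing_ideal_stalk X L \<omega> x"
  interpret S: cring ?S by (rule stalk_cring[OF x])
  interpret N: plain_module ?S "regular_module ?S" by (rule S.regular_module_module)
  have closed: "a \<in> carrier ?S" if "a \<in> ?J" for a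
    using that by (elim sing_ideal_stalkE) (simp add: germ_closed)
  have mult: "r \<otimes>\<^bsub>?S\<^esub> a \<in> ?J" if r: "r \<in> carrier ?S" and a: "a \<in> ?J" for r a
  proof -
    obtain V h where V: "opn V" "x \<in> V" "h \<in> reg X V" "contraction_sum V h" "a = germ X x V h"
      using a by (rule sing_ideal_stalkE)
    obtain W f where W: "opn W" "x \<in> W" "W \<subseteq> V" "f \<in> reg X W" "r = germ X x W f"
      using stalkE2[OF r r V(1,2)] by metis
    note h = reg_restrict[OF V(1,3) W(1,3)]
    have "r \<otimes>\<^bsub>?S\<^esub> a = germ X x W (\<lambda>y\<in>W. f y * restrict h W y)"
      using germ_mult[OF W(1,2,4) h] germ_restrict[OF W(1-3), of h] by (simp only: V(5) W(5))
    moreover have "contraction_sum W (\<lambda>y\<in>W. f y * restrict h W y)"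
      by (rule contraction_sum_cong[OF contraction_sum_mult[OF contraction_sum_restrict[OF V(4,1) W(1,3)] W(1,4)]])
        simp
    ultimately show ?thesis
      using sing_ideal_stalkI[OF W(1,2) reg_mult[OF W(1,4) h]] by (simp only:)
  qed
  have add: "a \<oplus>\<^bsub>?S\<^esub> b \<in> ?J" if ab: "a \<in> ?J" "b \<in> ?J" for a b
  proof -
    obtain V h where V: "opn V" "x \<in> V" "h \<in> reg X V" "contraction_sum V h" "a = germ X x V h"
      using ab(1) by (rule sing_ideal_stalkE)
    obtain W k where W: "opn W" "x \<in> W" "k \<in> reg X W" "contraction_sum W k" "b = germ X x W k"
      using ab(2) by (rule sing_ideal_stalkE)
    let ?I = "V \<inter> W"
    have I: "opn ?I" "x \<in> ?I" "?I \<subseteq> V" "?I \<subseteq> W" using V W by auto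
    note h = reg_restrict[OF V(1,3) I(1,3)] and k = reg_restrict[OF W(1,3) I(1,4)]
    have "a \<oplus>\<^bsub>?S\<^esub> b = germ X x ?I (\<lambda>y\<in>?I. restrict h ?I y + restrict k ?I y)"
      using germ_add[OF I(1,2) h k] germ_restrict[OF I(1-3), of h] germ_restrict[OF I(1,2,4), of k]
      by (simp only: V(5) W(5))
    moreover have "contraction_sum ?I (\<lambda>y\<in>?I. restrict h ?I y + restrict k ?I y)"
      by (rule contraction_sum_cong[OF contraction_sum_add[OF contraction_sum_restrict[OF V(4,1) I(1,3)]
          contraction_sum_restrict[OF W(4,1) I(1,4)]]]) simp
    ultimately show ?thesis
      using sing_ideal_stalkI[OF I(1,2) reg_add[OF I(1) h k]] by (simp only:)
  qed
  have zero: "\<zero>\<^bsub>?S\<^esub> \<in> ?J"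
    using sing_ideal_stalkI[OF openin_topspace x reg_const[OF openin_topspace, of 0]
        contraction_sum_cong[OF contraction_sum_zero]] stalk_zero[OF openin_topspace x] by simp
  show ?thesis
  proof (rule N.submoduleI)
    show "?J \<subseteq> carrier (regular_module ?S)" using closed by auto
    fix a assume a: "a \<in> ?J"
    have "\<ominus>\<^bsub>regular_module ?S\<^esub> a = (\<ominus>\<^bsub>?S\<^esub> \<one>\<^bsub>?S\<^esub>) \<otimes>\<^bsub>?S\<^esub> a"
      using N.smult_l_minus[of "\<one>\<^bsub>?S\<^esub>" a] closed[OF a] by simp
    then show "\<ominus>\<^bsub>regular_module ?S\<^esub> a \<in> ?J" using mult[OF _ a] by simp
  qed (simp_all add: zero add mult)
qed

text \<open>With coefficient 1 the generator itself lies in the image stalk, so at each point it is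
  the value of some \<omega>(s). This is how integrability, stated for sections of \<open>L\<close>,
  reaches \<alpha>.\<close>

lemma local_generatorD:
  assumes "local_generator X L \<omega> V \<alpha>" "x \<in> V"
  shows "opn V" "\<alpha> x \<in> carrier (Omega_stalk X x)" "\<alpha> x \<in> image_stalk X L \<omega> x"
    and "\<eta> \<in> image_stalk X L \<omega> x \<Longrightarrow> \<exists>a\<in>carrier (stalk X x). \<eta> = a \<odot>\<^bsub>Omega_stalk X x\<^esub> \<alpha> x"
proof -
  show V: "opn V" using assms(1) by (simp add: local_generator_def)
  interpret D: differentials "stalk X x" "range (const_germ X x)"
    by (rule stalk_differentials[OF openin_subset_topspace[OF V assms(2)]])
  have im: "image_stalk X L \<omega> x = {a \<odot>\<^bsub>Omega_stalk X x\<^esub> \<alpha> x | a. a \<in> carrier (stalk X x)}"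
    using assms by (simp add: local_generator_def)
  show \<alpha>: "\<alpha> x \<in> carrier (Omega_stalk X x)"
    using assms Omega_section_closed[of \<alpha> V x] by (simp add: local_generator_def Omega_def)
  show "\<eta> \<in> image_stalk X L \<omega> x \<Longrightarrow> \<exists>a\<in>carrier (stalk X x). \<eta> = a \<odot>\<^bsub>Omega_stalk X x\<^esub> \<alpha> x"
    unfolding im by auto
  have "\<alpha> x = \<one>\<^bsub>stalk X x\<^esub> \<odot>\<^bsub>Omega_stalk X x\<^esub> \<alpha> x" using \<alpha> by simp
  then show "\<alpha> x \<in> image_stalk X L \<omega> x" unfolding im using D.one_closed by blast
qed

text \<open>The germs that multiply d\<alpha> into the boundaries form an ideal, so one contraction
  v(\<omega>(s)) may be treated at a time. In the stalk \<omega>(s) = a \<alpha>, so this is a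
  v(\<alpha>), and \<open>contraction_of_wedge\<close> applies to v(\<alpha>).\<close>

lemma sing_subset_persistent:
  assumes integrable: "\<And>V s x. opn V \<Longrightarrow> s \<in> carrier (sect L V) \<Longrightarrow> x \<in> V \<Longrightarrow>
      wedge_stalk X 2 x (\<omega> V s x) (ext_deriv_stalk X x (\<omega> V s x)) = \<zero>\<^bsub>Omega_k_stalk X 3 x\<^esub>"
    and U: "opn U"
  shows "sing_ideal X L \<omega> U \<subseteq> persistent_ideal X L \<omega> U"
proof
  fix h assume h: "h \<in> sing_ideal X L \<omega> U"
  note hU = sing_idealD(1)[OF h]
  show "h \<in> persistent_ideal X L \<omega> U"
    unfolding persistent_ideal_def Let_def
  proof (intro CollectI conjI allI impI ballI hU)
    fix V \<alpha> x assume V\<alpha>: "V \<subseteq> U \<and> local_generator X L \<omega> V \<alpha>" and x: "x \<in> V"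
    note gen = local_generatorD[OF conjunct2[OF V\<alpha>] x]
    have xU: "x \<in> U" using V\<alpha> x by auto
    let ?S = "stalk X x" and ?\<Omega> = "Omega_stalk X x" and ?d = "ext_deriv_stalk X x (\<alpha> x)"
    let ?E = "\<lambda>k. Omega_k_stalk X k x"
    interpret D: differentials ?S "range (const_germ X x)"
      by (rule stalk_differentials[OF openin_subset_topspace[OF U xU]])
    interpret E2: plain_module ?S "?E 2" by (rule D.\<Omega>.ext_power_module)
    have d: "?d \<in> carrier (?E 2)" by (rule D.ext_deriv_closed[OF gen(2)])
    have zero: "wedge_stalk X 2 x (\<alpha> x) ?d = \<zero>\<^bsub>?E 3\<^esub>"
      using gen(3) integrable unfolding image_stalk_def by auto
    let ?B = "wedge_stalk X 1 x (\<alpha> x) ` carrier (?E 1)"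
    let ?P = "{b \<in> carrier (regular_module ?S). b \<odot>\<^bsub>?E 2\<^esub> ?d \<in> ?B}"
    have smult_linear: "linear_map ?S (regular_module ?S) (?E 2) (\<lambda>b. b \<odot>\<^bsub>?E 2\<^esub> ?d)"
      by (rule linear_mapI) (use d in \<open>simp_all add: E2.smult_l_distr E2.smult_assoc1\<close>)
    have B: "submodule ?B ?S (?E 2)"
      using linear_map_image_submodule[OF D.\<Omega>.ext_power_module D.\<Omega>.ext_power_module
          D.\<Omega>.wedge_left_linear[OF gen(2), of 1]]
      by (simp add: numeral_eq_Suc)
    interpret N: plain_module ?S "regular_module ?S" by (rule D.regular_module_module)
    have P: "submodule ?P ?S (regular_module ?S)"
      by (rule linear_map_vimage_submodule[OF D.regular_module_module D.\<Omega>.ext_power_module smult_linear B])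
    note Psub = N.submoduleE[OF P]
    obtain W where W: "opn W" "x \<in> W" "W \<subseteq> U" "contraction_sum W h"
      using sing_idealD(2)[OF h xU] by auto
    obtain n :: nat and v s where vs: "\<And>i. i < n \<Longrightarrow> v i \<in> tangent_sections X W"
      "\<And>i. i < n \<Longrightarrow> s i \<in> carrier (sect L W)" "\<And>y. y \<in> W \<Longrightarrow> h y = (\<Sum>i<n. v i W (\<omega> W (s i)) y)"
    using W(4) by (rule contraction_sumE) (rule that)
    have contraction: "germ X x W (v i W (\<omega> W (s i))) \<in> ?P" if i: "i < n" for i
    proof -
      obtain v' where v': "linear_map ?S ?\<Omega> (regular_module ?S) v'"
        "\<And>W' s. opn W' \<Longrightarrow> x \<in> W' \<Longrightarrow> W' \<subseteq> W \<Longrightarrow> s \<in> Omega_sections X W' \<Longrightarrow> v' (s x) = germ X x W' (v i W' s)"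
        using vs(1)[OF i] W(1,2) by (rule tangent_stalk_map) (rule that)
      have "\<omega> W (s i) x \<in> image_stalk X L \<omega> x"
        using W(1,2) vs(2)[OF i] unfolding image_stalk_def by blast
      then obtain a where a: "a \<in> carrier ?S" "\<omega> W (s i) x = a \<odot>\<^bsub>?\<Omega>\<^esub> \<alpha> x"
        using gen(4) by auto
      have "germ X x W (v i W (\<omega> W (s i))) = v' (a \<odot>\<^bsub>?\<Omega>\<^esub> \<alpha> x)"
        using v'(2)[OF W(1,2) order_refl form_section[OF W(1) vs(2)[OF i]]] by (simp only: a(2))
      also have "\<dots> = a \<odot>\<^bsub>regular_module ?S\<^esub> v' (\<alpha> x)"
        by (rule linear_map_smult[OF v'(1) a(1) gen(2)])
      finally have eq: "germ X x W (v i W (\<omega> W (s i))) = a \<odot>\<^bsub>regular_module ?S\<^esub> v' (\<alpha> x)" .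
      have "v' (\<alpha> x) \<in> ?P"
        using linear_map_closed[OF v'(1) gen(2)] D.\<Omega>.contraction_of_wedge[OF v'(1) gen(2) d zero] by simp
      then show ?thesis unfolding eq by (rule Psub(4)[OF a(1)])
    qed
    \<comment> \<open>Regularity of the partial sums is carried along because
      \<open>germ_add\<close> asks for regular functions.\<close>
    have sum: "(\<lambda>y\<in>W. \<Sum>i<m. v i W (\<omega> W (s i)) y) \<in> reg X W \<and>
        germ X x W (\<lambda>y\<in>W. \<Sum>i<m. v i W (\<omega> W (s i)) y) \<in> ?P" if "m \<le> n" for m
      using that
    proof (induction m)
      case 0
      then show ?case
        using N.submodule_zero_closed[OF P] reg_const[OF W(1), of 0] stalk_zero[OF W(1,2)]
        by (simp del: restrict_apply)
    next
      case (Suc m)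
      let ?f = "\<lambda>y\<in>W. \<Sum>i<m. v i W (\<omega> W (s i)) y" and ?g = "v m W (\<omega> W (s m))"
      note f = conjunct1[OF Suc.IH[OF Suc_leD[OF Suc.prems]]] conjunct2[OF Suc.IH[OF Suc_leD[OF Suc.prems]]]
      have m: "m < n" using Suc.prems by simp
      have g: "?g \<in> reg X W"
        by (rule tangent_closed[OF vs(1)[OF m] W(1) order_refl form_section[OF W(1) vs(2)[OF m]]])
      have eq: "(\<lambda>y\<in>W. \<Sum>i<Suc m. v i W (\<omega> W (s i)) y) = (\<lambda>y\<in>W. ?f y + ?g y)"
        by (rule restrict_ext) simp
      have "germ X x W (\<lambda>y\<in>W. ?f y + ?g y) = germ X x W ?f \<oplus>\<^bsub>regular_module ?S\<^esub> germ X x W ?g"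
        using germ_add[OF W(1,2) f(1) g] by (simp only: regular_module_simps)
      then show ?case
        unfolding eq using reg_add[OF W(1) f(1) g] Psub(5)[OF f(2) contraction[OF m]] by (simp only: simp_thms)
    qed
    have "germ X x U h = germ X x W (\<lambda>y\<in>W. \<Sum>i<n. v i W (\<omega> W (s i)) y)"
      by (rule germ_eqI[of X W]) (use W vs(3) in auto)
    then have "germ X x U h \<odot>\<^bsub>?E 2\<^esub> ?d \<in> ?B" using sum[of n] by simp
    then show "germ X x U h \<odot>\<^bsub>koszul_cohomology ?S ?\<Omega> (\<alpha> x) 2\<^esub> koszul_class ?S ?\<Omega> (\<alpha> x) 2 ?d
        = \<zero>\<^bsub>koszul_cohomology ?S ?\<Omega> (\<alpha> x) 2\<^esub>"
      using D.\<Omega>.koszul_class_annihilated_iff[OF gen(2) d germ_closed[OF U xU hU]] by simp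
  qed
qed

text \<open>Smoothness enters only through a local dual basis of forms \<open>b\<close> and vector fields \<open>v\<close>.\<close>
lemma persistent_subset_kupka:
  assumes dual_basis: "\<And>x. x \<in> topspace (zar X) \<Longrightarrow> \<exists>V (n :: nat) v b. opn V \<and> x \<in> V \<and>
      (\<forall>j<n. v j \<in> tangent_sections X V \<and> b j \<in> carrier (Omega_stalk X x)) \<and>
      (\<forall>W s. opn W \<and> x \<in> W \<and> W \<subseteq> V \<and> s \<in> Omega_sections X W \<longrightarrow>
        s x = finsum (Omega_stalk X x) (\<lambda>j. germ X x W (v j W s) \<odot>\<^bsub>Omega_stalk X x\<^esub> b j) {..<n})"
    and U: "opn U"
  shows "persistent_ideal X L \<omega> U \<subseteq> kupka_ideal X L \<omega> U"
proof
  fix h assume h: "h \<in> persistent_ideal X L \<omega> U"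
  then have hU: "h \<in> reg X U" by (simp add: persistent_ideal_def)
  show "h \<in> kupka_ideal X L \<omega> U"
    unfolding kupka_ideal_def Let_def
  proof (intro CollectI conjI allI impI ballI hU)
    fix V \<alpha> x assume V\<alpha>: "V \<subseteq> U \<and> local_generator X L \<omega> V \<alpha>" and x: "x \<in> V"
    note gen = local_generatorD[OF conjunct2[OF V\<alpha>] x]
    have xU: "x \<in> U" using V\<alpha> x by auto
    note xX = openin_subset_topspace[OF U xU]
    let ?S = "stalk X x" and ?\<Omega> = "Omega_stalk X x" and ?d = "ext_deriv_stalk X x (\<alpha> x)"
    let ?E = "\<lambda>k. Omega_k_stalk X k x" and ?J = "sing_ideal_stalk X L \<omega> x"
    let ?O = "O_Sing_stalk X L \<omega> x"
    let ?one = "?J +>\<^bsub>regular_module ?S\<^esub> \<one>\<^bsub>?S\<^esub>"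
    interpret D: differentials ?S "range (const_germ X x)" by (rule stalk_differentials[OF xX])
    interpret N: plain_module ?S "regular_module ?S" by (rule D.regular_module_module)
    note J = sing_ideal_stalk_submodule[OF xX]
    have O: "plain_module ?S ?O"
      unfolding O_Sing_stalk_def by (rule N.quotient_module_module[OF J])
    interpret T: tensor ?S "?E 2" ?O
      by (intro tensor.intro D.is_cring D.\<Omega>.ext_power_module O)
    interpret TM: plain_module ?S T.T by (rule T.tensor_is_module)
    let ?pt = "\<lambda>\<theta>. pure_tensor ?S (?E 2) ?O \<theta> ?one"
    have one: "?one \<in> carrier ?O"
      using linear_map_closed[OF N.quotient_projection_linear[OF J]] by (simp add: O_Sing_stalk_def)
    \<comment> \<open>Scaling the class of 1 by \<open>c\<close> gives the coset of
      \<open>c\<close>, which is zero in the quotient by the ideal containing it.\<close>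
    have one_zero: "c \<odot>\<^bsub>?O\<^esub> ?one = \<zero>\<^bsub>?O\<^esub>" if c: "c \<in> ?J" for c
    proof -
      have cS: "c \<in> carrier ?S" using c N.submoduleE(1)[OF J] by auto
      then show ?thesis
        using c N.quotient_smult[OF J cS, of "\<one>\<^bsub>?S\<^esub>"] N.coset_eq_self_iff[OF J, of c]
        by (simp add: O_Sing_stalk_def quotient_module_simps(2))
    qed
    have pt: "linear_map ?S (?E 2) T.T ?pt" by (rule T.pure_tensor_linear_left[OF one])
    have d: "?d \<in> carrier (?E 2)" by (rule D.ext_deriv_closed[OF gen(2)])
    obtain V' s where V': "opn V'" "x \<in> V'" "s \<in> carrier (sect L V')" "\<alpha> x = \<omega> V' s x"
      using gen(3) unfolding image_stalk_def by auto
    obtain A v b and n :: nat where A: "opn A" "x \<in> A"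
      and vb: "\<forall>j<n. v j \<in> tangent_sections X A \<and> b j \<in> carrier ?\<Omega>"
      and dual: "\<forall>W s. opn W \<and> x \<in> W \<and> W \<subseteq> A \<and> s \<in> Omega_sections X W \<longrightarrow>
        s x = finsum ?\<Omega> (\<lambda>j. germ X x W (v j W s) \<odot>\<^bsub>?\<Omega>\<^esub> b j) {..<n}"
      using dual_basis[OF xX] by (elim exE conjE) (rule that)
    have vb: "\<And>j. j < n \<Longrightarrow> v j \<in> tangent_sections X A" "\<And>j. j < n \<Longrightarrow> b j \<in> carrier ?\<Omega>"
      using vb by simp_all
    \<comment> \<open>The dual basis and the section representing \<alpha> have to live on one
      neighbourhood of \<open>x\<close>.\<close>
    let ?W = "A \<inter> V'"
    have W: "opn ?W" "x \<in> ?W" "?W \<subseteq> A" "?W \<subseteq> V'" using A V' by auto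
    define t where "t = res L V' ?W s"
    have t: "t \<in> carrier (sect L ?W)"
      unfolding t_def by (rule section_restrict_closed[OF V'(1,3) W(1,4)])
    have \<alpha>: "\<alpha> x = \<omega> ?W t x"
      unfolding t_def form_restrict[OF V'(1,3) W(1,4)] using V'(4) W(2) by simp
    note sec = form_section[OF W(1) t]
    \<comment> \<open>Coefficients of \<alpha> in the dual basis. They are contractions of
      \<omega>(t), hence lie in the singular ideal by construction.\<close>
    define c where "c j = germ X x ?W (v j ?W (\<omega> ?W t))" for j
    have vW: "v j \<in> tangent_sections X ?W" if "j < n" for j
      using vb(1)[OF that] tangent_sections_mono[OF W(3)] by auto
    have c: "c j \<in> ?J" if "j < n" for j
      unfolding c_def
      by (rule sing_ideal_stalkI[OF W(1,2) tangent_closed[OF vW[OF that] W(1) order_refl sec]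
          contraction_sum_single[OF vW[OF that] t]])
    then have cS: "c j \<in> carrier ?S" if "j < n" for j using that N.submoduleE(1)[OF J] by auto
    have \<alpha>_sum: "\<alpha> x = finsum ?\<Omega> (\<lambda>j. c j \<odot>\<^bsub>?\<Omega>\<^esub> b j) {..<n}"
      unfolding c_def \<alpha> by (rule dual[rule_format]) (simp only: W(1-3) sec simp_thms)
    \<comment> \<open>Expanding \<alpha> gives terms \<open>c j\<close> (b_j \<and> m) \<otimes> 1 =
      (b_j \<and> m) \<otimes> \<open>c j\<close>, and \<open>c j\<close> dies in the right
      factor.\<close>
    have wedge_zero: "?pt (wedge ?S ?\<Omega> [\<alpha> x, m]) = \<zero>\<^bsub>T.T\<^esub>" if m: "m \<in> carrier ?\<Omega>" for m
    proof -
      have lin: "linear_map ?S ?\<Omega> T.T (\<lambda>a. ?pt (wedge ?S ?\<Omega> [a, m]))"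
        by (rule linear_map_comp[OF _ pt], rule linear_mapI) (use m in \<open>simp_all add: D.\<Omega>.wedge_pair_simps\<close>)
      have "?pt (wedge ?S ?\<Omega> [\<alpha> x, m]) =
          finsum T.T (\<lambda>j. ?pt (wedge ?S ?\<Omega> [c j \<odot>\<^bsub>?\<Omega>\<^esub> b j, m])) {..<n}"
        unfolding \<alpha>_sum
        by (rule linear_map_finsum[OF D.kaehler_module T.tensor_is_module lin]) (use cS vb(2) in auto)
      also have "\<dots> = finsum T.T (\<lambda>j. \<zero>\<^bsub>T.T\<^esub>) {..<n}"
      proof (rule TM.finsum_cong')
        fix j assume "j \<in> {..<n}"
        then have j: "j < n" by simp
        note w = D.\<Omega>.wedge_pair_simps(1)[OF vb(2)[OF j] m]
        have "?pt (wedge ?S ?\<Omega> [c j \<odot>\<^bsub>?\<Omega>\<^esub> b j, m]) = c j \<odot>\<^bsub>T.T\<^esub> ?pt (wedge ?S ?\<Omega> [b j, m])"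
          by (rule linear_map_smult[OF lin cS[OF j] vb(2)[OF j]])
        also have "\<dots> = pure_tensor ?S (?E 2) ?O (wedge ?S ?\<Omega> [b j, m]) (c j \<odot>\<^bsub>?O\<^esub> ?one)"
          by (rule T.pure_tensor_smult_right[OF w one cS[OF j], symmetric])
        also have "\<dots> = \<zero>\<^bsub>T.T\<^esub>"
          unfolding one_zero[OF c[OF j]] by (rule T.pure_tensor_zero_right[OF w])
        finally show "?pt (wedge ?S ?\<Omega> [c j \<odot>\<^bsub>?\<Omega>\<^esub> b j, m]) = \<zero>\<^bsub>T.T\<^esub>" .
      qed auto
      finally show ?thesis by simp
    qed
    have wl: "linear_map ?S (?E 1) (?E 2) (wedge_stalk X 1 x (\<alpha> x))"
      using D.\<Omega>.wedge_left_linear[OF gen(2), of 1] by (simp add: numeral_eq_Suc)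
    note comp = linear_map_comp[OF wl pt]
    \<comment> \<open>Degree 1 elements are spanned by single vectors, so \<open>wedge_zero\<close>
      covers every \<alpha> \<and> \<eta>.\<close>
    have kernel: "\<eta> \<in> {\<eta> \<in> carrier (?E 1). ?pt (wedge_stalk X 1 x (\<alpha> x) \<eta>) \<in> {\<zero>\<^bsub>T.T\<^esub>}}"
      if "\<eta> \<in> carrier (?E 1)" for \<eta>
    proof (rule D.\<Omega>.ext_power_span[OF linear_map_vimage_submodule[OF D.\<Omega>.ext_power_module
          T.tensor_is_module comp TM.zero_submodule] _ that])
      fix ms assume ms: "set ms \<subseteq> carrier ?\<Omega>" "length ms = 1"
      then obtain m where m: "ms = [m]" "m \<in> carrier ?\<Omega>" by (cases ms) auto
      have "wedge_stalk X 1 x (\<alpha> x) (wedge ?S ?\<Omega> ms) = wedge ?S ?\<Omega> [\<alpha> x, m]"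
        using D.\<Omega>.wedge_left_wedge[OF gen(2) ms] by (simp only: m(1))
      then show "wedge ?S ?\<Omega> ms \<in> {\<eta> \<in> carrier (?E 1). ?pt (wedge_stalk X 1 x (\<alpha> x) \<eta>) \<in> {\<zero>\<^bsub>T.T\<^esub>}}"
        using wedge_zero[OF m(2)] D.\<Omega>.wedge_closed[OF ms] by simp
    qed
    have hS: "germ X x U h \<in> carrier ?S" by (rule germ_closed[OF U xU hU])
    have "germ X x U h \<odot>\<^bsub>?E 2\<^esub> ?d \<in> wedge_stalk X 1 x (\<alpha> x) ` carrier (?E 1)"
      using h V\<alpha> x D.\<Omega>.koszul_class_annihilated_iff[OF gen(2) d hS]
      unfolding persistent_ideal_def Let_def by blast
    then obtain \<eta> where \<eta>: "\<eta> \<in> carrier (?E 1)" "germ X x U h \<odot>\<^bsub>?E 2\<^esub> ?d = wedge_stalk X 1 x (\<alpha> x) \<eta>"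
      by auto
    have "germ X x U h \<odot>\<^bsub>T.T\<^esub> ?pt ?d = ?pt (germ X x U h \<odot>\<^bsub>?E 2\<^esub> ?d)"
      by (rule linear_map_smult[OF pt hS d, symmetric])
    also have "\<dots> = \<zero>\<^bsub>T.T\<^esub>" unfolding \<eta>(2) using kernel[OF \<eta>(1)] by simp
    finally show "germ X x U h \<odot>\<^bsub>T.T\<^esub> ?pt ?d = \<zero>\<^bsub>T.T\<^esub>" .
  qed
qed

end

section \<open>Differentiation of polynomials and elimination on their gradients\<close>

section \<open>Polynomial functions and the Jacobian criterion\<close>

text \<open>Written exactly as the matrix entries in \<open>jacobian_rank\<close>.\<close>

definition pd :: "nat \<Rightarrow> ((nat \<Rightarrow> complex) \<Rightarrow> complex) \<Rightarrow> (nat \<Rightarrow> complex) \<Rightarrow> complex" where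
  "pd i f p = deriv (\<lambda>t. f (p(i := t))) (p i)"

lemma poly_funs_differentiable:
  assumes "f \<in> poly_funs N"
  shows "(\<lambda>t. f (p(i := t))) field_differentiable at t"
  using assms
proof induction
  case (coord j)
  then show ?case by (cases "j = i") auto
qed (auto intro: field_differentiable_add field_differentiable_mult)

lemma poly_funs_pd:
  assumes "f \<in> poly_funs N"
  shows "((\<lambda>t. f (p(i := t))) has_field_derivative pd i f p) (at (p i))"
  unfolding pd_def DERIV_deriv_iff_field_differentiable by (rule poly_funs_differentiable[OF assms])

lemma pd_const [simp]: "pd i (\<lambda>p. c) p = 0"
  by (simp add: pd_def)

lemma pd_coord: "pd i (\<lambda>p. p j) p = (if i = j then 1 else 0)"
  by (auto simp: pd_def)

lemma pd_add:
  assumes "f \<in> poly_funs N" "g \<in> poly_funs N"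
  shows "pd i (\<lambda>p. f p + g p) p = pd i f p + pd i g p"
  using DERIV_add[OF poly_funs_pd[OF assms(1), of p i] poly_funs_pd[OF assms(2), of p i]]
  unfolding pd_def[of i "\<lambda>p. f p + g p"] by (rule DERIV_imp_deriv)

lemma pd_mult:
  assumes "f \<in> poly_funs N" "g \<in> poly_funs N"
  shows "pd i (\<lambda>p. f p * g p) p = f p * pd i g p + pd i f p * g p"
proof -
  have "((\<lambda>t. f (p(i := t)) * g (p(i := t))) has_field_derivative f p * pd i g p + pd i f p * g p) (at (p i))"
    using DERIV_mult[OF poly_funs_pd[OF assms(1), of p i] poly_funs_pd[OF assms(2), of p i]]
    by (simp add: algebra_simps)
  then show ?thesis unfolding pd_def[of i "\<lambda>p. f p * g p"] by (rule DERIV_imp_deriv)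
qed

text \<open>An analytic \<open>deriv\<close> has to be recognized as a polynomial function;
  induction over the generation of \<open>poly_funs\<close> does this through the differentiation
  rules.\<close>

lemma pd_closed: "f \<in> poly_funs N \<Longrightarrow> pd i f \<in> poly_funs N"
proof (induction rule: poly_funs.induct)
  case (const c)
  have "pd i (\<lambda>p. c) = (\<lambda>p. 0)" by (rule ext) simp
  then show ?case by (simp add: poly_funs.const)
next
  case (coord j)
  have "pd i (\<lambda>p. p j) = (\<lambda>p. if i = j then 1 else 0)" by (rule ext) (simp add: pd_coord)
  then show ?case by (simp add: poly_funs.const)
next
  case (add f g)
  have "pd i (\<lambda>p. f p + g p) = (\<lambda>p. pd i f p + pd i g p)"
    by (rule ext) (rule pd_add[OF add.hyps])
  then show ?case using add.IH by (simp add: poly_funs.add)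
next
  case (mult f g)
  have "pd i (\<lambda>p. f p * g p) = (\<lambda>p. f p * pd i g p + pd i f p * g p)"
    by (rule ext) (rule pd_mult[OF mult.hyps])
  then show ?case using mult by (simp add: poly_funs.add poly_funs.mult)
qed

lemma poly_funs_diff:
  assumes "f \<in> poly_funs N" "g \<in> poly_funs N"
  shows "(\<lambda>p. f p - g p) \<in> poly_funs N"
  using poly_funs.add[OF assms(1) poly_funs.mult[OF poly_funs.const[of "-1"] assms(2)]] by simp

lemma poly_funs_sum:
  assumes "\<And>i. i \<in> A \<Longrightarrow> f i \<in> poly_funs N"
  shows "(\<lambda>p. \<Sum>i\<in>A. f i p) \<in> poly_funs N"
  using assms
  by (induction A rule: infinite_finite_induct) (simp_all add: poly_funs.const poly_funs.add)

lemma pd_sum: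
  assumes "\<And>k. k \<in> A \<Longrightarrow> f k \<in> poly_funs N"
  shows "pd i (\<lambda>p. \<Sum>k\<in>A. f k p) p = (\<Sum>k\<in>A. pd i (f k) p)"
  using assms
proof (induction A rule: infinite_finite_induct)
  case (insert a A)
  then show ?case using pd_add[of "f a" N "\<lambda>p. \<Sum>k\<in>A. f k p" i p] poly_funs_sum[of A f N] by simp
qed simp_all

text \<open>The direction \<open>v\<close> is a single vector; a polynomial vector field is inserted
  as \<open>\<lambda>i. v i p\<close> at the same point \<open>p\<close>.\<close>

definition dir_deriv ::
    "nat \<Rightarrow> (nat \<Rightarrow> complex) \<Rightarrow> ((nat \<Rightarrow> complex) \<Rightarrow> complex) \<Rightarrow> (nat \<Rightarrow> complex) \<Rightarrow> complex" where
  "dir_deriv N v f p = (\<Sum>i<N. pd i f p * v i)"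

lemma
  assumes "f \<in> poly_funs N" "g \<in> poly_funs N"
  shows dir_deriv_add: "dir_deriv N v (\<lambda>p. f p + g p) p = dir_deriv N v f p + dir_deriv N v g p"
    and dir_deriv_mult:
      "dir_deriv N v (\<lambda>p. f p * g p) p = f p * dir_deriv N v g p + dir_deriv N v f p * g p"
  using assms
  by (simp_all add: dir_deriv_def pd_add pd_mult sum.distrib sum_distrib_left sum_distrib_right algebra_simps)

lemma dir_deriv_const [simp]: "dir_deriv N v (\<lambda>p. c) p = 0"
  by (simp add: dir_deriv_def)

lemma dir_deriv_coord: "j < N \<Longrightarrow> dir_deriv N v (\<lambda>p. p j) p = v j"
  by (simp add: dir_deriv_def pd_coord if_distrib[of "\<lambda>x. x * _"] cong: if_cong)

lemma dir_deriv_closed: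
  "f \<in> poly_funs N \<Longrightarrow> (\<And>i. i < N \<Longrightarrow> v i \<in> poly_funs N) \<Longrightarrow>
    (\<lambda>p. dir_deriv N (\<lambda>i. v i p) f p) \<in> poly_funs N"
  unfolding dir_deriv_def by (intro poly_funs_sum poly_funs.mult pd_closed) auto

text \<open>Write \<open>f\<close> as a combination of the generators. At a common zero the Leibniz
  rule leaves only the derivatives of the generators, which vanish along \<open>v\<close>.\<close>

lemma dir_deriv_vanishing:
  assumes F: "ideal_generators N F (vanishing_ideal N Y)"
    and v: "\<And>g. g \<in> F \<Longrightarrow> dir_deriv N v g p = 0" and p: "p \<in> Y"
    and f: "f \<in> poly_funs N" "\<And>q. q \<in> Y \<Longrightarrow> f q = 0"
  shows "dir_deriv N v f p = 0"
proof -
  have "f \<in> vanishing_ideal N Y" using f by (simp add: vanishing_ideal_def)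
  then obtain c where c: "\<And>g. g \<in> F \<Longrightarrow> c g \<in> poly_funs N" "f = (\<lambda>p. \<Sum>g\<in>F. c g p * g p)"
    using F unfolding ideal_generators_def by blast
  have g: "g \<in> poly_funs N" "g p = 0" if "g \<in> F" for g
    using F that p unfolding ideal_generators_def vanishing_ideal_def by auto
  have "dir_deriv N v f p = (\<Sum>g\<in>F. dir_deriv N v (\<lambda>p. c g p * g p) p)"
    unfolding c(2) dir_deriv_def
    using pd_sum[of F "\<lambda>g p. c g p * g p" N] c(1) g(1)
    by (simp add: poly_funs.mult sum_distrib_right sum.swap[of _ F])
  also have "\<dots> = 0"
    by (rule sum.neutral) (simp add: dir_deriv_mult[OF c(1) g(1)] g(2) v)
  finally show ?thesis .
qed

abbreviation "fscale \<equiv> (\<lambda>(c :: complex) (v :: nat \<Rightarrow> complex) i. c * v i)"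

lemma fscale_vector_space: "vector_space fscale"
  by unfold_locales (auto simp: fun_eq_iff algebra_simps)

text \<open>A vector of \<open>A\<close> outside the span could be added to \<open>B\<close>, giving
  an independent set larger than the dimension.\<close>

lemma (in vector_space) subset_span_of_card_eq_dim:
  assumes "finite A" "B \<subseteq> A" "independent B" "card B = dim A"
  shows "A \<subseteq> span B"
proof
  fix x assume x: "x \<in> A"
  obtain C where C: "C \<subseteq> A" "independent C" "A \<subseteq> span C" "card C = dim A"
    by (rule basis_exists)
  show "x \<in> span B"
  proof (rule ccontr)
    assume nx: "x \<notin> span B"
    then have "independent (insert x B)" using assms(3) by (simp add: independent_insert)
    moreover have "insert x B \<subseteq> span C" using x assms(2) C(3) by auto
    ultimately have "card (insert x B) \<le> card C"
      using independent_span_bound[of C "insert x B"] finite_subset[OF C(1) assms(1)] by auto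
    moreover have "card (insert x B) = Suc (card B)"
      using nx span_base[of x B] finite_subset[OF assms(2,1)] by (intro card_insert_disjoint) auto
    ultimately show False using C(4) assms(4) by simp
  qed
qed

text \<open>Padded by zero beyond \<open>N\<close>, as in \<open>jacobian_rank\<close>, so that
  gradients are vectors for \<open>fscale\<close>.\<close>

definition gradient :: "nat \<Rightarrow> (nat \<Rightarrow> complex) \<Rightarrow> ((nat \<Rightarrow> complex) \<Rightarrow> complex) \<Rightarrow> nat \<Rightarrow> complex" where
  "gradient N q f = (\<lambda>i. if i < N then pd i f q else 0)"

lemma jacobian_rank_gradient: "jacobian_rank N F p = vector_space.dim fscale (gradient N p ` F)"
  unfolding jacobian_rank_def gradient_def pd_def ..

text \<open>Gaussian elimination on the rows of the Jacobian matrix with the denominators cleared: up to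
  the factor \<open>D\<close>, the matrix \<open>P\<close> is a projection onto the common kernel of the gradients of \<open>H\<close>.\<close>
definition kernel_projection ::
    "nat \<Rightarrow> (nat \<Rightarrow> complex) \<Rightarrow> ((nat \<Rightarrow> complex) \<Rightarrow> complex) set \<Rightarrow> ((nat \<Rightarrow> complex) \<Rightarrow> complex) set \<Rightarrow>
     ((nat \<Rightarrow> complex) \<Rightarrow> complex) \<Rightarrow> (nat \<Rightarrow> nat \<Rightarrow> (nat \<Rightarrow> complex) \<Rightarrow> complex) \<Rightarrow>
     (nat \<Rightarrow> ((nat \<Rightarrow> complex) \<Rightarrow> complex) \<Rightarrow> (nat \<Rightarrow> complex) \<Rightarrow> complex) \<Rightarrow> bool" where
  "kernel_projection N p G H D P c \<longleftrightarrow>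
     H \<subseteq> G \<and> D \<in> poly_funs N \<and> D p \<noteq> 0 \<and> (\<forall>i<N. \<forall>j<N. P i j \<in> poly_funs N) \<and>
     (\<forall>i<N. \<forall>f\<in>H. c i f \<in> poly_funs N) \<and>
     (\<forall>q. \<forall>i<N. \<forall>j<N. (if i = j then D q else 0) = P i j q + (\<Sum>f\<in>H. c i f q * pd j f q)) \<and>
     (\<forall>q. \<forall>f\<in>H. \<forall>j<N. (\<Sum>i<N. pd i f q * P i j q) = 0) \<and>
     (\<forall>q. D q \<noteq> 0 \<longrightarrow> \<not> module.dependent fscale (gradient N q ` H) \<and> inj_on (gradient N q) H) \<and>
     (\<forall>f\<in>G. \<forall>j<N. (\<Sum>i<N. pd i f p * P i j p) = 0)"

text \<open>Being annihilated by column \<open>j\<close> of \<open>P\<close> is a linear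
  condition.\<close>

lemma kernel_projection_span:
  assumes H: "\<And>f. f \<in> H \<Longrightarrow> \<forall>j<N. (\<Sum>i<N. pd i f q * P i j q) = 0"
    and v: "v \<in> module.span fscale (gradient N q ` H)" and j: "j < N"
  shows "(\<Sum>i<N. v i * P i j q) = 0"
proof -
  interpret fs: vector_space fscale by (rule fscale_vector_space)
  have "fs.subspace {v. (\<Sum>i<N. v i * P i j q) = 0}"
    unfolding fs.subspace_def
    by (auto simp: algebra_simps sum.distrib sum_distrib_left[symmetric])
  moreover have "gradient N q ` H \<subseteq> {v. (\<Sum>i<N. v i * P i j q) = 0}"
    using H j by (auto simp: gradient_def)
  ultimately have "fs.span (gradient N q ` H) \<subseteq> {v. (\<Sum>i<N. v i * P i j q) = 0}"
    by (intro fs.span_minimal)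
  then show ?thesis using v by auto
qed

text \<open>Equations are added one at a time. Multiplying the new gradient by \<open>P\<close>
  gives a row \<open>w\<close>; if it vanishes at \<open>p\<close>, the equation is left out of
  \<open>H\<close>, otherwise an entry of \<open>w\<close> that is nonzero at \<open>p\<close>
  serves as pivot.\<close>

lemma kernel_projection_exists:
  assumes "finite G" "G \<subseteq> poly_funs N"
  shows "\<exists>H D P c. kernel_projection N p G H D P c"
  using assms
proof (induction G rule: finite_induct)
  case empty
  interpret fs: vector_space fscale by (rule fscale_vector_space)
  \<comment> \<open>Without equations the kernel is everything: the identity matrix with denominator
    1.\<close>
  have "kernel_projection N p {} {} (\<lambda>q. 1) (\<lambda>i j q. if i = j then 1 else 0) (\<lambda>i f q. 0)"
    unfolding kernel_projection_def by (auto simp: poly_funs.const fs.independent_empty)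
  then show ?case by blast
next
  case (insert f G)
  interpret fs: vector_space fscale by (rule fscale_vector_space)
  have f: "f \<in> poly_funs N" using insert by auto
  obtain H D P c where K: "kernel_projection N p G H D P c" using insert by auto
  then have H: "H \<subseteq> G" and D: "D \<in> poly_funs N" "D p \<noteq> 0"
    and P: "\<And>i j. i < N \<Longrightarrow> j < N \<Longrightarrow> P i j \<in> poly_funs N"
    and c: "\<And>i f. i < N \<Longrightarrow> f \<in> H \<Longrightarrow> c i f \<in> poly_funs N"
    and split: "\<And>q i j. i < N \<Longrightarrow> j < N \<Longrightarrow>
      (if i = j then D q else 0) = P i j q + (\<Sum>f\<in>H. c i f q * pd j f q)"
    and ker: "\<And>q f j. f \<in> H \<Longrightarrow> j < N \<Longrightarrow> (\<Sum>i<N. pd i f q * P i j q) = 0"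
    and ind: "\<And>q. D q \<noteq> 0 \<Longrightarrow> fs.independent (gradient N q ` H)" "\<And>q. D q \<noteq> 0 \<Longrightarrow> inj_on (gradient N q) H"
    and kerp: "\<And>f j. f \<in> G \<Longrightarrow> j < N \<Longrightarrow> (\<Sum>i<N. pd i f p * P i j p) = 0"
    unfolding kernel_projection_def by blast+
  have finH: "finite H" using H insert.hyps(1) finite_subset by blast
  have fH: "f \<notin> H" using H insert.hyps(2) by auto
  define w where "w j q = (\<Sum>i<N. pd i f q * P i j q)" for j q
  show ?case
  proof (cases "\<forall>j<N. w j p = 0")
    case True
    then have "kernel_projection N p (insert f G) H D P c"
      using K unfolding kernel_projection_def w_def by auto
    then show ?thesis by blast
  next
    case False
    then obtain k where k: "k < N" "w k p \<noteq> 0" by auto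
    have w: "w j \<in> poly_funs N" if "j < N" for j
      unfolding w_def by (intro poly_funs_sum poly_funs.mult pd_closed f P that) auto
    \<comment> \<open>\<open>P'\<close> is w_k P minus column k of \<open>P\<close> times the row
      \<open>w\<close>. Multiplied by the new gradient, this gives w_k w_j - w_k w_j = 0, while the
      rows from \<open>H\<close> stay annihilated. \<open>D'\<close> and \<open>c'\<close> are what
      the splitting identity then asks for.\<close>
    define D' where "D' q = D q * w k q" for q
    define P' where "P' i j q = w k q * P i j q - P i k q * w j q" for i j q
    define c' where "c' i g q = (if g = f then P i k q * D q
      else w k q * c i g q - P i k q * (\<Sum>l<N. pd l f q * c l g q))" for i g q
    \<comment> \<open>Multiplying the splitting identity by the gradient of \<open>f\<close> writes
      \<open>w\<close> as a combination of gradients; this turns the correction of \<open>P\<close>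
      into the coefficients \<open>c'\<close>.\<close>
    have w_split: "w j q = D q * pd j f q - (\<Sum>g\<in>H. (\<Sum>l<N. pd l f q * c l g q) * pd j g q)"
      if j: "j < N" for j q
    proof -
      have "D q * pd j f q = (\<Sum>l<N. pd l f q * (if l = j then D q else 0))"
        using j by (simp add: if_distrib[of "\<lambda>x. _ * x"] cong: if_cong)
      also have "\<dots> = (\<Sum>l<N. pd l f q * P l j q + pd l f q * (\<Sum>g\<in>H. c l g q * pd j g q))"
        by (rule sum.cong[OF refl]) (use j in \<open>simp add: split distrib_left\<close>)
      also have "\<dots> = w j q + (\<Sum>l<N. \<Sum>g\<in>H. pd l f q * c l g q * pd j g q)"
        by (simp add: sum.distrib w_def sum_distrib_left mult.assoc)
      also have "(\<Sum>l<N. \<Sum>g\<in>H. pd l f q * c l g q * pd j g q) =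
          (\<Sum>g\<in>H. (\<Sum>l<N. pd l f q * c l g q) * pd j g q)"
        by (subst sum.swap) (simp add: sum_distrib_right)
      finally show ?thesis by simp
    qed
    have P'_apply: "(\<Sum>i<N. pd i g q * P' i j q) =
        w k q * (\<Sum>i<N. pd i g q * P i j q) - (\<Sum>i<N. pd i g q * P i k q) * w j q" for g j q
      by (simp add: P'_def right_diff_distrib sum_subtractf sum_distrib_left sum_distrib_right mult.assoc
          mult.left_commute)
    have "kernel_projection N p (insert f G) (insert f H) D' P' c'"
      unfolding kernel_projection_def
    proof (intro conjI allI impI ballI)
      show "insert f H \<subseteq> insert f G" using H by auto
      show "D' \<in> poly_funs N" unfolding D'_def[abs_def] by (intro poly_funs.mult D(1) w k(1))
      show "D' p \<noteq> 0" using D(2) k(2) by (simp add: D'_def)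
      show "P' i j \<in> poly_funs N" if "i < N" "j < N" for i j
        unfolding P'_def[abs_def] using that k(1) by (intro poly_funs_diff poly_funs.mult w P)
      show "c' i g \<in> poly_funs N" if "i < N" "g \<in> insert f H" for i g
      proof (cases "g = f")
        case True
        then show ?thesis
          unfolding c'_def[abs_def] using that k(1) D(1) P by (simp add: poly_funs.mult)
      next
        case False
        then have "g \<in> H" using that by simp
        then have "(\<lambda>q. w k q * c i g q - P i k q * (\<Sum>l<N. pd l f q * c l g q)) \<in> poly_funs N"
          using that k(1) by (intro poly_funs_diff poly_funs.mult poly_funs_sum pd_closed w P c f) auto
        then show ?thesis unfolding c'_def[abs_def] using False by simp
      qed
      show "(if i = j then D' q else 0) = P' i j q + (\<Sum>g\<in>insert f H. c' i g q * pd j g q)"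
        if ij: "i < N" "j < N" for q i j
      proof -
        have "(\<Sum>g\<in>insert f H. c' i g q * pd j g q) = P i k q * D q * pd j f q + (\<Sum>g\<in>H. c' i g q * pd j g q)"
          using finH fH by (simp add: c'_def)
        also have "(\<Sum>g\<in>H. c' i g q * pd j g q) =
          (\<Sum>g\<in>H. w k q * (c i g q * pd j g q) - P i k q * ((\<Sum>l<N. pd l f q * c l g q) * pd j g q))"
          using fH by (intro sum.cong refl) (auto simp: c'_def algebra_simps)
        also have "\<dots> = w k q * (\<Sum>g\<in>H. c i g q * pd j g q) -
            P i k q * (\<Sum>g\<in>H. (\<Sum>l<N. pd l f q * c l g q) * pd j g q)"
          by (simp add: sum_subtractf sum_distrib_left)
        also have "(\<Sum>g\<in>H. c i g q * pd j g q) = (if i = j then D q else 0) - P i j q"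
          using split[OF ij, of q] by simp
        also have "(\<Sum>g\<in>H. (\<Sum>l<N. pd l f q * c l g q) * pd j g q) = D q * pd j f q - w j q"
          using w_split[OF ij(2), of q] by simp
        finally show ?thesis by (simp add: P'_def D'_def algebra_simps)
      qed
      show "(\<Sum>i<N. pd i g q * P' i j q) = 0" if "g \<in> insert f H" "j < N" for q g j
      proof (cases "g = f")
        case True
        show ?thesis unfolding True P'_apply w_def[symmetric] by simp
      next
        case False
        then show ?thesis unfolding P'_apply using that k(1) by (simp add: ker)
      qed
      show "(\<Sum>i<N. pd i g p * P' i j p) = 0" if "g \<in> insert f G" "j < N" for g j
      proof (cases "g = f")
        case True
        show ?thesis unfolding True P'_apply w_def[symmetric] by simp
      next
        case False
        then show ?thesis unfolding P'_apply using that k(1) by (simp add: kerp)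
      qed
      fix q assume "D' q \<noteq> 0"
      then have q: "D q \<noteq> 0" "w k q \<noteq> 0" by (auto simp: D'_def)
      \<comment> \<open>Column \<open>k\<close> of \<open>P\<close> kills the span of the old
        gradients, but on the new one it gives w_k, which is nonzero wherever \<open>D'\<close>
        is.\<close>
      have "gradient N q f \<notin> fs.span (gradient N q ` H)"
      proof
        assume "gradient N q f \<in> fs.span (gradient N q ` H)"
        then have "(\<Sum>i<N. gradient N q f i * P i k q) = 0"
          using ker k(1) by (intro kernel_projection_span[where H = H]) auto
        then show False using q(2) by (simp add: w_def gradient_def)
      qed
      moreover from this have "gradient N q f \<notin> gradient N q ` H"
        by (rule contra_subsetD[OF fs.span_superset])
      ultimately show "fs.independent (gradient N q ` insert f H)" "inj_on (gradient N q) (insert f H)"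
        using ind[OF q(1)] fH by (auto simp: fs.independent_insert)
    qed
    then show ?thesis by blast
  qed
qed

text \<open>At \<open>p\<close> the splitting identity puts every gradient of \<open>F\<close> into
  the span of those of \<open>H\<close>, so \<open>r = card H\<close>. At points of \<open>Y\<close>
  with \<open>D\<close> nonzero the gradients of \<open>H\<close> stay independent, and by constancy
  of the rank they still span; hence \<open>P\<close>, which kills them, kills all gradients of
  \<open>F\<close>.\<close>

lemma constant_rank_projection:
  assumes F: "finite F" "F \<subseteq> poly_funs N" and p: "p \<in> Y"
    and rank: "\<And>q. q \<in> Y \<Longrightarrow> jacobian_rank N F q = r"
  obtains H D P c where "H \<subseteq> F" "D \<in> poly_funs N" "D p \<noteq> 0"
    "\<And>i j. i < N \<Longrightarrow> j < N \<Longrightarrow> P i j \<in> poly_funs N" "\<And>i f. i < N \<Longrightarrow> f \<in> H \<Longrightarrow> c i f \<in> poly_funs N"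
    "\<And>q i j. i < N \<Longrightarrow> j < N \<Longrightarrow> (if i = j then D q else 0) = P i j q + (\<Sum>f\<in>H. c i f q * pd j f q)"
    "\<And>q f j. q \<in> Y \<Longrightarrow> D q \<noteq> 0 \<Longrightarrow> f \<in> F \<Longrightarrow> j < N \<Longrightarrow> dir_deriv N (\<lambda>i. P i j q) f q = 0"
proof -
  interpret fs: vector_space fscale by (rule fscale_vector_space)
  obtain H D P c where K: "kernel_projection N p F H D P c"
    using kernel_projection_exists[OF F] by blast
  then have H: "H \<subseteq> F" and D: "D \<in> poly_funs N" "D p \<noteq> 0"
    and P: "\<And>i j. i < N \<Longrightarrow> j < N \<Longrightarrow> P i j \<in> poly_funs N"
    and c: "\<And>i f. i < N \<Longrightarrow> f \<in> H \<Longrightarrow> c i f \<in> poly_funs N"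
    and split: "\<And>q i j. i < N \<Longrightarrow> j < N \<Longrightarrow>
      (if i = j then D q else 0) = P i j q + (\<Sum>f\<in>H. c i f q * pd j f q)"
    and ker: "\<And>q f j. f \<in> H \<Longrightarrow> j < N \<Longrightarrow> (\<Sum>i<N. pd i f q * P i j q) = 0"
    and ind: "\<And>q. D q \<noteq> 0 \<Longrightarrow> fs.independent (gradient N q ` H)" "\<And>q. D q \<noteq> 0 \<Longrightarrow> inj_on (gradient N q) H"
    and kerp: "\<And>f j. f \<in> F \<Longrightarrow> j < N \<Longrightarrow> (\<Sum>i<N. pd i f p * P i j p) = 0"
    unfolding kernel_projection_def by blast+
  have finH: "finite H" using H F(1) finite_subset by blast
  have "gradient N p f \<in> fs.span (gradient N p ` H)" if f: "f \<in> F" for f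
  proof -
    have D_grad: "D p * pd j f p = (\<Sum>g\<in>H. (\<Sum>l<N. pd l f p * c l g p) * pd j g p)" if j: "j < N" for j
    proof -
      have "D p * pd j f p = (\<Sum>l<N. pd l f p * (if l = j then D p else 0))"
        using j by (simp add: if_distrib[of "\<lambda>x. _ * x"] cong: if_cong)
      also have "\<dots> = (\<Sum>l<N. pd l f p * P l j p + pd l f p * (\<Sum>g\<in>H. c l g p * pd j g p))"
        by (rule sum.cong[OF refl]) (use j in \<open>simp add: split distrib_left\<close>)
      also have "\<dots> = (\<Sum>l<N. \<Sum>g\<in>H. pd l f p * c l g p * pd j g p)"
        using kerp[OF f j] by (simp add: sum.distrib sum_distrib_left mult.assoc)
      also have "\<dots> = (\<Sum>g\<in>H. (\<Sum>l<N. pd l f p * c l g p) * pd j g p)"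
        by (subst sum.swap) (simp add: sum_distrib_right)
      finally show ?thesis .
    qed
    \<comment> \<open>Dividing by \<open>D p\<close> is possible here because only values at the
      single point \<open>p\<close> occur.\<close>
    define e where "e g = (\<Sum>l<N. pd l f p * c l g p) / D p" for g
    have sum_apply: "(\<Sum>g\<in>A. fscale (e g) (gradient N p g)) i = (\<Sum>g\<in>A. e g * gradient N p g i)" for A i
      by (induction A rule: infinite_finite_induct) auto
    have "gradient N p f = (\<Sum>g\<in>H. fscale (e g) (gradient N p g))"
    proof
      fix j
      show "gradient N p f j = (\<Sum>g\<in>H. fscale (e g) (gradient N p g)) j"
      proof (cases "j < N")
        case True
        have "pd j f p = (\<Sum>g\<in>H. (\<Sum>l<N. pd l f p * c l g p) * pd j g p) / D p"
          using D_grad[OF True] D(2) by (simp add: field_simps)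
        then show ?thesis
          unfolding sum_apply using True by (simp add: gradient_def e_def sum_divide_distrib[of _ H])
      next
        case False
        then show ?thesis unfolding sum_apply by (simp add: gradient_def)
      qed
    qed
    then show ?thesis by (simp add: fs.span_sum fs.span_scale fs.span_base)
  qed
  then have sub: "gradient N p ` F \<subseteq> fs.span (gradient N p ` H)" by auto
  have "fs.span (gradient N p ` H) = fs.span (gradient N p ` F)"
  proof (rule antisym)
    show "fs.span (gradient N p ` H) \<subseteq> fs.span (gradient N p ` F)" using H by (intro fs.span_mono image_mono)
    show "fs.span (gradient N p ` F) \<subseteq> fs.span (gradient N p ` H)"
      using sub by (simp add: fs.span_minimal fs.subspace_span)
  qed
  from fs.dim_eq_card[OF this ind(1)[OF D(2)]] have "r = card (gradient N p ` H)"
    using rank[OF p] by (simp add: jacobian_rank_gradient)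
  then have r: "r = card H" using card_image[OF ind(2)[OF D(2)]] by simp
  have "dir_deriv N (\<lambda>i. P i j q) f q = 0" if q: "q \<in> Y" "D q \<noteq> 0" and f: "f \<in> F" and j: "j < N" for q f j
  proof -
    have "card (gradient N q ` H) = fs.dim (gradient N q ` F)"
      using rank[OF q(1)] card_image[OF ind(2)[OF q(2)]] r by (simp add: jacobian_rank_gradient)
    then have "gradient N q ` F \<subseteq> fs.span (gradient N q ` H)"
      using F(1) H ind(1)[OF q(2)] by (intro fs.subset_span_of_card_eq_dim) auto
    then have "(\<Sum>i<N. gradient N q f i * P i j q) = 0"
      using f j ker by (intro kernel_projection_span[where H = H]) auto
    then show ?thesis by (simp add: dir_deriv_def gradient_def)
  qed
  with H D P c split show ?thesis by (rule that)
qed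

section \<open>Affine coordinates on open sets and on stalks\<close>

section \<open>Affine charts\<close>

lemma derivation_comp:
  assumes "plain_module R P" "plain_module R Q" "derivation R k P \<delta>" "linear_map R P Q f"
  shows "derivation R k Q (\<lambda>a. f (\<delta> a))"
proof (rule derivationI)
  interpret P: plain_module R P by fact
  note d = derivationD[OF assms(3)]
  show "f (\<delta> c) = \<zero>\<^bsub>Q\<^esub>" if "c \<in> k" for c
    unfolding d(4)[OF that] by (rule linear_map_zero[OF assms(1,2,4)])
qed (simp_all add: derivationD[OF assms(3)] linear_mapD[OF assms(4)] module.smult_closed[OF plain_module.axioms[OF assms(1)]])

lemma linear_map_finsum_maps:
  assumes P: "plain_module R P" and Q: "plain_module R Q"
    and f: "\<And>j. j < n \<Longrightarrow> linear_map R P Q (f j)"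
  shows "linear_map R P Q (\<lambda>x. finsum Q (\<lambda>j. f j x) {..<n::nat})"
proof (rule linear_mapI)
  interpret P: plain_module R P by (rule P)
  interpret Q: plain_module R Q by (rule Q)
  fix x assume x: "x \<in> carrier P"
  have c: "f j y \<in> carrier Q" if "j < n" "y \<in> carrier P" for j y
    by (rule linear_map_closed[OF f[OF that(1)] that(2)])
  show "finsum Q (\<lambda>j. f j x) {..<n} \<in> carrier Q"
    using c x by (intro Q.finsum_closed) auto
  show "finsum Q (\<lambda>j. f j (x \<oplus>\<^bsub>P\<^esub> y)) {..<n} =
      finsum Q (\<lambda>j. f j x) {..<n} \<oplus>\<^bsub>Q\<^esub> finsum Q (\<lambda>j. f j y) {..<n}" if y: "y \<in> carrier P" for y
  proof -
    have "finsum Q (\<lambda>j. f j (x \<oplus>\<^bsub>P\<^esub> y)) {..<n} = finsum Q (\<lambda>j. f j x \<oplus>\<^bsub>Q\<^esub> f j y) {..<n}"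
      using c x y by (intro Q.finsum_cong') (auto simp: linear_map_add[OF f])
    also have "\<dots> = finsum Q (\<lambda>j. f j x) {..<n} \<oplus>\<^bsub>Q\<^esub> finsum Q (\<lambda>j. f j y) {..<n}"
      using c x y by (intro Q.finsum_addf) auto
    finally show ?thesis .
  qed
  show "finsum Q (\<lambda>j. f j (r \<odot>\<^bsub>P\<^esub> x)) {..<n} = r \<odot>\<^bsub>Q\<^esub> finsum Q (\<lambda>j. f j x) {..<n}"
    if r: "r \<in> carrier R" for r
  proof -
    have "finsum Q (\<lambda>j. f j (r \<odot>\<^bsub>P\<^esub> x)) {..<n} = finsum Q (\<lambda>j. r \<odot>\<^bsub>Q\<^esub> f j x) {..<n}"
      using c x r by (intro Q.finsum_cong') (auto simp: linear_map_smult[OF f])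
    also have "\<dots> = r \<odot>\<^bsub>Q\<^esub> finsum Q (\<lambda>j. f j x) {..<n}"
      using c x r by (intro Q.finsum_smult_ldistr[symmetric]) auto
    finally show ?thesis .
  qed
qed

lemma topspace_zariski: "topspace (zariski N) = affine_space N"
proof -
  have "{p \<in> affine_space N. (\<lambda>p. 1 :: complex) p \<noteq> 0} \<in> {{p \<in> affine_space N. f p \<noteq> 0} | f. f \<in> poly_funs N}"
    by (intro CollectI exI[of _ "\<lambda>p. 1"] conjI poly_funs.const refl)
  then have "affine_space N \<in> {{p \<in> affine_space N. f p \<noteq> 0} | f. f \<in> poly_funs N}" by simp
  then show ?thesis unfolding zariski_def topology_generated_by_topspace by auto
qed

text \<open>Nonvanishing loci of polynomials are closed under finite intersection, by taking
  products, so the generating family is a basis.\<close>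

lemma zariski_basis:
  assumes "openin (zariski N) T" "p \<in> T"
  obtains R where "R \<in> poly_funs N" "R p \<noteq> 0" "\<And>q. q \<in> affine_space N \<Longrightarrow> R q \<noteq> 0 \<Longrightarrow> q \<in> T"
proof -
  have "generate_topology_on {{p \<in> affine_space N. f p \<noteq> 0} | f. f \<in> poly_funs N} T"
    using assms(1) unfolding zariski_def by (rule openin_topology_generated_by)
  then have "\<forall>p\<in>T. \<exists>R\<in>poly_funs N. R p \<noteq> 0 \<and> (\<forall>q\<in>affine_space N. R q \<noteq> 0 \<longrightarrow> q \<in> T)"
  proof induction
    case (Int A B)
    show ?case
    proof
      fix p assume p: "p \<in> A \<inter> B"
      obtain R where R: "R \<in> poly_funs N" "R p \<noteq> 0" "\<forall>q\<in>affine_space N. R q \<noteq> 0 \<longrightarrow> q \<in> A"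
        using Int.IH(1) p by blast
      obtain S where S: "S \<in> poly_funs N" "S p \<noteq> 0" "\<forall>q\<in>affine_space N. S q \<noteq> 0 \<longrightarrow> q \<in> B"
        using Int.IH(2) p by blast
      show "\<exists>R\<in>poly_funs N. R p \<noteq> 0 \<and> (\<forall>q\<in>affine_space N. R q \<noteq> 0 \<longrightarrow> q \<in> A \<inter> B)"
        by (rule bexI[OF _ poly_funs.mult[OF R(1) S(1)]]) (use R S in auto)
    qed
  next
    case (UN K)
    then show ?case by blast
  next
    case (Basis s)
    then show ?case by auto
  qed auto
  with assms(2) that show ?thesis by blast
qed

locale chart = sheaf_of_functions X for X :: "'a fspace" +
  fixes U N Y \<phi>
  assumes chart: "affine_chart X U N Y \<phi>"
begin

lemma open_domain: "opn U"
  using chart by (simp add: affine_chart_def)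

lemma image_affine: "Y \<subseteq> affine_space N"
  using chart unfolding affine_chart_def algebraic_set_def by auto

lemma topspaces:
  "topspace (zar (open_fsubspace X U)) = U" "topspace (zar (affine_fspace N Y)) = Y"
  using openin_subset[OF open_domain] image_affine
  by (auto simp: open_fsubspace_def affine_fspace_def topspace_zariski)

lemma openin_domain: "openin (zar (open_fsubspace X U)) W \<longleftrightarrow> opn W \<and> W \<subseteq> U"
  using openin_open_subtopology[OF open_domain] by (simp add: open_fsubspace_def)

text \<open>An inverse is only asserted to exist in \<open>fspace_iso\<close>; one is fixed so that
  functions and open sets can be transported to the affine model.\<close>

definition inverse_chart :: "(nat \<Rightarrow> complex) \<Rightarrow> 'a" where
  "inverse_chart = (SOME \<psi>. fspace_morphism (affine_fspace N Y) (open_fsubspace X U) \<psi> \<and>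
     (\<forall>x\<in>U. \<psi> (\<phi> x) = x) \<and> (\<forall>y\<in>Y. \<phi> (\<psi> y) = y))"

lemma chart_morphism: "fspace_morphism (open_fsubspace X U) (affine_fspace N Y) \<phi>"
  using chart by (simp add: affine_chart_def fspace_iso_def)

lemma inverse_chart:
  "fspace_morphism (affine_fspace N Y) (open_fsubspace X U) inverse_chart"
  "x \<in> U \<Longrightarrow> inverse_chart (\<phi> x) = x" "y \<in> Y \<Longrightarrow> \<phi> (inverse_chart y) = y"
proof -
  have "\<exists>\<psi>. fspace_morphism (affine_fspace N Y) (open_fsubspace X U) \<psi> \<and>
     (\<forall>x\<in>U. \<psi> (\<phi> x) = x) \<and> (\<forall>y\<in>Y. \<phi> (\<psi> y) = y)"
    using chart unfolding affine_chart_def fspace_iso_def topspaces by blast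
  from someI_ex[OF this, folded inverse_chart_def]
  show "fspace_morphism (affine_fspace N Y) (open_fsubspace X U) inverse_chart"
    "x \<in> U \<Longrightarrow> inverse_chart (\<phi> x) = x" "y \<in> Y \<Longrightarrow> \<phi> (inverse_chart y) = y" by auto
qed

lemma chart_closed: "x \<in> U \<Longrightarrow> \<phi> x \<in> Y"
  using chart_morphism unfolding fspace_morphism_def continuous_map_def topspaces by auto

lemma inverse_chart_closed: "y \<in> Y \<Longrightarrow> inverse_chart y \<in> U"
  using inverse_chart(1) unfolding fspace_morphism_def continuous_map_def topspaces by auto

lemma chart_vimage_open:
  assumes "openin (zar (affine_fspace N Y)) V"
  shows "opn {x \<in> U. \<phi> x \<in> V}"
  using openin_continuous_map_preimage[of _ _ \<phi>, OF _ assms] chart_morphism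
  unfolding fspace_morphism_def by (metis openin_domain topspaces(1))

lemma chart_pullback:
  assumes "openin (zar (affine_fspace N Y)) V" "f \<in> reg (affine_fspace N Y) V"
  shows "(\<lambda>x\<in>{x \<in> U. \<phi> x \<in> V}. f (\<phi> x)) \<in> reg X {x \<in> U. \<phi> x \<in> V}"
  using chart_morphism assms unfolding fspace_morphism_def topspaces by (simp add: open_fsubspace_def)

lemma basic_open: "f \<in> poly_funs N \<Longrightarrow> openin (zar (affine_fspace N Y)) {p \<in> Y. f p \<noteq> 0}"
proof -
  assume f: "f \<in> poly_funs N"
  have "openin (zariski N) {p \<in> affine_space N. f p \<noteq> 0}"
    unfolding zariski_def by (rule topology_generated_by_Basis) (use f in blast)
  then have "openin (subtopology (zariski N) Y) (Y \<inter> {p \<in> affine_space N. f p \<noteq> 0})"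
    by (rule openin_subtopology_Int2)
  moreover have "Y \<inter> {p \<in> affine_space N. f p \<noteq> 0} = {p \<in> Y. f p \<noteq> 0}" using image_affine by auto
  ultimately show ?thesis by (simp add: affine_fspace_def)
qed

lemma nonvanishing_open:
  assumes "f \<in> poly_funs N"
  shows "opn {x \<in> U. f (\<phi> x) \<noteq> 0}"
proof -
  have "{x \<in> U. f (\<phi> x) \<noteq> 0} = {x \<in> U. \<phi> x \<in> {p \<in> Y. f p \<noteq> 0}}" using chart_closed by auto
  then show ?thesis using chart_vimage_open[OF basic_open[OF assms]] by simp
qed

text \<open>The quotient is regular on the affine model where the denominator is nonzero; pull it
  back and restrict.\<close>

lemma fraction_regular:
  assumes f: "f \<in> poly_funs N" and g: "g \<in> poly_funs N"
    and W: "opn W" "W \<subseteq> U" "\<And>y. y \<in> W \<Longrightarrow> g (\<phi> y) \<noteq> 0"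
  shows "(\<lambda>y\<in>W. f (\<phi> y) / g (\<phi> y)) \<in> reg X W"
proof -
  let ?V = "{p \<in> Y. g p \<noteq> 0}" and ?W = "{x \<in> U. \<phi> x \<in> {p \<in> Y. g p \<noteq> 0}}"
  have "(\<lambda>p\<in>?V. f p / g p) \<in> reg (affine_fspace N Y) ?V"
    unfolding affine_fspace_def fspace.simps
  proof (intro CollectI conjI ballI)
    fix p assume p: "p \<in> ?V"
    have "openin (subtopology (zariski N) Y) ?V" using basic_open[OF g] by (simp add: affine_fspace_def)
    then show "\<exists>V. openin (subtopology (zariski N) Y) V \<and> p \<in> V \<and> V \<subseteq> ?V \<and>
        (\<exists>g'\<in>poly_funs N. \<exists>h\<in>poly_funs N. \<forall>q\<in>V. h q \<noteq> 0 \<and> (\<lambda>p\<in>?V. f p / g p) q = g' q / h q)"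
      using p f g by (intro exI[of _ ?V] conjI bexI[of _ f] bexI[of _ g]) auto
  qed simp
  then have "(\<lambda>x\<in>?W. (\<lambda>p\<in>?V. f p / g p) (\<phi> x)) \<in> reg X ?W"
    by (rule chart_pullback[OF basic_open[OF g]])
  moreover have WW: "opn ?W" by (rule chart_vimage_open[OF basic_open[OF g]])
  moreover have sub: "W \<subseteq> ?W" using W chart_closed by auto
  ultimately have "restrict (\<lambda>x\<in>?W. (\<lambda>p\<in>?V. f p / g p) (\<phi> x)) W \<in> reg X W"
    using reg_restrict W(1) by blast
  moreover have "restrict (\<lambda>x\<in>?W. (\<lambda>p\<in>?V. f p / g p) (\<phi> x)) W = (\<lambda>y\<in>W. f (\<phi> y) / g (\<phi> y))"
    by (rule restrict_ext) (use sub in auto)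
  ultimately show ?thesis by simp
qed

lemma polynomial_regular:
  "f \<in> poly_funs N \<Longrightarrow> opn W \<Longrightarrow> W \<subseteq> U \<Longrightarrow> (\<lambda>y\<in>W. f (\<phi> y)) \<in> reg X W"
  using fraction_regular[of f "\<lambda>p. 1" W] by (simp add: poly_funs.const)

text \<open>Transport \<open>h\<close> to the affine model by \<open>inverse_chart\<close>, take the
  fraction that regularity provides there, and pull its neighbourhood back.\<close>

lemma locally_fraction:
  assumes W: "opn W" "W \<subseteq> U" and h: "h \<in> reg X W" and y: "y \<in> W"
  obtains V P Q where "opn V" "y \<in> V" "V \<subseteq> W" "P \<in> poly_funs N" "Q \<in> poly_funs N"
    "\<And>z. z \<in> V \<Longrightarrow> Q (\<phi> z) \<noteq> 0" "\<And>z. z \<in> V \<Longrightarrow> h z = P (\<phi> z) / Q (\<phi> z)"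
proof -
  let ?T = "{q \<in> Y. inverse_chart q \<in> W}"
  have hW: "openin (zar (open_fsubspace X U)) W \<and> h \<in> reg (open_fsubspace X U) W"
    using W h by (simp add: openin_domain) (simp add: open_fsubspace_def)
  have "(\<lambda>q\<in>?T. h (inverse_chart q)) \<in> reg (affine_fspace N Y) ?T"
    using inverse_chart(1) hW unfolding fspace_morphism_def topspaces by blast
  then have loc: "\<forall>p\<in>?T. \<exists>V. openin (subtopology (zariski N) Y) V \<and> p \<in> V \<and> V \<subseteq> ?T \<and>
      (\<exists>g\<in>poly_funs N. \<exists>k\<in>poly_funs N. \<forall>q\<in>V. k q \<noteq> 0 \<and> (\<lambda>q\<in>?T. h (inverse_chart q)) q = g q / k q)"
    unfolding affine_fspace_def fspace.simps by blast
  have yU: "y \<in> U" using y W by auto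
  then have "\<phi> y \<in> ?T" using y inverse_chart(2) chart_closed by auto
  from bspec[OF loc this] obtain V P Q where V: "openin (subtopology (zariski N) Y) V" "\<phi> y \<in> V" "V \<subseteq> ?T"
    and PQ: "P \<in> poly_funs N" "Q \<in> poly_funs N"
      "\<forall>q\<in>V. Q q \<noteq> 0 \<and> (\<lambda>q\<in>?T. h (inverse_chart q)) q = P q / Q q"
    by (elim exE conjE bexE) (rule that)
  let ?V = "{x \<in> U. \<phi> x \<in> V}"
  show ?thesis
  proof (rule that[of ?V P Q])
    show "opn ?V" using chart_vimage_open V(1) by (simp add: affine_fspace_def)
    show "y \<in> ?V" using yU V(2) by auto
    have *: "\<phi> z \<in> ?T" "inverse_chart (\<phi> z) = z" if "z \<in> ?V" for z
      using that V(3) inverse_chart(2) by auto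
    then show "?V \<subseteq> W" by force
    show "h z = P (\<phi> z) / Q (\<phi> z)" if z: "z \<in> ?V" for z
      using PQ(3) z *[OF z] by force
  qed (use PQ in auto)
qed

text \<open>Such an \<open>R\<close> later serves to cut off functions outside
  \<open>W\<close>.\<close>

lemma open_contains_basic:
  assumes W: "opn W" "W \<subseteq> U" and y: "y \<in> W"
  obtains R where "R \<in> poly_funs N" "R (\<phi> y) \<noteq> 0" "\<And>z. z \<in> U \<Longrightarrow> R (\<phi> z) \<noteq> 0 \<Longrightarrow> z \<in> W"
proof -
  let ?T = "{q \<in> Y. inverse_chart q \<in> W}"
  have "openin (zar (open_fsubspace X U)) W" using W by (simp add: openin_domain)
  then have "openin (zar (affine_fspace N Y)) ?T"
    using openin_continuous_map_preimage[of "zar (affine_fspace N Y)" "zar (open_fsubspace X U)" inverse_chart W]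
      inverse_chart(1) unfolding fspace_morphism_def topspaces by auto
  then obtain T where T: "openin (zariski N) T" "?T = T \<inter> Y"
    unfolding affine_fspace_def fspace.simps openin_subtopology by auto
  have "\<phi> y \<in> ?T" using y W inverse_chart(2) chart_closed by auto
  then have "\<phi> y \<in> T" using T(2) by auto
  with T(1) obtain R where R: "R \<in> poly_funs N" "R (\<phi> y) \<noteq> 0"
    "\<And>q. q \<in> affine_space N \<Longrightarrow> R q \<noteq> 0 \<Longrightarrow> q \<in> T"
    by (rule zariski_basis) (rule that)
  show ?thesis
  proof (rule that[OF R(1,2)])
    fix z assume z: "z \<in> U" "R (\<phi> z) \<noteq> 0"
    then have "\<phi> z \<in> T \<inter> Y" using R(3) chart_closed image_affine by auto
    then have "\<phi> z \<in> ?T" using T(2) by simp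
    then show "z \<in> W" using inverse_chart(2)[OF z(1)] by simp
  qed
qed

text \<open>Different polynomials may give the same germ; \<open>dir_deriv_pgerm\<close> deals with
  this ambiguity.\<close>

definition pgerm :: "'a \<Rightarrow> ((nat \<Rightarrow> complex) \<Rightarrow> complex) \<Rightarrow> 'a germ" where
  "pgerm y f = germ X y U (\<lambda>z\<in>U. f (\<phi> z))"

context
  fixes y
  assumes y: "y \<in> U"
begin

lemma pgerm_closed: "f \<in> poly_funs N \<Longrightarrow> pgerm y f \<in> carrier (stalk X y)"
  unfolding pgerm_def by (rule germ_closed[OF open_domain y polynomial_regular[OF _ open_domain order_refl]])

lemma
  assumes "f \<in> poly_funs N" "g \<in> poly_funs N"
  shows pgerm_add: "pgerm y (\<lambda>p. f p + g p) = pgerm y f \<oplus>\<^bsub>stalk X y\<^esub> pgerm y g"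
    and pgerm_mult: "pgerm y (\<lambda>p. f p * g p) = pgerm y f \<otimes>\<^bsub>stalk X y\<^esub> pgerm y g"
proof -
  note r = polynomial_regular[OF assms(1) open_domain order_refl]
    polynomial_regular[OF assms(2) open_domain order_refl]
  show "pgerm y (\<lambda>p. f p + g p) = pgerm y f \<oplus>\<^bsub>stalk X y\<^esub> pgerm y g"
    unfolding pgerm_def germ_add[OF open_domain y r] by (rule germ_cong[OF open_domain y]) simp
  show "pgerm y (\<lambda>p. f p * g p) = pgerm y f \<otimes>\<^bsub>stalk X y\<^esub> pgerm y g"
    unfolding pgerm_def germ_mult[OF open_domain y r] by (rule germ_cong[OF open_domain y]) simp
qed

lemma pgerm_const: "pgerm y (\<lambda>p. c) = const_germ X y c"
  unfolding pgerm_def const_germ_eq[OF open_domain y] ..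

lemma pgerm_one: "pgerm y (\<lambda>p. 1) = \<one>\<^bsub>stalk X y\<^esub>"
  and pgerm_zero: "pgerm y (\<lambda>p. 0) = \<zero>\<^bsub>stalk X y\<^esub>"
  unfolding pgerm_def stalk_one[OF open_domain y] stalk_zero[OF open_domain y] by simp_all

lemma pgerm_value: "f \<in> poly_funs N \<Longrightarrow> germ_value y (pgerm y f) = f (\<phi> y)"
  unfolding pgerm_def
  using germ_value_germ[OF open_domain y polynomial_regular[OF _ open_domain order_refl]] y by simp

text \<open>Fractions are kept in the form h Q = P, since division is not an operation of the
  stalk.\<close>

lemma germ_fraction:
  assumes W: "opn W" "y \<in> W" "W \<subseteq> U" and PQ: "P \<in> poly_funs N" "Q \<in> poly_funs N"
    and h: "h \<in> reg X W" "\<And>z. z \<in> W \<Longrightarrow> h z * Q (\<phi> z) = P (\<phi> z)"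
  shows "germ X y W h \<otimes>\<^bsub>stalk X y\<^esub> pgerm y Q = pgerm y P"
proof -
  have p: "pgerm y f = germ X y W (\<lambda>z\<in>W. f (\<phi> z))" for f
    unfolding pgerm_def by (rule germ_eqI[of X W]) (use W in auto)
  show ?thesis
    unfolding p germ_mult[OF W(1,2) h(1) polynomial_regular[OF PQ(2) W(1,3)]]
    by (rule germ_cong[OF W(1,2)]) (simp add: h(2))
qed

lemma stalk_fraction:
  assumes "a \<in> carrier (stalk X y)"
  obtains P Q where "P \<in> poly_funs N" "Q \<in> poly_funs N" "Q (\<phi> y) \<noteq> 0"
    "a \<otimes>\<^bsub>stalk X y\<^esub> pgerm y Q = pgerm y P"
proof -
  obtain W h where W: "opn W" "y \<in> W" "W \<subseteq> U" "h \<in> reg X W" "a = germ X y W h"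
    using stalkE2[OF assms assms open_domain y] by metis
  obtain V P Q where V: "opn V" "y \<in> V" "V \<subseteq> W" "P \<in> poly_funs N" "Q \<in> poly_funs N"
    "\<And>z. z \<in> V \<Longrightarrow> Q (\<phi> z) \<noteq> 0" "\<And>z. z \<in> V \<Longrightarrow> h z = P (\<phi> z) / Q (\<phi> z)"
    using W(1,3,4,2) by (rule locally_fraction) (rule that)
  have VU: "V \<subseteq> U" using V W by auto
  have "germ X y V (restrict h V) \<otimes>\<^bsub>stalk X y\<^esub> pgerm y Q = pgerm y P"
    by (rule germ_fraction[OF V(1,2) VU V(4,5) reg_restrict[OF W(1,4) V(1,3)]]) (simp add: V(6,7))
  then have "a \<otimes>\<^bsub>stalk X y\<^esub> pgerm y Q = pgerm y P"
    by (simp only: germ_restrict[OF V(1-3)] W(5))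
  then show ?thesis using that V by blast
qed

lemma pgerm_unit:
  assumes Q: "Q \<in> poly_funs N" "Q (\<phi> y) \<noteq> 0"
  obtains b where "b \<in> carrier (stalk X y)" "b \<otimes>\<^bsub>stalk X y\<^esub> pgerm y Q = \<one>\<^bsub>stalk X y\<^esub>"
proof -
  let ?W = "{x \<in> U. Q (\<phi> x) \<noteq> 0}"
  have W: "opn ?W" "y \<in> ?W" "?W \<subseteq> U" using nonvanishing_open[OF Q(1)] Q(2) y by auto
  have r: "(\<lambda>z\<in>?W. (\<lambda>p. 1) (\<phi> z) / Q (\<phi> z)) \<in> reg X ?W"
    by (rule fraction_regular[OF poly_funs.const Q(1) W(1,3)]) simp
  have "germ X y ?W (\<lambda>z\<in>?W. (\<lambda>p. 1) (\<phi> z) / Q (\<phi> z)) \<otimes>\<^bsub>stalk X y\<^esub> pgerm y Q = pgerm y (\<lambda>p. 1)"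
    by (rule germ_fraction[OF W poly_funs.const Q(1) r]) simp
  then show ?thesis using that germ_closed[OF W(1,2) r] by (simp add: pgerm_one)
qed

end

text \<open>Agreement on coordinates extends to polynomials by the derivation rules, and to
  fractions by applying the Leibniz rule to a Q = A and cancelling the unit Q.\<close>

lemma derivations_agree:
  assumes y: "y \<in> U" and P: "plain_module (stalk X y) P"
    and \<delta>: "derivation (stalk X y) (range (const_germ X y)) P \<delta>"
    and \<epsilon>: "derivation (stalk X y) (range (const_germ X y)) P \<epsilon>"
    and coord: "\<And>i. i < N \<Longrightarrow> \<delta> (pgerm y (\<lambda>p. p i)) = \<epsilon> (pgerm y (\<lambda>p. p i))"
    and a: "a \<in> carrier (stalk X y)"
  shows "\<delta> a = \<epsilon> a"
proof -
  let ?S = "stalk X y"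
  interpret P: plain_module ?S P by (rule P)
  note d = derivationD[OF \<delta>] and e = derivationD[OF \<epsilon>]
  have poly: "\<delta> (pgerm y f) = \<epsilon> (pgerm y f)" if "f \<in> poly_funs N" for f
    using that
  proof induction
    case (const c)
    show ?case unfolding pgerm_const[OF y] by (simp add: d(4) e(4))
  qed (simp_all add: coord pgerm_add[OF y] pgerm_mult[OF y] pgerm_closed[OF y] d e)
  obtain A Q where Q: "A \<in> poly_funs N" "Q \<in> poly_funs N" "Q (\<phi> y) \<noteq> 0"
    "a \<otimes>\<^bsub>?S\<^esub> pgerm y Q = pgerm y A"
    using a by (rule stalk_fraction[OF y]) (rule that)
  obtain b where b: "b \<in> carrier ?S" "b \<otimes>\<^bsub>?S\<^esub> pgerm y Q = \<one>\<^bsub>?S\<^esub>"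
    using Q(2,3) by (rule pgerm_unit[OF y]) (rule that)
  note q = pgerm_closed[OF y Q(2)]
  have "a \<odot>\<^bsub>P\<^esub> \<delta> (pgerm y Q) \<oplus>\<^bsub>P\<^esub> pgerm y Q \<odot>\<^bsub>P\<^esub> \<delta> a =
      a \<odot>\<^bsub>P\<^esub> \<delta> (pgerm y Q) \<oplus>\<^bsub>P\<^esub> pgerm y Q \<odot>\<^bsub>P\<^esub> \<epsilon> a"
    using poly[OF Q(1)] d(3)[OF a q] e(3)[OF a q] by (simp add: Q(4) poly[OF Q(2)])
  then have "pgerm y Q \<odot>\<^bsub>P\<^esub> \<delta> a = pgerm y Q \<odot>\<^bsub>P\<^esub> \<epsilon> a"
    using a q d(1) e(1) by simp
  then have "b \<odot>\<^bsub>P\<^esub> (pgerm y Q \<odot>\<^bsub>P\<^esub> \<delta> a) = b \<odot>\<^bsub>P\<^esub> (pgerm y Q \<odot>\<^bsub>P\<^esub> \<epsilon> a)" by simp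
  then show ?thesis
    using a b q d(1)[OF a] e(1)[OF a] by (simp add: P.smult_assoc1[symmetric])
qed

end

section \<open>Tangent vectors, polynomial vector fields, and the dual basis\<close>

section \<open>Vector fields on smooth varieties\<close>

locale chart_with_equations = chart +
  fixes F
  assumes equations: "ideal_generators N F (vanishing_ideal N Y)"
begin

text \<open>The kernel of the Jacobian matrix at the image point, i.e. the Zariski tangent
  space.\<close>

definition tangent_vector :: "'a \<Rightarrow> (nat \<Rightarrow> complex) \<Rightarrow> bool" where
  "tangent_vector y v \<longleftrightarrow> (\<forall>g\<in>F. dir_deriv N v g (\<phi> y) = 0)"

text \<open>Equal germs say only that h = f - g vanishes on \<open>Y\<close> near the point.
  Multiplying by a polynomial \<open>R\<close> that vanishes on the rest of \<open>Y\<close> puts h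
  R into the vanishing ideal, on which tangent vectors act as zero. Both h and the derivative of h R
  vanish at the point while \<open>R\<close> does not, so the derivative of h is zero.\<close>

lemma dir_deriv_pgerm:
  assumes y: "y \<in> U" and v: "tangent_vector y v"
    and f: "f \<in> poly_funs N" and g: "g \<in> poly_funs N" and eq: "pgerm y f = pgerm y g"
  shows "dir_deriv N v f (\<phi> y) = dir_deriv N v g (\<phi> y)"
proof -
  obtain W where W: "opn W" "y \<in> W" "W \<subseteq> U \<inter> U"
    and fg: "\<And>z. z \<in> W \<Longrightarrow> (\<lambda>z\<in>U. f (\<phi> z)) z = (\<lambda>z\<in>U. g (\<phi> z)) z"
    using eq[unfolded pgerm_def] open_domain y polynomial_regular[OF f open_domain order_refl]
    by (rule germ_eqD) (rule that)
  have WU: "W \<subseteq> U" using W by auto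
  obtain R where R: "R \<in> poly_funs N" "R (\<phi> y) \<noteq> 0" "\<And>z. z \<in> U \<Longrightarrow> R (\<phi> z) \<noteq> 0 \<Longrightarrow> z \<in> W"
    using W(1) WU W(2) by (rule open_contains_basic) (rule that)
  define h where "h = (\<lambda>p. f p - g p)"
  have h: "h \<in> poly_funs N" unfolding h_def by (rule poly_funs_diff[OF f g])
  have h0: "h (\<phi> z) = 0" if "z \<in> W" for z
    using fg[OF that] that WU by (auto simp: h_def)
  have "dir_deriv N v (\<lambda>p. h p * R p) (\<phi> y) = 0"
  proof (rule dir_deriv_vanishing[OF equations _ chart_closed[OF y] poly_funs.mult[OF h R(1)]])
    show "dir_deriv N v g (\<phi> y) = 0" if "g \<in> F" for g using v that by (simp add: tangent_vector_def)
    fix q assume q: "q \<in> Y"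
    show "h q * R q = 0"
    proof (cases "R q = 0")
      case False
      then have "inverse_chart q \<in> W"
        using R(3)[OF inverse_chart_closed[OF q]] inverse_chart(3)[OF q] by simp
      then show ?thesis using h0 inverse_chart(3)[OF q] by force
    qed simp
  qed
  then have "dir_deriv N v h (\<phi> y) = 0"
    using R(2) h0[OF W(2)] by (simp add: dir_deriv_mult[OF h R(1)])
  moreover have "f = (\<lambda>p. h p + g p)" by (simp add: h_def)
  ultimately show ?thesis using dir_deriv_add[OF h g, of v "\<phi> y"] by simp
qed

text \<open>The value on da is dictated by the quotient rule for a = A/Q; the content is that it
  does not depend on the fraction and defines a derivation.\<close>

lemma tangent_functional:
  assumes y: "y \<in> U" and v: "tangent_vector y v"
  obtains e where "linear_map (stalk X y) (Omega_stalk X y) (residue_module y) e"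
    "\<And>a A Q. a \<in> carrier (stalk X y) \<Longrightarrow> A \<in> poly_funs N \<Longrightarrow> Q \<in> poly_funs N \<Longrightarrow> Q (\<phi> y) \<noteq> 0 \<Longrightarrow>
      a \<otimes>\<^bsub>stalk X y\<^esub> pgerm y Q = pgerm y A \<Longrightarrow>
      e (d_stalk X y a) = (dir_deriv N v A (\<phi> y) - germ_value y a * dir_deriv N v Q (\<phi> y)) / Q (\<phi> y)"
proof -
  let ?S = "stalk X y" and ?D = "\<lambda>f. dir_deriv N v f (\<phi> y)"
  note yX = openin_subset_topspace[OF open_domain y]
  interpret D: differentials ?S "range (const_germ X y)" by (rule stalk_differentials[OF yX])
  note pm = pgerm_mult[OF y] and pa = pgerm_add[OF y] and pc = pgerm_closed[OF y]
    and pv = pgerm_value[OF y] and gv = germ_value_simps[OF yX]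
  define \<delta> where "\<delta> a = (SOME c. \<exists>A\<in>poly_funs N. \<exists>Q\<in>poly_funs N. Q (\<phi> y) \<noteq> 0 \<and>
    a \<otimes>\<^bsub>?S\<^esub> pgerm y Q = pgerm y A \<and> c = (?D A - germ_value y a * ?D Q) / Q (\<phi> y))" for a
  have \<delta>: "\<delta> a = (?D A - germ_value y a * ?D Q) / Q (\<phi> y)"
    if a: "a \<in> carrier ?S" and A: "A \<in> poly_funs N" and Q: "Q \<in> poly_funs N" "Q (\<phi> y) \<noteq> 0"
      and eq: "a \<otimes>\<^bsub>?S\<^esub> pgerm y Q = pgerm y A" for a A Q
    unfolding \<delta>_def
  proof (rule some_equality)
    fix c assume "\<exists>A\<in>poly_funs N. \<exists>Q\<in>poly_funs N. Q (\<phi> y) \<noteq> 0 \<and>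
      a \<otimes>\<^bsub>?S\<^esub> pgerm y Q = pgerm y A \<and> c = (?D A - germ_value y a * ?D Q) / Q (\<phi> y)"
    then obtain B T where B: "B \<in> poly_funs N" and T: "T \<in> poly_funs N" "T (\<phi> y) \<noteq> 0"
      and eq': "a \<otimes>\<^bsub>?S\<^esub> pgerm y T = pgerm y B" and c: "c = (?D B - germ_value y a * ?D T) / T (\<phi> y)"
      by blast
    \<comment> \<open>Cross multiplying two fractions for \<open>a\<close> gives polynomials with
      the same germ, which have equal derivatives along \<open>v\<close>.\<close>
    have "pgerm y (\<lambda>p. A p * T p) = pgerm y (\<lambda>p. B p * Q p)"
      unfolding pm[OF A T(1)] pm[OF B Q(1)] eq[symmetric] eq'[symmetric]
      using a pc[OF T(1)] pc[OF Q(1)] by (simp add: D.m_ac)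
    then have "?D (\<lambda>p. A p * T p) = ?D (\<lambda>p. B p * Q p)"
      by (rule dir_deriv_pgerm[OF y v poly_funs.mult[OF A T(1)] poly_funs.mult[OF B Q(1)]])
    moreover have "A (\<phi> y) = germ_value y a * Q (\<phi> y)" "B (\<phi> y) = germ_value y a * T (\<phi> y)"
      using gv(2)[OF a pc[OF Q(1)]] gv(2)[OF a pc[OF T(1)]] eq eq' by (simp_all add: pv A B Q T)
    ultimately have "T (\<phi> y) * (?D A - germ_value y a * ?D Q) = Q (\<phi> y) * (?D B - germ_value y a * ?D T)"
      by (simp add: dir_deriv_mult[OF A T(1)] dir_deriv_mult[OF B Q(1)] algebra_simps)
    then show "c = (?D A - germ_value y a * ?D Q) / Q (\<phi> y)"
      using Q(2) T(2) by (simp add: c field_simps)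
  qed (use that in blast)
  have "derivation ?S (range (const_germ X y)) (residue_module y) \<delta>"
  proof (rule derivationI)
    fix a b assume ab: "a \<in> carrier ?S" "b \<in> carrier ?S"
    obtain A Q where A: "A \<in> poly_funs N" and Q: "Q \<in> poly_funs N" "Q (\<phi> y) \<noteq> 0"
      and eqa: "a \<otimes>\<^bsub>?S\<^esub> pgerm y Q = pgerm y A"
      using ab(1) by (rule stalk_fraction[OF y]) (rule that)
    obtain B T where B: "B \<in> poly_funs N" and T: "T \<in> poly_funs N" "T (\<phi> y) \<noteq> 0"
      and eqb: "b \<otimes>\<^bsub>?S\<^esub> pgerm y T = pgerm y B"
      using ab(2) by (rule stalk_fraction[OF y]) (rule that)
    \<comment> \<open>Sum and product are put over the common denominator Q T, where the formula for
      \<open>\<delta>\<close> can be evaluated.\<close>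
    note QT = poly_funs.mult[OF Q(1) T(1)]
    have QT0: "Q (\<phi> y) * T (\<phi> y) \<noteq> 0" using Q T by simp
    have val: "A (\<phi> y) = germ_value y a * Q (\<phi> y)" "B (\<phi> y) = germ_value y b * T (\<phi> y)"
      using gv(2)[OF ab(1) pc[OF Q(1)]] gv(2)[OF ab(2) pc[OF T(1)]] eqa eqb
      by (simp_all add: pv A B Q T)
    note p = pc[OF Q(1)] pc[OF T(1)] pc[OF A] pc[OF B]
    have "(a \<oplus>\<^bsub>?S\<^esub> b) \<otimes>\<^bsub>?S\<^esub> pgerm y (\<lambda>p. Q p * T p) =
        (a \<otimes>\<^bsub>?S\<^esub> pgerm y Q) \<otimes>\<^bsub>?S\<^esub> pgerm y T \<oplus>\<^bsub>?S\<^esub> (b \<otimes>\<^bsub>?S\<^esub> pgerm y T) \<otimes>\<^bsub>?S\<^esub> pgerm y Q"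
      using ab p by (simp add: pm Q T D.l_distr D.r_distr D.m_ac)
    also have "\<dots> = pgerm y (\<lambda>p. A p * T p + B p * Q p)"
      by (simp add: eqa eqb pm pa poly_funs.mult A B Q T)
    finally have "\<delta> (a \<oplus>\<^bsub>?S\<^esub> b) = (?D (\<lambda>p. A p * T p + B p * Q p) -
        germ_value y (a \<oplus>\<^bsub>?S\<^esub> b) * ?D (\<lambda>p. Q p * T p)) / (Q (\<phi> y) * T (\<phi> y))"
      using ab by (intro \<delta> D.a_closed poly_funs.add poly_funs.mult A B Q(1) T(1) QT0)
    then show "\<delta> (a \<oplus>\<^bsub>?S\<^esub> b) = \<delta> a \<oplus>\<^bsub>residue_module y\<^esub> \<delta> b"
      using Q(2) T(2) unfolding \<delta>[OF ab(1) A Q eqa] \<delta>[OF ab(2) B T eqb]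
      by (simp add: dir_deriv_add[OF poly_funs.mult[OF A T(1)] poly_funs.mult[OF B Q(1)]]
          dir_deriv_mult[OF A T(1)] dir_deriv_mult[OF B Q(1)] dir_deriv_mult[OF Q(1) T(1)]
          gv(1)[OF ab] val field_simps)
    have "(a \<otimes>\<^bsub>?S\<^esub> b) \<otimes>\<^bsub>?S\<^esub> pgerm y (\<lambda>p. Q p * T p) =
        (a \<otimes>\<^bsub>?S\<^esub> pgerm y Q) \<otimes>\<^bsub>?S\<^esub> (b \<otimes>\<^bsub>?S\<^esub> pgerm y T)"
      using ab p by (simp add: pm Q T D.m_ac)
    also have "\<dots> = pgerm y (\<lambda>p. A p * B p)"
      by (simp add: eqa eqb pm A B)
    finally have "\<delta> (a \<otimes>\<^bsub>?S\<^esub> b) = (?D (\<lambda>p. A p * B p) -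
        germ_value y (a \<otimes>\<^bsub>?S\<^esub> b) * ?D (\<lambda>p. Q p * T p)) / (Q (\<phi> y) * T (\<phi> y))"
      using ab by (intro \<delta> D.m_closed poly_funs.mult A B Q(1) T(1) QT0)
    then show "\<delta> (a \<otimes>\<^bsub>?S\<^esub> b) = a \<odot>\<^bsub>residue_module y\<^esub> \<delta> b \<oplus>\<^bsub>residue_module y\<^esub> b \<odot>\<^bsub>residue_module y\<^esub> \<delta> a"
      using Q(2) T(2) unfolding \<delta>[OF ab(1) A Q eqa] \<delta>[OF ab(2) B T eqb]
      by (simp add: dir_deriv_mult[OF A B] dir_deriv_mult[OF Q(1) T(1)] gv(2)[OF ab] val field_simps)
  next
    fix c assume "c \<in> range (const_germ X y)"
    then obtain k where c: "c = pgerm y (\<lambda>p. k)" using pgerm_const[OF y] by auto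
    have "\<delta> c = (?D (\<lambda>p. k) - germ_value y c * ?D (\<lambda>p. 1)) / 1"
      by (rule \<delta>) (simp_all add: c poly_funs.const pc pgerm_one[OF y])
    then show "\<delta> c = \<zero>\<^bsub>residue_module y\<^esub>" by simp
  qed simp
  then obtain e where e: "linear_map ?S (Omega_stalk X y) (residue_module y) e"
    "\<And>a. a \<in> carrier ?S \<Longrightarrow> e (d_stalk X y a) = \<delta> a"
    using D.derivation_lift[OF residue_module_module[OF yX]] by metis
  show ?thesis by (rule that[OF e(1)]) (simp add: e(2) \<delta>)
qed

text \<open>The tangent vectors at all points come from one polynomial vector, so wherever g is
  given by one fraction A/Q, the values on dg are those of one rational function.\<close>

lemma tangent_section_of_polynomials:
  assumes V: "opn V" "V \<subseteq> U" and v: "\<And>i. i < N \<Longrightarrow> v i \<in> poly_funs N"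
    and tangent: "\<And>y. y \<in> V \<Longrightarrow> tangent_vector y (\<lambda>i. v i (\<phi> y))"
  obtains \<theta> where "\<theta> \<in> tangent_sections X V"
    "\<And>f. f \<in> poly_funs N \<Longrightarrow> \<theta> V (d_section V (\<lambda>z\<in>V. f (\<phi> z))) =
      (\<lambda>z\<in>V. dir_deriv N (\<lambda>i. v i (\<phi> z)) f (\<phi> z))"
proof -
  have "\<exists>e. linear_map (stalk X y) (Omega_stalk X y) (residue_module y) e \<and>
    (\<forall>a A Q. a \<in> carrier (stalk X y) \<and> A \<in> poly_funs N \<and> Q \<in> poly_funs N \<and> Q (\<phi> y) \<noteq> 0 \<and>
      a \<otimes>\<^bsub>stalk X y\<^esub> pgerm y Q = pgerm y A \<longrightarrow>
      e (d_stalk X y a) = (dir_deriv N (\<lambda>i. v i (\<phi> y)) A (\<phi> y) -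
        germ_value y a * dir_deriv N (\<lambda>i. v i (\<phi> y)) Q (\<phi> y)) / Q (\<phi> y))" if y: "y \<in> V" for y
  proof -
    have yU: "y \<in> U" using y V by auto
    obtain e where "linear_map (stalk X y) (Omega_stalk X y) (residue_module y) e"
      "\<And>a A Q. a \<in> carrier (stalk X y) \<Longrightarrow> A \<in> poly_funs N \<Longrightarrow> Q \<in> poly_funs N \<Longrightarrow> Q (\<phi> y) \<noteq> 0 \<Longrightarrow>
        a \<otimes>\<^bsub>stalk X y\<^esub> pgerm y Q = pgerm y A \<Longrightarrow>
        e (d_stalk X y a) = (dir_deriv N (\<lambda>i. v i (\<phi> y)) A (\<phi> y) -
          germ_value y a * dir_deriv N (\<lambda>i. v i (\<phi> y)) Q (\<phi> y)) / Q (\<phi> y)"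
      using yU tangent[OF y] by (rule tangent_functional) (rule that)
    then show ?thesis by (intro exI[of _ e]) simp
  qed
  then obtain e where lin: "\<And>y. y \<in> V \<Longrightarrow> linear_map (stalk X y) (Omega_stalk X y) (residue_module y) (e y)"
    and e: "\<And>y a A Q. y \<in> V \<Longrightarrow> a \<in> carrier (stalk X y) \<Longrightarrow> A \<in> poly_funs N \<Longrightarrow> Q \<in> poly_funs N \<Longrightarrow>
      Q (\<phi> y) \<noteq> 0 \<Longrightarrow> a \<otimes>\<^bsub>stalk X y\<^esub> pgerm y Q = pgerm y A \<Longrightarrow>
      e y (d_stalk X y a) = (dir_deriv N (\<lambda>i. v i (\<phi> y)) A (\<phi> y) -
        germ_value y a * dir_deriv N (\<lambda>i. v i (\<phi> y)) Q (\<phi> y)) / Q (\<phi> y)"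
    by metis
  have dd: "(\<lambda>p. dir_deriv N (\<lambda>i. v i p) f p) \<in> poly_funs N" if "f \<in> poly_funs N" for f
    using that v by (rule dir_deriv_closed)
  have value_eq: "e y (d_section W g y) = (dir_deriv N (\<lambda>i. v i (\<phi> y)) A (\<phi> y) -
        g y * dir_deriv N (\<lambda>i. v i (\<phi> y)) Q (\<phi> y)) / Q (\<phi> y)"
    if W: "opn W" "W \<subseteq> V" "y \<in> W" "g \<in> reg X W" and A: "A \<in> poly_funs N" and Q: "Q \<in> poly_funs N"
      and Q0: "\<And>z. z \<in> W \<Longrightarrow> Q (\<phi> z) \<noteq> 0" and eq: "\<And>z. z \<in> W \<Longrightarrow> g z * Q (\<phi> z) = A (\<phi> z)" for W y g A Q
  proof -
    have yU: "y \<in> U" and yV: "y \<in> V" and WU: "W \<subseteq> U" using W V by auto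
    have "germ X y W g \<otimes>\<^bsub>stalk X y\<^esub> pgerm y Q = pgerm y A"
      by (rule germ_fraction[OF yU W(1,3) WU A Q W(4) eq])
    from e[OF yV germ_closed[OF W(1,3,4)] A Q Q0[OF W(3)] this] show ?thesis
      using W(3) germ_value_germ[OF W(1,3,4)] by (simp add: d_section_def)
  qed
  let ?\<theta> = "\<lambda>W s. \<lambda>y\<in>W. e y (s y)"
  show ?thesis
  proof (rule that[of ?\<theta>])
    show "?\<theta> \<in> tangent_sections X V"
    proof (rule tangent_section_of_pointwise[OF V(1) lin])
      fix W g assume W: "opn W" "W \<subseteq> V" and g: "g \<in> reg X W"
      have WU: "W \<subseteq> U" using W V by auto
      show "(\<lambda>y\<in>W. e y (d_section W g y)) \<in> reg X W"
      proof (rule reg_glue[OF W(1)])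
        fix y assume y: "y \<in> W"
        obtain T A Q where T: "opn T" "y \<in> T" "T \<subseteq> W" and A: "A \<in> poly_funs N" and Q: "Q \<in> poly_funs N"
          "\<And>z. z \<in> T \<Longrightarrow> Q (\<phi> z) \<noteq> 0" "\<And>z. z \<in> T \<Longrightarrow> g z = A (\<phi> z) / Q (\<phi> z)"
          using W(1) WU g y by (rule locally_fraction) (rule that)
        have TV: "T \<subseteq> V" "T \<subseteq> U" using T(3) W WU by auto
        \<comment> \<open>Numerator of the quotient rule, to be taken over Q Q.\<close>
        let ?A = "\<lambda>p. dir_deriv N (\<lambda>i. v i p) A p * Q p - A p * dir_deriv N (\<lambda>i. v i p) Q p"
        have "(\<lambda>z\<in>T. ?A (\<phi> z) / (\<lambda>p. Q p * Q p) (\<phi> z)) \<in> reg X T"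
          using Q(2) by (intro fraction_regular[OF _ _ T(1) TV(2)] poly_funs_diff poly_funs.mult dd A Q(1)) simp
        moreover have "restrict (\<lambda>y\<in>W. e y (d_section W g y)) T = (\<lambda>z\<in>T. ?A (\<phi> z) / (\<lambda>p. Q p * Q p) (\<phi> z))"
        proof
          fix z
          show "restrict (\<lambda>y\<in>W. e y (d_section W g y)) T z = (\<lambda>z\<in>T. ?A (\<phi> z) / (\<lambda>p. Q p * Q p) (\<phi> z)) z"
          proof (cases "z \<in> T")
            case True
            then have zW: "z \<in> W" using T(3) by auto
            have "d_section W g z = d_section T (restrict g T) z"
              using True zW germ_restrict[OF T(1) True T(3), of g] by (simp add: d_section_def)
            then have "e z (d_section W g z) = (dir_deriv N (\<lambda>i. v i (\<phi> z)) A (\<phi> z) -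
                g z * dir_deriv N (\<lambda>i. v i (\<phi> z)) Q (\<phi> z)) / Q (\<phi> z)"
              using value_eq[OF T(1) TV(1) True reg_restrict[OF W(1) g T(1,3)] A Q(1,2)] Q(2,3) True by simp
            then show ?thesis
              using True zW Q(2,3)[OF True] by (simp add: field_simps)
          qed simp
        qed
        ultimately have "restrict (\<lambda>y\<in>W. e y (d_section W g y)) T \<in> reg X T" by (simp only:)
        with T show "\<exists>T. opn T \<and> y \<in> T \<and> T \<subseteq> W \<and> restrict (\<lambda>y\<in>W. e y (d_section W g y)) T \<in> reg X T"
          by blast
      qed simp
    qed
    fix f assume f: "f \<in> poly_funs N"
    show "?\<theta> V (d_section V (\<lambda>z\<in>V. f (\<phi> z))) = (\<lambda>z\<in>V. dir_deriv N (\<lambda>i. v i (\<phi> z)) f (\<phi> z))"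
    proof (rule restrict_ext)
      fix z assume z: "z \<in> V"
      \<comment> \<open>With denominator 1 the quotient rule reduces to the derivative of
        \<open>f\<close>.\<close>
      show "e z (d_section V (\<lambda>z\<in>V. f (\<phi> z)) z) = dir_deriv N (\<lambda>i. v i (\<phi> z)) f (\<phi> z)"
        using value_eq[OF V(1) order_refl z polynomial_regular[OF f V] f poly_funs.const[of 1]] by simp
    qed
  qed
qed

text \<open>Both sides are linear in the form, so the identity is tested on the coordinate
  differentials dx_i. There v_j(dx_i) = P_ij, and the sum over j of P_ij dx_j is E dx_i, because the
  remaining terms are combinations of differentials of equations. The forms b_j are dx_j divided by
  E.\<close>

lemma dual_basis:
  assumes x: "x \<in> U" and rank: "\<And>q. q \<in> Y \<Longrightarrow> jacobian_rank N F q = r"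
  shows "\<exists>V (n :: nat) v b. opn V \<and> x \<in> V \<and>
      (\<forall>j<n. v j \<in> tangent_sections X V \<and> b j \<in> carrier (Omega_stalk X x)) \<and>
      (\<forall>W s. opn W \<and> x \<in> W \<and> W \<subseteq> V \<and> s \<in> Omega_sections X W \<longrightarrow>
        s x = finsum (Omega_stalk X x) (\<lambda>j. germ X x W (v j W s) \<odot>\<^bsub>Omega_stalk X x\<^esub> b j) {..<n})"
proof -
  let ?S = "stalk X x" and ?\<Omega> = "Omega_stalk X x" and ?d = "d_stalk X x"
  interpret D: differentials ?S "range (const_germ X x)"
    by (rule stalk_differentials[OF openin_subset_topspace[OF open_domain x]])
  have F: "finite F" "F \<subseteq> poly_funs N" and F0: "\<And>f q. f \<in> F \<Longrightarrow> q \<in> Y \<Longrightarrow> f q = 0"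
    using equations by (auto simp: ideal_generators_def vanishing_ideal_def)
  obtain H E P c where H: "H \<subseteq> F" and E: "E \<in> poly_funs N" "E (\<phi> x) \<noteq> 0"
    and P: "\<And>i j. i < N \<Longrightarrow> j < N \<Longrightarrow> P i j \<in> poly_funs N" and c: "\<And>i f. i < N \<Longrightarrow> f \<in> H \<Longrightarrow> c i f \<in> poly_funs N"
    and split: "\<And>q i j. i < N \<Longrightarrow> j < N \<Longrightarrow> (if i = j then E q else 0) = P i j q + (\<Sum>f\<in>H. c i f q * pd j f q)"
    and tangent: "\<And>q f j. q \<in> Y \<Longrightarrow> E q \<noteq> 0 \<Longrightarrow> f \<in> F \<Longrightarrow> j < N \<Longrightarrow> dir_deriv N (\<lambda>i. P i j q) f q = 0"
    by (rule constant_rank_projection[OF F chart_closed[OF x]]) (erule rank, rule that)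
  \<comment> \<open>Here the columns of \<open>P\<close> are tangent and \<open>E\<close> is
    invertible.\<close>
  let ?V = "{y \<in> U. E (\<phi> y) \<noteq> 0}"
  have V: "opn ?V" "x \<in> ?V" "?V \<subseteq> U" using nonvanishing_open[OF E(1)] E(2) x by auto
  have "\<exists>\<theta>. \<theta> \<in> tangent_sections X ?V \<and> (\<forall>f\<in>poly_funs N. \<theta> ?V (d_section ?V (\<lambda>z\<in>?V. f (\<phi> z))) =
      (\<lambda>z\<in>?V. dir_deriv N (\<lambda>i. P i j (\<phi> z)) f (\<phi> z)))" if j: "j < N" for j
  proof -
    have tv: "tangent_vector y (\<lambda>i. P i j (\<phi> y))" if "y \<in> ?V" for y
      using that tangent chart_closed j by (simp add: tangent_vector_def)
    obtain \<theta> where "\<theta> \<in> tangent_sections X ?V" "\<And>f. f \<in> poly_funs N \<Longrightarrow>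
        \<theta> ?V (d_section ?V (\<lambda>z\<in>?V. f (\<phi> z))) = (\<lambda>z\<in>?V. dir_deriv N (\<lambda>i. P i j (\<phi> z)) f (\<phi> z))"
      by (rule tangent_section_of_polynomials[where v = "\<lambda>i. P i j", OF V(1,3)])
        (erule P[OF _ j], erule tv, rule that)
    then show ?thesis by (intro exI[of _ \<theta>]) simp
  qed
  then have "\<forall>j. \<exists>\<theta>. j < N \<longrightarrow> \<theta> \<in> tangent_sections X ?V \<and>
      (\<forall>f\<in>poly_funs N. \<theta> ?V (d_section ?V (\<lambda>z\<in>?V. f (\<phi> z))) =
        (\<lambda>z\<in>?V. dir_deriv N (\<lambda>i. P i j (\<phi> z)) f (\<phi> z)))" by simp
  from choice[OF this] obtain \<theta> where "\<forall>j<N. \<theta> j \<in> tangent_sections X ?V \<and>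
      (\<forall>f\<in>poly_funs N. \<theta> j ?V (d_section ?V (\<lambda>z\<in>?V. f (\<phi> z))) =
        (\<lambda>z\<in>?V. dir_deriv N (\<lambda>i. P i j (\<phi> z)) f (\<phi> z)))" ..
  then have \<theta>: "\<And>j. j < N \<Longrightarrow> \<theta> j \<in> tangent_sections X ?V"
    and \<theta>_d: "\<And>j f. j < N \<Longrightarrow> f \<in> poly_funs N \<Longrightarrow> \<theta> j ?V (d_section ?V (\<lambda>z\<in>?V. f (\<phi> z))) =
      (\<lambda>z\<in>?V. dir_deriv N (\<lambda>i. P i j (\<phi> z)) f (\<phi> z))"
    by simp_all
  \<comment> \<open>The vector fields as linear functionals on the stalk, so that linear maps on
    germs of forms can be compared.\<close>
  have "\<exists>v'. linear_map ?S ?\<Omega> (regular_module ?S) v' \<and> (\<forall>W s. opn W \<and> x \<in> W \<and> W \<subseteq> ?V \<and>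
      s \<in> Omega_sections X W \<longrightarrow> v' (s x) = germ X x W (\<theta> j W s))" if j: "j < N" for j
  proof -
    obtain v' where "linear_map ?S ?\<Omega> (regular_module ?S) v'"
      "\<And>W s. opn W \<Longrightarrow> x \<in> W \<Longrightarrow> W \<subseteq> ?V \<Longrightarrow> s \<in> Omega_sections X W \<Longrightarrow> v' (s x) = germ X x W (\<theta> j W s)"
      using \<theta>[OF j] V(1,2) by (rule tangent_stalk_map) (rule that)
    then show ?thesis by (intro exI[of _ v']) simp
  qed
  then have "\<forall>j. \<exists>v'. j < N \<longrightarrow> linear_map ?S ?\<Omega> (regular_module ?S) v' \<and> (\<forall>W s. opn W \<and> x \<in> W \<and> W \<subseteq> ?V \<and>
      s \<in> Omega_sections X W \<longrightarrow> v' (s x) = germ X x W (\<theta> j W s))" by simp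
  from choice[OF this] obtain v where "\<forall>j<N. linear_map ?S ?\<Omega> (regular_module ?S) (v j) \<and>
      (\<forall>W s. opn W \<and> x \<in> W \<and> W \<subseteq> ?V \<and> s \<in> Omega_sections X W \<longrightarrow> v j (s x) = germ X x W (\<theta> j W s))" ..
  then have v: "\<And>j. j < N \<Longrightarrow> linear_map ?S ?\<Omega> (regular_module ?S) (v j)"
    and v_section: "\<And>j W s. j < N \<Longrightarrow> opn W \<Longrightarrow> x \<in> W \<Longrightarrow> W \<subseteq> ?V \<Longrightarrow> s \<in> Omega_sections X W \<Longrightarrow>
      v j (s x) = germ X x W (\<theta> j W s)"
    by simp_all
  note pg = pgerm_closed[OF x]
  have v_d: "v j (?d (pgerm x f)) = pgerm x (\<lambda>p. dir_deriv N (\<lambda>i. P i j p) f p)"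
    if j: "j < N" and f: "f \<in> poly_funs N" for j f
  proof -
    have r: "(\<lambda>z\<in>?V. f (\<phi> z)) \<in> reg X ?V" by (rule polynomial_regular[OF f V(1,3)])
    have restr: "pgerm x g = germ X x ?V (\<lambda>z\<in>?V. g (\<phi> z))" for g
      unfolding pgerm_def by (rule germ_eqI[of X ?V]) (use V in auto)
    have "?d (pgerm x f) = d_section ?V (\<lambda>z\<in>?V. f (\<phi> z)) x"
      unfolding restr using V(2) by (simp add: d_section_def del: restrict_apply mem_Collect_eq add: restrict_apply')
    then have "v j (?d (pgerm x f)) = germ X x ?V (\<theta> j ?V (d_section ?V (\<lambda>z\<in>?V. f (\<phi> z))))"
      using v_section[OF j V(1,2) order_refl d_section_section(1)[OF V(1) r r]] by (simp only:)
    then show ?thesis unfolding restr \<theta>_d[OF j f] .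
  qed
  define x' where "x' j = ?d (pgerm x (\<lambda>p. p j))" for j
  have x': "x' j \<in> carrier ?\<Omega>" if "j < N" for j
    unfolding x'_def by (rule D.kaehler_d_simps(1)[OF pg[OF poly_funs.coord[OF that]]])
  \<comment> \<open>The form with polynomial coefficient vector \<open>u\<close> in the coordinate
    differentials. Linearity in \<open>u\<close> carries the polynomial matrix identity over to
    forms.\<close>
  define \<Phi> where "\<Phi> u = finsum ?\<Omega> (\<lambda>j. pgerm x (u j) \<odot>\<^bsub>?\<Omega>\<^esub> x' j) {..<N}" for u
  have \<Phi>_closed: "\<Phi> u \<in> carrier ?\<Omega>" if "\<And>j. j < N \<Longrightarrow> u j \<in> poly_funs N" for u
    unfolding \<Phi>_def using that pg x' by (intro D.\<Omega>.M.finsum_closed) auto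
  have \<Phi>_cong: "\<Phi> u = \<Phi> w" if "\<And>j. j < N \<Longrightarrow> u j = w j" "\<And>j. j < N \<Longrightarrow> w j \<in> poly_funs N" for u w
    unfolding \<Phi>_def using that pg x' by (intro D.\<Omega>.M.finsum_cong') auto
  have \<Phi>_add: "\<Phi> (\<lambda>j p. u j p + w j p) = \<Phi> u \<oplus>\<^bsub>?\<Omega>\<^esub> \<Phi> w"
    if u: "\<And>j. j < N \<Longrightarrow> u j \<in> poly_funs N" and w: "\<And>j. j < N \<Longrightarrow> w j \<in> poly_funs N" for u w
  proof -
    have "\<Phi> (\<lambda>j p. u j p + w j p) =
        finsum ?\<Omega> (\<lambda>j. pgerm x (u j) \<odot>\<^bsub>?\<Omega>\<^esub> x' j \<oplus>\<^bsub>?\<Omega>\<^esub> pgerm x (w j) \<odot>\<^bsub>?\<Omega>\<^esub> x' j) {..<N}"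
      unfolding \<Phi>_def using u w pg x'
      by (intro D.\<Omega>.M.finsum_cong') (auto simp: pgerm_add[OF x] D.\<Omega>.smult_l_distr)
    also have "\<dots> = \<Phi> u \<oplus>\<^bsub>?\<Omega>\<^esub> \<Phi> w"
      unfolding \<Phi>_def using u w pg x' by (intro D.\<Omega>.M.finsum_addf) auto
    finally show ?thesis .
  qed
  have \<Phi>_mult: "\<Phi> (\<lambda>j p. g p * u j p) = pgerm x g \<odot>\<^bsub>?\<Omega>\<^esub> \<Phi> u"
    if g: "g \<in> poly_funs N" and u: "\<And>j. j < N \<Longrightarrow> u j \<in> poly_funs N" for g u
  proof -
    have "\<Phi> (\<lambda>j p. g p * u j p) = finsum ?\<Omega> (\<lambda>j. pgerm x g \<odot>\<^bsub>?\<Omega>\<^esub> (pgerm x (u j) \<odot>\<^bsub>?\<Omega>\<^esub> x' j)) {..<N}"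
      unfolding \<Phi>_def using u g pg x'
      by (intro D.\<Omega>.M.finsum_cong') (auto simp: pgerm_mult[OF x] D.\<Omega>.smult_assoc1)
    also have "\<dots> = pgerm x g \<odot>\<^bsub>?\<Omega>\<^esub> \<Phi> u"
      unfolding \<Phi>_def using u g pg x' by (intro D.\<Omega>.finsum_smult_ldistr[symmetric]) auto
    finally show ?thesis .
  qed
  have \<Phi>_zero: "\<Phi> (\<lambda>j p. 0) = \<zero>\<^bsub>?\<Omega>\<^esub>"
    using \<Phi>_mult[of "\<lambda>p. 0" "\<lambda>j p. 0"] D.\<Omega>.smult_l_null[OF \<Phi>_closed[of "\<lambda>j p. 0"]]
    by (simp add: poly_funs.const pgerm_zero[OF x])
  have \<Phi>_delta: "\<Phi> (\<lambda>j p. if i = j then g p else 0) = pgerm x g \<odot>\<^bsub>?\<Omega>\<^esub> x' i"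
    if i: "i < N" and g: "g \<in> poly_funs N" for i g
  proof -
    have "\<Phi> (\<lambda>j p. if i = j then g p else 0) =
        finsum ?\<Omega> (\<lambda>j. if i = j then pgerm x g \<odot>\<^bsub>?\<Omega>\<^esub> x' j else \<zero>\<^bsub>?\<Omega>\<^esub>) {..<N}"
      unfolding \<Phi>_def using g pg x'
      by (intro D.\<Omega>.M.finsum_cong') (auto simp: pgerm_zero[OF x])
    also have "\<dots> = pgerm x g \<odot>\<^bsub>?\<Omega>\<^esub> x' i"
      using i g pg x' by (intro D.\<Omega>.M.add.finprod_singleton) auto
    finally show ?thesis .
  qed
  \<comment> \<open>The total differential, by induction over the generation of polynomials.\<close>
  have d_poly: "?d (pgerm x f) = \<Phi> (\<lambda>j. pd j f)" if "f \<in> poly_funs N" for f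
    using that
  proof induction
    case (const k)
    have "\<Phi> (\<lambda>j. pd j (\<lambda>p. k)) = \<Phi> (\<lambda>j p. 0)"
      by (rule \<Phi>_cong) (simp_all add: fun_eq_iff poly_funs.const)
    then show ?case unfolding pgerm_const[OF x] by (simp add: D.kaehler_d_simps(4) \<Phi>_zero)
  next
    case (coord i)
    have "\<Phi> (\<lambda>j. pd j (\<lambda>p. p i)) = \<Phi> (\<lambda>j p. if i = j then (\<lambda>p. 1) p else 0)"
      by (rule \<Phi>_cong) (auto simp: fun_eq_iff pd_coord poly_funs.const)
    also have "\<dots> = pgerm x (\<lambda>p. 1) \<odot>\<^bsub>?\<Omega>\<^esub> x' i"
      by (rule \<Phi>_delta[OF coord poly_funs.const])
    finally show ?case using x'[OF coord] by (simp add: pgerm_one[OF x] x'_def)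
  next
    case (add f g)
    have "\<Phi> (\<lambda>j. pd j (\<lambda>p. f p + g p)) = \<Phi> (\<lambda>j p. pd j f p + pd j g p)"
      by (rule \<Phi>_cong) (simp_all add: fun_eq_iff pd_add[OF add.hyps] poly_funs.add pd_closed add.hyps)
    then show ?case
      using add by (simp add: \<Phi>_add pd_closed pgerm_add[OF x] D.kaehler_d_simps pg)
  next
    case (mult f g)
    have "\<Phi> (\<lambda>j. pd j (\<lambda>p. f p * g p)) = \<Phi> (\<lambda>j p. (\<lambda>j p. f p * pd j g p) j p + (\<lambda>j p. g p * pd j f p) j p)"
      by (rule \<Phi>_cong)
        (simp_all add: fun_eq_iff pd_mult[OF mult.hyps] poly_funs.add poly_funs.mult pd_closed mult.hyps mult.commute)
    also have "\<dots> = \<Phi> (\<lambda>j p. f p * pd j g p) \<oplus>\<^bsub>?\<Omega>\<^esub> \<Phi> (\<lambda>j p. g p * pd j f p)"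
      by (rule \<Phi>_add) (simp_all add: poly_funs.mult pd_closed mult.hyps)
    finally show ?case
      using mult by (simp add: \<Phi>_mult pd_closed pgerm_mult[OF x] D.kaehler_d_simps pg)
  qed
  \<comment> \<open>Equations vanish on \<open>Y\<close>, so their germs are zero, and so are their
    differentials.\<close>
  have d_equation: "\<Phi> (\<lambda>j. pd j f) = \<zero>\<^bsub>?\<Omega>\<^esub>" if f: "f \<in> H" for f
  proof -
    have f': "f \<in> F" "f \<in> poly_funs N" using f H F(2) by auto
    have "pgerm x f = pgerm x (\<lambda>p. 0)"
      unfolding pgerm_def by (rule germ_cong[OF open_domain x]) (simp add: F0[OF f'(1)] chart_closed)
    then have "?d (pgerm x f) = \<zero>\<^bsub>?\<Omega>\<^esub>" by (simp add: pgerm_const[OF x] D.kaehler_d_simps(4))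
    then show ?thesis using d_poly[OF f'(2)] by simp
  qed
  have combination: "\<Phi> (\<lambda>j p. \<Sum>f\<in>A. c i f p * pd j f p) = \<zero>\<^bsub>?\<Omega>\<^esub>" if i: "i < N" and "A \<subseteq> H" for i A
    using finite_subset[OF that(2) finite_subset[OF H F(1)]] that(2)
  proof (induction A rule: finite_induct)
    case empty
    then show ?case by (simp add: \<Phi>_zero)
  next
    case (insert f A)
    then have f: "f \<in> H" "f \<in> poly_funs N" and A: "\<And>f. f \<in> A \<Longrightarrow> f \<in> H \<and> f \<in> poly_funs N" using H F(2) by auto
    have "\<Phi> (\<lambda>j p. \<Sum>f\<in>insert f A. c i f p * pd j f p) =
        \<Phi> (\<lambda>j p. (\<lambda>j p. c i f p * pd j f p) j p + (\<lambda>j p. \<Sum>f\<in>A. c i f p * pd j f p) j p)"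
      using insert.hyps by simp
    also have "\<dots> = \<Phi> (\<lambda>j p. c i f p * pd j f p) \<oplus>\<^bsub>?\<Omega>\<^esub> \<Phi> (\<lambda>j p. \<Sum>f\<in>A. c i f p * pd j f p)"
      using f A i by (intro \<Phi>_add) (simp_all add: poly_funs.mult poly_funs_sum pd_closed c)
    also have "\<dots> = \<zero>\<^bsub>?\<Omega>\<^esub>"
      using insert.IH insert.prems f i pg by (simp add: \<Phi>_mult c pd_closed d_equation)
    finally show ?case .
  qed
  \<comment> \<open>The splitting identity with differentials in place of gradients; the combination
    of equations drops out.\<close>
  have projection: "\<Phi> (P i) = pgerm x E \<odot>\<^bsub>?\<Omega>\<^esub> x' i" if i: "i < N" for i
  proof -
    have "pgerm x E \<odot>\<^bsub>?\<Omega>\<^esub> x' i = \<Phi> (\<lambda>j p. if i = j then E p else 0)"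
      by (rule \<Phi>_delta[OF i E(1), symmetric])
    also have "\<dots> = \<Phi> (\<lambda>j p. P i j p + (\<lambda>j p. \<Sum>f\<in>H. c i f p * pd j f p) j p)"
      using i H F(2) by (intro \<Phi>_cong ext poly_funs.add P poly_funs_sum poly_funs.mult c pd_closed)
        (auto simp: split)
    also have "\<dots> = \<Phi> (P i) \<oplus>\<^bsub>?\<Omega>\<^esub> \<Phi> (\<lambda>j p. \<Sum>f\<in>H. c i f p * pd j f p)"
      using i H F(2) by (intro \<Phi>_add P poly_funs_sum poly_funs.mult c pd_closed) auto
    also have "\<dots> = \<Phi> (P i)"
      using combination[OF i order_refl] \<Phi>_closed[of "P i"] P[OF i] by simp
    finally show ?thesis by simp
  qed
  \<comment> \<open>\<open>E\<close> is a unit of the stalk because it is nonzero at the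
    point.\<close>
  obtain E' where E': "E' \<in> carrier ?S" "E' \<otimes>\<^bsub>?S\<^esub> pgerm x E = \<one>\<^bsub>?S\<^esub>"
    using E by (rule pgerm_unit[OF x]) (rule that)
  define b where "b j = E' \<odot>\<^bsub>?\<Omega>\<^esub> x' j" for j
  have b: "b j \<in> carrier ?\<Omega>" if "j < N" for j unfolding b_def using E'(1) x'[OF that] by simp
  define L where "L \<eta> = finsum ?\<Omega> (\<lambda>j. v j \<eta> \<odot>\<^bsub>?\<Omega>\<^esub> b j) {..<N}" for \<eta>
  have L: "linear_map ?S ?\<Omega> ?\<Omega> L"
    unfolding L_def[abs_def]
  proof (rule linear_map_finsum_maps[OF D.kaehler_module D.kaehler_module])
    fix j assume j: "j < N"
    have "linear_map ?S (regular_module ?S) ?\<Omega> (\<lambda>r. r \<odot>\<^bsub>?\<Omega>\<^esub> b j)"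
      by (rule linear_mapI) (use b[OF j] in \<open>simp_all add: D.\<Omega>.smult_l_distr D.\<Omega>.smult_assoc1\<close>)
    then show "linear_map ?S ?\<Omega> ?\<Omega> (\<lambda>\<eta>. v j \<eta> \<odot>\<^bsub>?\<Omega>\<^esub> b j)" by (rule linear_map_comp[OF v[OF j]])
  qed
  have L_coord: "L (x' i) = x' i" if i: "i < N" for i
  proof -
    have "L (x' i) = finsum ?\<Omega> (\<lambda>j. E' \<odot>\<^bsub>?\<Omega>\<^esub> (pgerm x (P i j) \<odot>\<^bsub>?\<Omega>\<^esub> x' j)) {..<N}"
      unfolding L_def
    proof (rule D.\<Omega>.M.finsum_cong')
      fix j assume "j \<in> {..<N}"
      then have j: "j < N" by simp
      have "(\<lambda>p. dir_deriv N (\<lambda>i. P i j p) (\<lambda>p. p i) p) = P i j"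
        by (rule ext) (rule dir_deriv_coord[OF i])
      then have "v j (x' i) = pgerm x (P i j)"
        using v_d[OF j poly_funs.coord[OF i]] by (simp add: x'_def)
      then show "v j (x' i) \<odot>\<^bsub>?\<Omega>\<^esub> b j = E' \<odot>\<^bsub>?\<Omega>\<^esub> (pgerm x (P i j) \<odot>\<^bsub>?\<Omega>\<^esub> x' j)"
        using E'(1) pg[OF P[OF i j]] x'[OF j] by (simp add: b_def D.\<Omega>.smult_assoc1[symmetric] D.m_comm)
    qed (use E'(1) pg P[OF i] x' in auto)
    also have "\<dots> = E' \<odot>\<^bsub>?\<Omega>\<^esub> \<Phi> (P i)"
      unfolding \<Phi>_def using E'(1) pg P[OF i] x' by (intro D.\<Omega>.finsum_smult_ldistr[symmetric]) auto
    also have "\<dots> = x' i"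
      using E' pg[OF E(1)] x'[OF i] by (simp add: projection[OF i] D.\<Omega>.smult_assoc1[symmetric])
    finally show ?thesis .
  qed
  have identity: "linear_map ?S ?\<Omega> ?\<Omega> (\<lambda>\<eta>. \<eta>)"
    by (rule linear_mapI) (assumption | rule refl)+
  \<comment> \<open>\<open>L\<close> and the identity agree on coordinate differentials;
    \<open>derivations_agree\<close> extends this to all exact germs, and these generate the
    module.\<close>
  have L_id: "\<eta> = L \<eta>" if "\<eta> \<in> carrier ?\<Omega>" for \<eta>
  proof (rule D.kaehler_linear_eq[OF D.kaehler_module identity L _ that])
    fix a assume a: "a \<in> carrier ?S"
    show "?d a = L (?d a)"
      by (rule derivations_agree[OF x D.kaehler_module D.kaehler_d_derivation
          derivation_comp[OF D.kaehler_module D.kaehler_module D.kaehler_d_derivation L] _ a])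
        (simp add: L_coord[unfolded x'_def])
  qed
  show ?thesis
  proof (intro exI[of _ ?V] exI[of _ N] exI[of _ \<theta>] exI[of _ b] conjI allI impI)
    fix W s assume W: "opn W \<and> x \<in> W \<and> W \<subseteq> ?V \<and> s \<in> Omega_sections X W"
    have s: "s x \<in> carrier ?\<Omega>" using W Omega_section_closed by blast
    have "s x = L (s x)" by (rule L_id[OF s])
    also have "\<dots> = finsum ?\<Omega> (\<lambda>j. germ X x W (\<theta> j W s) \<odot>\<^bsub>?\<Omega>\<^esub> b j) {..<N}"
      unfolding L_def
    proof (rule D.\<Omega>.M.finsum_cong')
      fix j assume "j \<in> {..<N}"
      then have j: "j < N" by simp
      have eq: "v j (s x) = germ X x W (\<theta> j W s)" using v_section[OF j] W by blast
      then show "v j (s x) \<odot>\<^bsub>?\<Omega>\<^esub> b j = germ X x W (\<theta> j W s) \<odot>\<^bsub>?\<Omega>\<^esub> b j" by simp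
    next
      show "(\<lambda>j. germ X x W (\<theta> j W s) \<odot>\<^bsub>?\<Omega>\<^esub> b j) \<in> {..<N} \<rightarrow> carrier ?\<Omega>"
      proof
        fix j assume "j \<in> {..<N}"
        then have j: "j < N" by simp
        have eq: "v j (s x) = germ X x W (\<theta> j W s)" using v_section[OF j] W by blast
        have "v j (s x) \<in> carrier ?S" using linear_map_closed[OF v[OF j] s] by simp
        then show "germ X x W (\<theta> j W s) \<odot>\<^bsub>?\<Omega>\<^esub> b j \<in> carrier ?\<Omega>"
          using b[OF j] by (simp flip: eq)
      qed
    qed simp
    finally show "s x = finsum ?\<Omega> (\<lambda>j. germ X x W (\<theta> j W s) \<odot>\<^bsub>?\<Omega>\<^esub> b j) {..<N}" .
  qed (use V \<theta> b in auto)
qed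

end

theorem proposition3p12:
  fixes X :: "'a fspace"
    and L :: "('a, 'l) mod_presheaf"
    and \<omega> :: "'a set \<Rightarrow> 'l \<Rightarrow> 'a \<Rightarrow> 'a cotangent"
  assumes "smooth_variety X"
    and "codim1_foliation X L \<omega>"
    and "openin (zar X) U"
  shows "sing_ideal X L \<omega> U \<subseteq> persistent_ideal X L \<omega> U \<and>
         persistent_ideal X L \<omega> U \<subseteq> kupka_ideal X L \<omega> U"
proof -
  interpret twisted_form X L \<omega>
    using assms(1,2)
    by unfold_locales
      (simp_all add: smooth_variety_def algebraic_variety_def codim1_foliation_def line_bundle_def)
  have "\<exists>V (n :: nat) v b. openin (zar X) V \<and> x \<in> V \<and>
      (\<forall>j<n. v j \<in> tangent_sections X V \<and> b j \<in> carrier (Omega_stalk X x)) \<and>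
      (\<forall>W s. openin (zar X) W \<and> x \<in> W \<and> W \<subseteq> V \<and> s \<in> Omega_sections X W \<longrightarrow>
        s x = finsum (Omega_stalk X x) (\<lambda>j. germ X x W (v j W s) \<odot>\<^bsub>Omega_stalk X x\<^esub> b j) {..<n})"
    if x: "x \<in> topspace (zar X)" for x
  proof -
    obtain A N Y \<phi> F d where A: "affine_chart X A N Y \<phi>" "x \<in> A" "ideal_generators N F (vanishing_ideal N Y)"
      and rank: "\<forall>p\<in>Y. jacobian_rank N F p + d = N"
      using assms(1) x unfolding smooth_variety_def by blast
    interpret chart_with_equations X A N Y \<phi> F by unfold_locales (rule A)+
    show ?thesis
      \<comment> \<open>The criterion gives rank + d = N at every point of \<open>Y\<close>, so the
        rank there is the constant \<open>N - d\<close> and the natural subtraction does not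
        truncate.\<close>
      by (rule dual_basis[OF A(2), of "N - d"]) (use rank in force)
  qed
  then have "persistent_ideal X L \<omega> U \<subseteq> kupka_ideal X L \<omega> U"
    by (rule persistent_subset_kupka[OF _ assms(3)])
  moreover have "sing_ideal X L \<omega> U \<subseteq> persistent_ideal X L \<omega> U"
    using assms(2) unfolding codim1_foliation_def by (intro sing_subset_persistent[OF _ assms(3)]) simp
  ultimately show ?thesis by simp
qed

end
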